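(* Let $m\ge 2$ and let $s_1,\dots,s_m$ be strings, each of length $n$, over an alphabet $\Sigma$, such that $\mathcal{L}(s_1,\dots,s_m)=\lambda n$ for some $\lambda\in[0,1]$. For every arbitrarily small constant $\epsilon>0$ there is an algorithm that computes a $\frac{\lambda}{2+\epsilon}$-approximation of $\mathcal{L}(s_1,\dots,s_m)$, i.e. returns a common subsequence of $s_1,\dots,s_m$ of length at least $\frac{\lambda}{2+\epsilon}\mathcal{L}(s_1,\dots,s_m)=\frac{\lambda^2 n}{2+\epsilon}$, in time $\tilde{O}_m(n^{\lfloor m/2\rfloor+1})$.
   Context: $\mathcal{L}(s_1,\dots,s_m)$ denotes the length of a longest common subsequence of $s_1,\dots,s_m$ (a longest sequence that is a subsequence of every $s_i$). The notation $\tilde{O}_m(\cdot)$ hides factors of the form $c^m\log^m n$ with $c$ a constant, as well as polylogarithmic factors. *)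

theory Defs
  imports Complex_Main "HOL-Library.Sublist" "HOL-Library.Log_Nat"
begin

section \<open>Longest common subsequences\<close>

definition common_subseq :: "'a list \<Rightarrow> 'a list list \<Rightarrow> bool" where
  "common_subseq t S \<longleftrightarrow> (\<forall>s\<in>set S. subseq t s)"

definition lcs_length :: "'a list list \<Rightarrow> nat" where
  "lcs_length S = Max (length ` {t. common_subseq t S})"

section \<open>Random access machines with logarithmic cost\<close>

text \<open>
  Programs are structured programs for a random access machine with registers, an unbounded
  indirectly addressed memory of natural numbers, a read-only input (a list of strings) and a
  write-only output string.  A program does not mention the alphabet: symbols of the input can only
  be tested for equality and copied to the output.

  In the expressions, \<open>SymEq i p j q\<close> tests whether symbol \<open>p\<close> of string \<open>i\<close> equals symbol \<open>q\<close> of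
  string \<open>j\<close> (counting from 0), and truth values are 0 and 1.
\<close>

datatype aexp =
    Num nat
  | Reg nat
  | Mem aexp
  | Plus aexp aexp
  | Monus aexp aexp
  | Times aexp aexp
  | Quot aexp aexp
  | Less aexp aexp
  | SymEq aexp aexp aexp aexp

datatype prog =
    Skip
  | Assign nat aexp
  | Store aexp aexp
  | Emit aexp aexp
  | Seq prog prog
  | Cond aexp prog prog
  | While aexp prog

record 'a state =
  regs :: "nat \<Rightarrow> nat"
  mem :: "nat \<Rightarrow> nat"
  outp :: "'a list"

definition valid_pos :: "'a list list \<Rightarrow> nat \<Rightarrow> nat \<Rightarrow> bool" where
  "valid_pos S i p \<longleftrightarrow> i < length S \<and> p < length (S ! i)"

fun aval :: "'a list list \<Rightarrow> 'a state \<Rightarrow> aexp \<Rightarrow> nat" where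
  "aval S \<sigma> (Num k) = k"
| "aval S \<sigma> (Reg r) = regs \<sigma> r"
| "aval S \<sigma> (Mem a) = mem \<sigma> (aval S \<sigma> a)"
| "aval S \<sigma> (Plus a b) = aval S \<sigma> a + aval S \<sigma> b"
| "aval S \<sigma> (Monus a b) = aval S \<sigma> a - aval S \<sigma> b"
| "aval S \<sigma> (Times a b) = aval S \<sigma> a * aval S \<sigma> b"
| "aval S \<sigma> (Quot a b) = aval S \<sigma> a div aval S \<sigma> b"
| "aval S \<sigma> (Less a b) = (if aval S \<sigma> a < aval S \<sigma> b then 1 else 0)"
| "aval S \<sigma> (SymEq a b c d) =
     (if valid_pos S (aval S \<sigma> a) (aval S \<sigma> b) \<and> valid_pos S (aval S \<sigma> c) (aval S \<sigma> d) \<and>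
         S ! aval S \<sigma> a ! aval S \<sigma> b = S ! aval S \<sigma> c ! aval S \<sigma> d
      then 1 else 0)"

text \<open>
  Every node of an expression costs one unit plus the number of binary digits of its value
  (\<open>floorlog 2\<close> is the binary length).  Operands and addresses are charged because they are
  themselves nodes.
\<close>

fun acost :: "'a list list \<Rightarrow> 'a state \<Rightarrow> aexp \<Rightarrow> nat" where
  "acost S \<sigma> (Num k) = 1 + floorlog 2 k"
| "acost S \<sigma> (Reg r) = 1 + floorlog 2 (regs \<sigma> r)"
| "acost S \<sigma> (Mem a) = 1 + floorlog 2 (aval S \<sigma> (Mem a)) + acost S \<sigma> a"
| "acost S \<sigma> (Plus a b) = 1 + floorlog 2 (aval S \<sigma> (Plus a b)) + acost S \<sigma> a + acost S \<sigma> b"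
| "acost S \<sigma> (Monus a b) = 1 + floorlog 2 (aval S \<sigma> (Monus a b)) + acost S \<sigma> a + acost S \<sigma> b"
| "acost S \<sigma> (Times a b) = 1 + floorlog 2 (aval S \<sigma> (Times a b)) + acost S \<sigma> a + acost S \<sigma> b"
| "acost S \<sigma> (Quot a b) = 1 + floorlog 2 (aval S \<sigma> (Quot a b)) + acost S \<sigma> a + acost S \<sigma> b"
| "acost S \<sigma> (Less a b) = 1 + floorlog 2 (aval S \<sigma> (Less a b)) + acost S \<sigma> a + acost S \<sigma> b"
| "acost S \<sigma> (SymEq a b c d) = 1 + floorlog 2 (aval S \<sigma> (SymEq a b c d))
     + acost S \<sigma> a + acost S \<sigma> b + acost S \<sigma> c + acost S \<sigma> d"

text \<open>
  \<open>exec S c \<sigma> t \<tau>\<close>: on input \<open>S\<close>, the program \<open>c\<close> started in state \<open>\<sigma>\<close> halts in state \<open>\<tau>\<close> at total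
  cost \<open>t\<close>.
\<close>

inductive exec :: "'a list list \<Rightarrow> prog \<Rightarrow> 'a state \<Rightarrow> nat \<Rightarrow> 'a state \<Rightarrow> bool"
  for S :: "'a list list" where
  Skip: "exec S Skip \<sigma> 1 \<sigma>"
| Assign: "exec S (Assign r a) \<sigma> (1 + acost S \<sigma> a) (\<sigma>\<lparr>regs := (regs \<sigma>)(r := aval S \<sigma> a)\<rparr>)"
| Store: "exec S (Store a b) \<sigma> (1 + acost S \<sigma> a + acost S \<sigma> b)
    (\<sigma>\<lparr>mem := (mem \<sigma>)(aval S \<sigma> a := aval S \<sigma> b)\<rparr>)"
| Emit: "valid_pos S (aval S \<sigma> a) (aval S \<sigma> b) \<Longrightarrow>
    exec S (Emit a b) \<sigma> (1 + acost S \<sigma> a + acost S \<sigma> b)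
      (\<sigma>\<lparr>outp := outp \<sigma> @ [S ! aval S \<sigma> a ! aval S \<sigma> b]\<rparr>)"
| Seq: "exec S c \<sigma> t \<tau> \<Longrightarrow> exec S d \<tau> u \<upsilon> \<Longrightarrow> exec S (Seq c d) \<sigma> (t + u) \<upsilon>"
| CondTrue: "aval S \<sigma> a \<noteq> 0 \<Longrightarrow> exec S c \<sigma> t \<tau> \<Longrightarrow>
    exec S (Cond a c d) \<sigma> (1 + acost S \<sigma> a + t) \<tau>"
| CondFalse: "aval S \<sigma> a = 0 \<Longrightarrow> exec S d \<sigma> t \<tau> \<Longrightarrow>
    exec S (Cond a c d) \<sigma> (1 + acost S \<sigma> a + t) \<tau>"
| WhileFalse: "aval S \<sigma> a = 0 \<Longrightarrow> exec S (While a c) \<sigma> (1 + acost S \<sigma> a) \<sigma>"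
| WhileTrue: "aval S \<sigma> a \<noteq> 0 \<Longrightarrow> exec S c \<sigma> t \<tau> \<Longrightarrow> exec S (While a c) \<tau> u \<upsilon> \<Longrightarrow>
    exec S (While a c) \<sigma> (1 + acost S \<sigma> a + t + u) \<upsilon>"

inductive_cases exec_SkipE: "exec S Skip \<sigma> t \<tau>"
  and exec_AssignE: "exec S (Assign r a) \<sigma> t \<tau>"
  and exec_StoreE: "exec S (Store a b) \<sigma> t \<tau>"
  and exec_EmitE: "exec S (Emit a b) \<sigma> t \<tau>"
  and exec_SeqE: "exec S (Seq c d) \<sigma> t \<tau>"
  and exec_CondE: "exec S (Cond a c d) \<sigma> t \<tau>"
  and exec_WhileE: "exec S (While a c) \<sigma> t \<tau>"

lemma exec_deterministic:
  "exec S c \<sigma> t \<tau> \<Longrightarrow> exec S c \<sigma> t' \<tau>' \<Longrightarrow> t' = t \<and> \<tau>' = \<tau>"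
proof (induction arbitrary: t' \<tau>' rule: exec.induct)
  case (Seq c \<sigma> t \<tau> d u \<upsilon>)
  obtain t1 \<tau>1 u1 where "exec S c \<sigma> t1 \<tau>1" "exec S d \<tau>1 u1 \<tau>'" "t' = t1 + u1"
    using Seq.prems by (rule exec_SeqE)
  with Seq.IH(1)[of t1 \<tau>1] Seq.IH(2)[of u1 \<tau>'] show ?case by simp
next
  case (CondTrue \<sigma> a c t \<tau> d)
  obtain t1 where "exec S c \<sigma> t1 \<tau>'" "t' = Suc (acost S \<sigma> a + t1)"
    using CondTrue.prems by (rule exec_CondE) (use CondTrue.hyps in simp_all)
  with CondTrue.IH[of t1 \<tau>'] show ?case by simp
next
  case (CondFalse \<sigma> a d t \<tau> c)
  obtain t1 where "exec S d \<sigma> t1 \<tau>'" "t' = Suc (acost S \<sigma> a + t1)"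
    using CondFalse.prems by (rule exec_CondE) (use CondFalse.hyps in simp_all)
  with CondFalse.IH[of t1 \<tau>'] show ?case by simp
next
  case (WhileFalse \<sigma> a c)
  show ?case
    using WhileFalse.prems by (rule exec_WhileE) (use WhileFalse.hyps in simp_all)
next
  case (WhileTrue \<sigma> a c t \<tau> u \<upsilon>)
  obtain t1 \<tau>1 u1 where "exec S c \<sigma> t1 \<tau>1" "exec S (While a c) \<tau>1 u1 \<tau>'"
      "t' = Suc (acost S \<sigma> a + t1 + u1)"
    using WhileTrue.prems by (rule exec_WhileE) (use WhileTrue.hyps in simp_all)
  with WhileTrue.IH(1)[of t1 \<tau>1] WhileTrue.IH(2)[of u1 \<tau>'] show ?case by simp
next
  case (Skip \<sigma>)
  then show ?case by (rule exec_SkipE) simp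
next
  case (Assign r a \<sigma>)
  then show ?case by (rule exec_AssignE) simp
next
  case (Store a b \<sigma>)
  then show ?case by (rule exec_StoreE) simp
next
  case (Emit \<sigma> a b)
  show ?case using Emit.prems by (rule exec_EmitE) simp
qed

text \<open>Initially, register 0 holds the number of strings and register 1 their common length.\<close>

definition init_state :: "'a list list \<Rightarrow> 'a state" where
  "init_state S =
     \<lparr>regs = (\<lambda>_. 0)(0 := length S, 1 := length (hd S)), mem = (\<lambda>_. 0), outp = []\<rparr>"

definition returns_in_time :: "prog \<Rightarrow> 'a list list \<Rightarrow> 'a list \<Rightarrow> nat \<Rightarrow> bool" where
  "returns_in_time P S r t \<longleftrightarrow> (\<exists>\<tau>. exec S P (init_state S) t \<tau> \<and> outp \<tau> = r)"

section \<open>The running time notation\<close>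

text \<open>
  Hidden are factors \<open>c ^ m * log n ^ m\<close> and \<open>log n ^ k\<close>; the constants depend neither on \<open>m\<close> nor
  on \<open>n\<close>.  The bound is only required where \<open>log 2 n \<ge> 1\<close>.
\<close>

definition soft_O_m :: "(nat \<Rightarrow> nat \<Rightarrow> real) \<Rightarrow> (nat \<Rightarrow> nat \<Rightarrow> real) set" where
  "soft_O_m g = {T. \<exists>C c :: real. \<exists>k :: nat. 0 < C \<and> 0 < c \<and>
     (\<forall>m\<ge>2. \<forall>n\<ge>2. T m n \<le> C * (c ^ m * log 2 n ^ m) * log 2 n ^ k * g m n)}"

end

theory Submission
  imports Defs
begin

text \<open>
  Put \<open>k = m div 2\<close>. Repeatedly extract from \<open>s\<^sub>0\<close>, restricted to a set \<open>U\<close> of unused positions, a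
  longest subsequence \<open>T\<close> that is common to \<open>s\<^sub>1, \<dots>, s\<^sub>k\<close>; compute a longest subsequence of \<open>T\<close>
  that is common to the last \<open>k\<close> strings; then delete \<open>T\<close> from \<open>U\<close>. Return the longest of the
  latter subsequences, of length \<open>b\<close>, say. If \<open>O\<close> is an optimal set of positions in \<open>s\<^sub>0\<close> and
  \<open>r = card (O \<inter> U)\<close>, then \<open>card T \<ge> r\<close>, and \<open>r\<close> drops by \<open>card (O \<inter> T) \<le> b\<close>; hence
  \<open>2 b (n - card U) + r\<^sup>2\<close> never decreases below its initial value \<open>(card O)\<^sup>2\<close>, and at the end, where
  \<open>r = 0\<close>, we get \<open>b \<ge> (card O)\<^sup>2 / (2 n)\<close>.

  For the running time, a longest common subsequence of length \<open>L\<close> of \<open>k + 1\<close> strings is found in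
  time about \<open>(L + 2) (n + 1)\<^sup>k\<close> by tabulating, for a length and prefixes of \<open>k\<close> strings, the shortest
  sufficient prefix of the last string. The extracted sets \<open>T\<close> are disjoint, so that the lengths \<open>L\<close>
  add up to at most \<open>n\<close>, no matter how many rounds there are.
\<close>

section \<open>Reasoning about cost-bounded execution\<close>

fun asize :: "aexp \<Rightarrow> nat" where
  "asize (Num k) = 1"
| "asize (Reg r) = 1"
| "asize (Mem a) = 1 + asize a"
| "asize (Plus a b) = 1 + asize a + asize b"
| "asize (Monus a b) = 1 + asize a + asize b"
| "asize (Times a b) = 1 + asize a + asize b"
| "asize (Quot a b) = 1 + asize a + asize b"
| "asize (Less a b) = 1 + asize a + asize b"
| "asize (SymEq a b c d) = 1 + asize a + asize b + asize c + asize d"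

fun amax :: "aexp \<Rightarrow> nat" where
  "amax (Num k) = k"
| "amax (Reg r) = 0"
| "amax (Mem a) = amax a"
| "amax (Plus a b) = max (amax a) (amax b)"
| "amax (Monus a b) = max (amax a) (amax b)"
| "amax (Times a b) = max (amax a) (amax b)"
| "amax (Quot a b) = max (amax a) (amax b)"
| "amax (Less a b) = max (amax a) (amax b)"
| "amax (SymEq a b c d) = max (max (amax a) (amax b)) (max (amax c) (amax d))"

definition bounded_state :: "nat \<Rightarrow> 'a state \<Rightarrow> bool" where
  "bounded_state B \<sigma> \<longleftrightarrow> (\<forall>r. regs \<sigma> r < 2 ^ B) \<and> (\<forall>x. mem \<sigma> x < 2 ^ B)"

lemma aval_less:
  assumes "bounded_state B \<sigma>" "amax a < 2 ^ B" "1 \<le> B"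
  shows "aval S \<sigma> a < 2 ^ (B * asize a)"
  using assms(2)
proof (induction a)
  case (Mem a)
  have "aval S \<sigma> (Mem a) < 2 ^ B" using assms(1) by (simp add: bounded_state_def)
  also have "\<dots> \<le> 2 ^ (B * asize (Mem a))" by (rule power_increasing) auto
  finally show ?case .
next
  case (Plus a b)
  then have "aval S \<sigma> a < 2 ^ (B * asize a)" "aval S \<sigma> b < 2 ^ (B * asize b)" by auto
  moreover have "(2::nat) ^ (B * asize a) \<le> 2 ^ (B * (asize a + asize b))"
    "(2::nat) ^ (B * asize b) \<le> 2 ^ (B * (asize a + asize b))" by (auto intro: power_increasing)
  ultimately have "aval S \<sigma> (Plus a b) < 2 * 2 ^ (B * (asize a + asize b))"
    unfolding aval.simps by linarith
  also have "\<dots> \<le> 2 ^ B * 2 ^ (B * (asize a + asize b))"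
    using assms(3) power_increasing[of 1 B "2::nat"] by auto
  also have "\<dots> = 2 ^ (B * asize (Plus a b))" by (simp add: power_add[symmetric] algebra_simps)
  finally show ?case .
next
  case (Monus a b)
  then have "aval S \<sigma> a < 2 ^ (B * asize a)" by auto
  also have "\<dots> \<le> 2 ^ (B * asize (Monus a b))"
    by (rule power_increasing) (auto simp: algebra_simps)
  finally show ?case by simp
next
  case (Times a b)
  then have "aval S \<sigma> a < 2 ^ (B * asize a)" "aval S \<sigma> b < 2 ^ (B * asize b)" by auto
  then have "aval S \<sigma> (Times a b) < 2 ^ (B * asize a) * 2 ^ (B * asize b)"
    by (simp add: mult_strict_mono)
  also have "\<dots> = 2 ^ (B * (asize a + asize b))" by (simp add: power_add[symmetric] algebra_simps)
  also have "\<dots> \<le> 2 ^ (B * asize (Times a b))" by (rule power_increasing) auto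
  finally show ?case .
next
  case (Quot a b)
  then have "aval S \<sigma> a < 2 ^ (B * asize a)" by auto
  also have "\<dots> \<le> 2 ^ (B * asize (Quot a b))"
    by (rule power_increasing) (auto simp: algebra_simps)
  finally show ?case unfolding aval.simps by (rule le_less_trans[OF div_le_dividend])
next
  case (Less a b)
  have "1 < (2::nat) ^ (B * asize (Less a b))" using assms(3) by (intro one_less_power) auto
  then show ?case by auto
next
  case (SymEq a b c d)
  have "1 < (2::nat) ^ (B * asize (SymEq a b c d))" using assms(3) by (intro one_less_power) auto
  then show ?case by auto
qed (use assms(1) in \<open>auto simp: bounded_state_def\<close>)

lemma floorlog_le_of_less_power: "x < 2 ^ b \<Longrightarrow> floorlog 2 x \<le> b"
  by (simp add: floorlog_le_iff)

lemma acost_le: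
  assumes "bounded_state B \<sigma>" "amax a < 2 ^ B" "1 \<le> B"
  shows "acost S \<sigma> a \<le> asize a * (1 + B * asize a)"
proof -
  have node: "floorlog 2 (aval S \<sigma> e) \<le> B * asize a" if "amax e < 2 ^ B" "asize e \<le> asize a" for e
  proof -
    have "floorlog 2 (aval S \<sigma> e) \<le> B * asize e"
      using aval_less[OF assms(1) that(1) assms(3)] by (rule floorlog_le_of_less_power)
    also have "\<dots> \<le> B * asize a" using that(2) by simp
    finally show ?thesis .
  qed
  have "acost S \<sigma> e \<le> asize e * (1 + B * asize a)" if "amax e < 2 ^ B" "asize e \<le> asize a" for e
    using that
  proof (induction e)
    case (Num x) then show ?case using node[OF Num] by simp
  next
    case (Reg x) then show ?case using node[OF Reg] by simp
  next
    case (Mem e) then show ?case using node[OF Mem.prems] by (simp add: algebra_simps)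
  next
    case (Plus e1 e2) then show ?case using node[OF Plus.prems] by (simp add: algebra_simps)
  next
    case (Monus e1 e2) then show ?case using node[OF Monus.prems] by (simp add: algebra_simps)
  next
    case (Times e1 e2) then show ?case using node[OF Times.prems] by (simp add: algebra_simps)
  next
    case (Quot e1 e2) then show ?case using node[OF Quot.prems] by (simp add: algebra_simps)
  next
    case (Less e1 e2) then show ?case using node[OF Less.prems] by (simp add: algebra_simps)
  next
    case (SymEq e1 e2 e3 e4) then show ?case using node[OF SymEq.prems] by (simp add: algebra_simps)
  qed
  then show ?thesis using assms(2) by simp
qed

definition small :: "aexp \<Rightarrow> bool" where
  "small a \<longleftrightarrow> asize a \<le> 50 \<and> amax a < 16"

definition unit_cost :: "nat \<Rightarrow> nat" where
  "unit_cost B = 1 + 100 * (1 + 50 * B)"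

lemma acost_small:
  assumes "bounded_state B \<sigma>" "small a" "4 \<le> B"
  shows "acost S \<sigma> a \<le> 50 * (1 + 50 * B)"
proof -
  have "(16::nat) \<le> 2 ^ B" using power_increasing[of 4 B "2::nat"] assms(3) by simp
  then have "acost S \<sigma> a \<le> asize a * (1 + B * asize a)"
    using assms by (intro acost_le) (auto simp: small_def)
  also have "\<dots> \<le> 50 * (1 + B * 50)"
    using assms(2) by (intro mult_mono add_mono) (auto simp: small_def)
  finally show ?thesis by (simp add: mult.commute)
qed

fun smallp :: "prog \<Rightarrow> bool" where
  "smallp Skip \<longleftrightarrow> True"
| "smallp (Assign r a) \<longleftrightarrow> small a"
| "smallp (Store a b) \<longleftrightarrow> small a \<and> small b"
| "smallp (Emit a b) \<longleftrightarrow> small a \<and> small b"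
| "smallp (Seq c d) \<longleftrightarrow> smallp c \<and> smallp d"
| "smallp (Cond a c d) \<longleftrightarrow> small a \<and> smallp c \<and> smallp d"
| "smallp (While a c) \<longleftrightarrow> small a \<and> smallp c"

text \<open>Array \<open>c < 8\<close> occupies the addresses congruent to \<open>c\<close> modulo 8.\<close>

definition Arr :: "nat \<Rightarrow> aexp \<Rightarrow> aexp" where
  "Arr c e = Plus (Times (Num 8) e) (Num c)"

definition arr :: "'a state \<Rightarrow> nat \<Rightarrow> nat \<Rightarrow> nat" where
  "arr \<sigma> c i = mem \<sigma> (8 * i + c)"

definition set_reg :: "'a state \<Rightarrow> nat \<Rightarrow> nat \<Rightarrow> 'a state" where
  "set_reg \<sigma> r v = \<sigma>\<lparr>regs := (regs \<sigma>)(r := v)\<rparr>"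

definition set_arr :: "'a state \<Rightarrow> nat \<Rightarrow> nat \<Rightarrow> nat \<Rightarrow> 'a state" where
  "set_arr \<sigma> c i v = \<sigma>\<lparr>mem := (mem \<sigma>)(8 * i + c := v)\<rparr>"

definition add_out :: "'a state \<Rightarrow> 'a \<Rightarrow> 'a state" where
  "add_out \<sigma> x = \<sigma>\<lparr>outp := outp \<sigma> @ [x]\<rparr>"

lemma state_simps [simp]:
  "regs (set_reg \<sigma> r v) r' = (if r' = r then v else regs \<sigma> r')"
  "arr (set_reg \<sigma> r v) c i = arr \<sigma> c i"
  "outp (set_reg \<sigma> r v) = outp \<sigma>"
  "regs (set_arr \<sigma> c i v) = regs \<sigma>"
  "outp (set_arr \<sigma> c i v) = outp \<sigma>"
  "regs (add_out \<sigma> x) = regs \<sigma>"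
  "arr (add_out \<sigma> x) = arr \<sigma>"
  "outp (add_out \<sigma> x) = outp \<sigma> @ [x]"
  by (auto simp: set_reg_def set_arr_def add_out_def arr_def fun_eq_iff)

lemma arr_set_arr [simp]:
  assumes "c < 8" "d < 8"
  shows "arr (set_arr \<sigma> c i v) d j = (if d = c \<and> j = i then v else arr \<sigma> d j)"
proof -
  have "8 * j + d = 8 * i + c \<longleftrightarrow> d = c \<and> j = i" using assms by presburger
  then show ?thesis by (simp add: arr_def set_arr_def)
qed

lemma Arr_simps [simp]:
  "asize (Arr c e) = 4 + asize e"
  "amax (Arr c e) = max (max 8 (amax e)) c"
  "aval S \<sigma> (Mem (Arr c e)) = arr \<sigma> c (aval S \<sigma> e)"
  by (simp_all add: Arr_def arr_def)

declare aval.simps(3) [simp del]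

fun written :: "prog \<Rightarrow> nat set" where
  "written Skip = {}"
| "written (Assign r a) = {r}"
| "written (Store a b) = {}"
| "written (Emit a b) = {}"
| "written (Seq c d) = written c \<union> written d"
| "written (Cond a c d) = written c \<union> written d"
| "written (While a c) = written c"

fun addr_class :: "aexp \<Rightarrow> nat set" where
  "addr_class (Plus (Times (Num q) e) (Num c)) = (if q = 8 then {c mod 8} else UNIV)"
| "addr_class _ = UNIV"

fun stored :: "prog \<Rightarrow> nat set" where
  "stored Skip = {}"
| "stored (Assign r a) = {}"
| "stored (Store a b) = addr_class a"
| "stored (Emit a b) = {}"
| "stored (Seq c d) = stored c \<union> stored d"
| "stored (Cond a c d) = stored c \<union> stored d"
| "stored (While a c) = stored c"

fun emits :: "prog \<Rightarrow> bool" where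
  "emits Skip = False"
| "emits (Assign r a) = False"
| "emits (Store a b) = False"
| "emits (Emit a b) = True"
| "emits (Seq c d) = (emits c \<or> emits d)"
| "emits (Cond a c d) = (emits c \<or> emits d)"
| "emits (While a c) = emits c"

lemma addr_class_Arr [simp]: "addr_class (Arr c e) = {c mod 8}"
  by (simp add: Arr_def)

lemma aval_addr_class: "aval S \<sigma> a mod 8 \<in> addr_class a"
  by (cases a rule: addr_class.cases) auto

definition frame :: "prog \<Rightarrow> 'a state \<Rightarrow> 'a state \<Rightarrow> bool" where
  "frame c \<sigma> \<tau> \<longleftrightarrow> (\<forall>r. r \<notin> written c \<longrightarrow> regs \<tau> r = regs \<sigma> r) \<and>
     (\<forall>d. d < 8 \<longrightarrow> d \<notin> stored c \<longrightarrow> arr \<tau> d = arr \<sigma> d) \<and>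
     (\<not> emits c \<longrightarrow> outp \<tau> = outp \<sigma>)"

lemma frame_regs: "frame c \<sigma> \<tau> \<Longrightarrow> r \<notin> written c \<Longrightarrow> regs \<tau> r = regs \<sigma> r"
  and frame_arr: "frame c \<sigma> \<tau> \<Longrightarrow> d < 8 \<Longrightarrow> d \<notin> stored c \<Longrightarrow> arr \<tau> d = arr \<sigma> d"
  and frame_outp: "frame c \<sigma> \<tau> \<Longrightarrow> \<not> emits c \<Longrightarrow> outp \<tau> = outp \<sigma>"
  by (auto simp: frame_def)

lemma frame_refl: "frame c \<sigma> \<sigma>"
  by (simp add: frame_def)

lemma frame_trans:
  "frame c \<sigma> \<tau> \<Longrightarrow> frame d \<tau> \<upsilon> \<Longrightarrow> written c \<union> written d \<subseteq> written e \<Longrightarrow>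
    stored c \<union> stored d \<subseteq> stored e \<Longrightarrow> emits c \<or> emits d \<longrightarrow> emits e \<Longrightarrow> frame e \<sigma> \<upsilon>"
  unfolding frame_def by (metis UnCI subsetD)

lemma exec_frame: "exec S c \<sigma> t \<tau> \<Longrightarrow> frame c \<sigma> \<tau>"
proof (induction rule: exec.induct)
  case (Store a b \<sigma>)
  have "8 * i + d \<noteq> aval S \<sigma> a" if "d < 8" "d \<notin> addr_class a" for d i
    using that aval_addr_class[of S \<sigma> a] by (metis mod_less mod_mult_self4)
  then show ?case by (auto simp: frame_def arr_def fun_eq_iff)
qed (auto simp: frame_def arr_def fun_eq_iff)

text \<open>The bound on the values is part of the judgement, so that each elementary step costs at most
  one unit.\<close>

definition ok :: "'a list list \<Rightarrow> nat \<Rightarrow> prog \<Rightarrow> 'a state \<Rightarrow> nat \<Rightarrow> ('a state \<Rightarrow> bool) \<Rightarrow> bool" where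
  "ok S B c \<sigma> n Q \<longleftrightarrow> (bounded_state B \<sigma> \<longrightarrow>
     (\<exists>u \<tau>. exec S c \<sigma> u \<tau> \<and> u \<le> n * unit_cost B \<and> bounded_state B \<tau> \<and> frame c \<sigma> \<tau> \<and> Q \<tau>))"

lemma ok_weaken:
  assumes "ok S B c \<sigma> n Q" "n \<le> n'"
    "\<And>\<tau>. Q \<tau> \<Longrightarrow> frame c \<sigma> \<tau> \<Longrightarrow> bounded_state B \<tau> \<Longrightarrow> Q' \<tau>"
  shows "ok S B c \<sigma> n' Q'"
proof -
  have "u \<le> n' * unit_cost B" if "u \<le> n * unit_cost B" for u
    using that mult_le_mono1[OF assms(2)] order_trans by blast
  then show ?thesis using assms(1,3) unfolding ok_def by blast
qed

lemma ok_bounded: "(bounded_state B \<sigma> \<Longrightarrow> ok S B c \<sigma> n Q) \<Longrightarrow> ok S B c \<sigma> n Q"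
  by (simp add: ok_def)

lemma ok_Seq:
  assumes c: "ok S B c \<sigma> n1 R"
    and d: "\<And>\<tau>. R \<tau> \<Longrightarrow> frame c \<sigma> \<tau> \<Longrightarrow> bounded_state B \<tau> \<Longrightarrow> ok S B d \<tau> n2 Q"
    and n: "n1 + n2 \<le> n"
  shows "ok S B (Seq c d) \<sigma> n Q"
  unfolding ok_def
proof
  assume "bounded_state B \<sigma>"
  with c obtain u \<tau> where u: "exec S c \<sigma> u \<tau>" "u \<le> n1 * unit_cost B" "bounded_state B \<tau>"
    "frame c \<sigma> \<tau>" "R \<tau>" unfolding ok_def by blast
  with d[OF u(5,4,3)] obtain u' \<upsilon> where v: "exec S d \<tau> u' \<upsilon>" "u' \<le> n2 * unit_cost B"
    "bounded_state B \<upsilon>" "Q \<upsilon>" unfolding ok_def by blast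
  have "u + u' \<le> (n1 + n2) * unit_cost B" using u(2) v(2) by (simp add: algebra_simps)
  also have "\<dots> \<le> n * unit_cost B" using n by (rule mult_le_mono1)
  finally show "\<exists>u \<tau>. exec S (Seq c d) \<sigma> u \<tau> \<and> u \<le> n * unit_cost B \<and> bounded_state B \<tau> \<and>
      frame (Seq c d) \<sigma> \<tau> \<and> Q \<tau>"
    using exec.Seq[OF u(1) v(1)] v exec_frame by blast
qed

fun wp :: "'a list list \<Rightarrow> nat \<Rightarrow> prog \<Rightarrow> ('a state \<Rightarrow> bool) \<Rightarrow> 'a state \<Rightarrow> bool" where
  "wp S B Skip Q \<sigma> = Q \<sigma>"
| "wp S B (Assign r a) Q \<sigma> = (aval S \<sigma> a < 2 ^ B \<and> Q (set_reg \<sigma> r (aval S \<sigma> a)))"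
| "wp S B (Store a b) Q \<sigma> =
    (aval S \<sigma> b < 2 ^ B \<and> Q (\<sigma>\<lparr>mem := (mem \<sigma>)(aval S \<sigma> a := aval S \<sigma> b)\<rparr>))"
| "wp S B (Emit a b) Q \<sigma> = (valid_pos S (aval S \<sigma> a) (aval S \<sigma> b) \<and>
    Q (add_out \<sigma> (S ! aval S \<sigma> a ! aval S \<sigma> b)))"
| "wp S B (Seq c d) Q \<sigma> = wp S B c (wp S B d Q) \<sigma>"
| "wp S B (Cond a c d) Q \<sigma> = (if aval S \<sigma> a \<noteq> 0 then wp S B c Q \<sigma> else wp S B d Q \<sigma>)"
| "wp S B (While a c) Q \<sigma> = False"

lemma wp_Store_Arr [simp]:
  "wp S B (Store (Arr c e) b) Q \<sigma> =
    (aval S \<sigma> b < 2 ^ B \<and> Q (set_arr \<sigma> c (aval S \<sigma> e) (aval S \<sigma> b)))"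
  by (simp add: Arr_def set_arr_def)

declare wp.simps(3) [simp del]

fun steps :: "prog \<Rightarrow> nat" where
  "steps (Seq c d) = steps c + steps d"
| "steps (Cond a c d) = 1 + max (steps c) (steps d)"
| "steps _ = 1"

lemma ok_wp:
  assumes "wp S B c Q \<sigma>" "smallp c" "4 \<le> B"
  shows "ok S B c \<sigma> (steps c) Q"
  using assms(1,2)
proof (induction c arbitrary: Q \<sigma>)
  case Skip
  then show ?case using exec.Skip[of S \<sigma>] unfolding ok_def
    by (auto intro!: exI[of _ 1] exI[of _ \<sigma>] simp: frame_def unit_cost_def)
next
  case (Assign r a)
  show ?case unfolding ok_def
  proof
    assume b: "bounded_state B \<sigma>"
    have "1 + acost S \<sigma> a \<le> unit_cost B"
      using acost_small[OF b _ assms(3), of a S] Assign.prems by (simp add: unit_cost_def)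
    moreover have "bounded_state B (\<sigma>\<lparr>regs := (regs \<sigma>)(r := aval S \<sigma> a)\<rparr>)"
      using b Assign.prems by (simp add: bounded_state_def)
    moreover note exec.Assign[of S r a \<sigma>] exec_frame[OF exec.Assign[of S r a \<sigma>]]
    ultimately show "\<exists>u \<tau>. exec S (Assign r a) \<sigma> u \<tau> \<and> u \<le> steps (Assign r a) * unit_cost B \<and>
        bounded_state B \<tau> \<and> frame (Assign r a) \<sigma> \<tau> \<and> Q \<tau>"
      using Assign.prems by (auto simp: set_reg_def)
  qed
next
  case (Store a b)
  show ?case unfolding ok_def
  proof
    assume bd: "bounded_state B \<sigma>"
    have "1 + acost S \<sigma> a + acost S \<sigma> b \<le> unit_cost B"
      using acost_small[OF bd _ assms(3), of a S] acost_small[OF bd _ assms(3), of b S] Store.prems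
      by (simp add: unit_cost_def)
    moreover have "bounded_state B (\<sigma>\<lparr>mem := (mem \<sigma>)(aval S \<sigma> a := aval S \<sigma> b)\<rparr>)"
      using bd Store.prems by (simp add: bounded_state_def wp.simps(3))
    moreover note exec.Store[of S a b \<sigma>] exec_frame[OF exec.Store[of S a b \<sigma>]]
    ultimately show "\<exists>u \<tau>. exec S (Store a b) \<sigma> u \<tau> \<and> u \<le> steps (Store a b) * unit_cost B \<and>
        bounded_state B \<tau> \<and> frame (Store a b) \<sigma> \<tau> \<and> Q \<tau>"
      using Store.prems by (auto simp: wp.simps(3))
  qed
next
  case (Emit a b)
  show ?case unfolding ok_def
  proof
    assume bd: "bounded_state B \<sigma>"
    have "1 + acost S \<sigma> a + acost S \<sigma> b \<le> unit_cost B"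
      using acost_small[OF bd _ assms(3), of a S] acost_small[OF bd _ assms(3), of b S] Emit.prems
      by (simp add: unit_cost_def)
    moreover have "bounded_state B (\<sigma>\<lparr>outp := outp \<sigma> @ [S ! aval S \<sigma> a ! aval S \<sigma> b]\<rparr>)"
      using bd by (simp add: bounded_state_def)
    moreover have "valid_pos S (aval S \<sigma> a) (aval S \<sigma> b)" using Emit.prems by simp
    moreover note exec.Emit[OF this] exec_frame[OF exec.Emit[OF this]]
    ultimately show "\<exists>u \<tau>. exec S (Emit a b) \<sigma> u \<tau> \<and> u \<le> steps (Emit a b) * unit_cost B \<and>
        bounded_state B \<tau> \<and> frame (Emit a b) \<sigma> \<tau> \<and> Q \<tau>"
      using Emit.prems by (auto simp: add_out_def)
  qed
next
  case (Seq c d)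
  show ?case
    by (rule ok_Seq[where R = "wp S B d Q" and ?n1.0 = "steps c" and ?n2.0 = "steps d"])
      (use Seq in auto)
next
  case (Cond a c d)
  show ?case unfolding ok_def
  proof
    assume bd: "bounded_state B \<sigma>"
    have ac: "1 + acost S \<sigma> a \<le> unit_cost B"
      using acost_small[OF bd _ assms(3), of a S] Cond.prems by (simp add: unit_cost_def)
    let ?e = "if aval S \<sigma> a \<noteq> 0 then c else d"
    have "ok S B ?e \<sigma> (steps ?e) Q" using Cond by auto
    then have "ok S B ?e \<sigma> (max (steps c) (steps d)) Q" by (rule ok_weaken) auto
    then obtain u \<tau> where u: "exec S ?e \<sigma> u \<tau>" "u \<le> max (steps c) (steps d) * unit_cost B"
      "bounded_state B \<tau>" "Q \<tau>" using bd unfolding ok_def by blast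
    have e: "exec S (Cond a c d) \<sigma> (1 + acost S \<sigma> a + u) \<tau>"
      using u(1) by (cases "aval S \<sigma> a = 0") (auto intro: exec.CondTrue[simplified] exec.CondFalse[simplified])
    have "1 + acost S \<sigma> a + u \<le> steps (Cond a c d) * unit_cost B" using ac u(2) by simp
    then show "\<exists>u \<tau>. exec S (Cond a c d) \<sigma> u \<tau> \<and> u \<le> steps (Cond a c d) * unit_cost B \<and>
        bounded_state B \<tau> \<and> frame (Cond a c d) \<sigma> \<tau> \<and> Q \<tau>"
      using e u exec_frame[OF e] by blast
  qed
qed simp

lemma ok_Assign:
  assumes "aval S \<sigma> a < 2 ^ B" "Q (set_reg \<sigma> r (aval S \<sigma> a))" "small a" "4 \<le> B"
  shows "ok S B (Assign r a) \<sigma> 1 Q"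
  using ok_wp[of S B "Assign r a" Q \<sigma>] assms by simp

lemma ok_wp_le:
  assumes "wp S B c Q \<sigma>" "smallp c" "4 \<le> B" "steps c \<le> n"
  shows "ok S B c \<sigma> n Q"
  using ok_wp[OF assms(1-3)] assms(4) by (rule ok_weaken)

lemma ok_Skip: "Q \<sigma> \<Longrightarrow> 4 \<le> B \<Longrightarrow> 1 \<le> n \<Longrightarrow> ok S B Skip \<sigma> n Q"
  by (rule ok_wp_le) simp_all

lemma ok_Cond:
  assumes "aval S \<sigma> a \<noteq> 0 \<Longrightarrow> ok S B c \<sigma> n Q" "aval S \<sigma> a = 0 \<Longrightarrow> ok S B d \<sigma> n Q"
    and sm: "small a" "4 \<le> B" and n: "n + 1 \<le> n'"
  shows "ok S B (Cond a c d) \<sigma> n' Q"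
  unfolding ok_def
proof
  assume bd: "bounded_state B \<sigma>"
  have ac: "1 + acost S \<sigma> a \<le> unit_cost B"
    using acost_small[OF bd sm, of S] by (simp add: unit_cost_def)
  let ?e = "if aval S \<sigma> a \<noteq> 0 then c else d"
  have "ok S B ?e \<sigma> n Q" using assms by auto
  then obtain u \<tau> where u: "exec S ?e \<sigma> u \<tau>" "u \<le> n * unit_cost B"
    "bounded_state B \<tau>" "Q \<tau>" using bd unfolding ok_def by blast
  have e: "exec S (Cond a c d) \<sigma> (1 + acost S \<sigma> a + u) \<tau>"
    using u(1) by (cases "aval S \<sigma> a = 0") (auto intro: exec.CondTrue[simplified] exec.CondFalse[simplified])
  have "1 + acost S \<sigma> a + u \<le> (n + 1) * unit_cost B" using ac u(2) by simp
  also have "\<dots> \<le> n' * unit_cost B" using n by (rule mult_le_mono1)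
  finally show "\<exists>u \<tau>. exec S (Cond a c d) \<sigma> u \<tau> \<and> u \<le> n' * unit_cost B \<and>
      bounded_state B \<tau> \<and> frame (Cond a c d) \<sigma> \<tau> \<and> Q \<tau>"
    using e u exec_frame[OF e] by blast
qed

text \<open>The potential \<open>\<phi>\<close> pays for the iterations, which may have different costs.\<close>

lemma ok_While:
  fixes \<phi> :: "'a state \<Rightarrow> nat"
  assumes init: "I \<sigma>" and sm: "small a" "4 \<le> B"
    and step: "\<And>\<tau>. I \<tau> \<Longrightarrow> aval S \<tau> a \<noteq> 0 \<Longrightarrow> frame (While a c) \<sigma> \<tau> \<Longrightarrow> bounded_state B \<tau> \<Longrightarrow>
      \<exists>n. ok S B c \<tau> n (\<lambda>\<upsilon>. I \<upsilon> \<and> \<phi> \<upsilon> + n + 1 \<le> \<phi> \<tau>)"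
    and final: "\<And>\<tau>. I \<tau> \<Longrightarrow> aval S \<tau> a = 0 \<Longrightarrow> frame (While a c) \<sigma> \<tau> \<Longrightarrow> bounded_state B \<tau> \<Longrightarrow> Q \<tau>"
    and n: "\<phi> \<sigma> + 1 \<le> n"
  shows "ok S B (While a c) \<sigma> n Q"
proof -
  have "\<exists>u \<upsilon>. exec S (While a c) \<tau> u \<upsilon> \<and> u \<le> (\<phi> \<tau> + 1) * unit_cost B \<and> bounded_state B \<upsilon> \<and>
      frame (While a c) \<sigma> \<upsilon> \<and> Q \<upsilon>"
    if "I \<tau>" "bounded_state B \<tau>" "frame (While a c) \<sigma> \<tau>" for \<tau>
    using that
  proof (induction "\<phi> \<tau>" arbitrary: \<tau> rule: less_induct)
    case less
    have ac: "1 + acost S \<tau> a \<le> unit_cost B"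
      using acost_small[OF less.prems(2) sm, of S] by (simp add: unit_cost_def)
    show ?case
    proof (cases "aval S \<tau> a = 0")
      case True
      have e: "exec S (While a c) \<tau> (1 + acost S \<tau> a) \<tau>" using True by (rule exec.WhileFalse)
      have "1 + acost S \<tau> a \<le> (\<phi> \<tau> + 1) * unit_cost B" using ac by simp
      moreover have "Q \<tau>" using final True less.prems by blast
      ultimately show ?thesis using e less.prems by blast
    next
      case False
      from step[OF less.prems(1) False less.prems(3,2)] obtain k where
        "ok S B c \<tau> k (\<lambda>\<upsilon>. I \<upsilon> \<and> \<phi> \<upsilon> + k + 1 \<le> \<phi> \<tau>)" by blast
      then obtain u \<upsilon> where u: "exec S c \<tau> u \<upsilon>" "u \<le> k * unit_cost B" "bounded_state B \<upsilon>"
        "frame c \<tau> \<upsilon>" "I \<upsilon>" "\<phi> \<upsilon> + k + 1 \<le> \<phi> \<tau>"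
        using less.prems(2) unfolding ok_def by blast
      have "frame (While a c) \<sigma> \<upsilon>" by (rule frame_trans[OF less.prems(3) u(4)]) auto
      moreover have "\<phi> \<upsilon> < \<phi> \<tau>" using u(6) by simp
      ultimately obtain u' \<omega> where v: "exec S (While a c) \<upsilon> u' \<omega>"
        "u' \<le> (\<phi> \<upsilon> + 1) * unit_cost B" "bounded_state B \<omega>" "frame (While a c) \<sigma> \<omega>" "Q \<omega>"
        using less.hyps u by blast
      have "1 + acost S \<tau> a + u + u' \<le> (\<phi> \<upsilon> + k + 1 + 1) * unit_cost B"
        using ac u(2) v(2) by (simp add: algebra_simps)
      also have "\<dots> \<le> (\<phi> \<tau> + 1) * unit_cost B" using u(6) by (intro mult_le_mono1) simp
      finally show ?thesis using exec.WhileTrue[OF False u(1) v(1)] v by blast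
    qed
  qed
  from this[OF init _ frame_refl]
  have "ok S B (While a c) \<sigma> (\<phi> \<sigma> + 1) Q"
    unfolding ok_def using exec_frame by blast
  then show ?thesis using n by (rule ok_weaken)
qed

definition For :: "nat \<Rightarrow> aexp \<Rightarrow> prog \<Rightarrow> prog" where
  "For i e c = Seq (Assign i (Num 0))
     (While (Less (Reg i) e) (Seq c (Assign i (Plus (Reg i) (Num 1)))))"

lemma For_simps [simp]:
  "written (For i e c) = insert i (written c)"
  "stored (For i e c) = stored c"
  "emits (For i e c) = emits c"
  "smallp (For i e c) \<longleftrightarrow> asize e \<le> 48 \<and> amax e < 16 \<and> smallp c"
  by (auto simp: For_def small_def)

lemma ok_For:
  assumes init: "I 0 (set_reg \<sigma> i 0)" and sm: "smallp (For i e c)" "4 \<le> B" and K: "K < 2 ^ B"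
    and val: "\<And>j \<tau>. I j \<tau> \<Longrightarrow> frame (For i e c) \<sigma> \<tau> \<Longrightarrow> aval S \<tau> e = K"
    and step: "\<And>j \<tau>. j < K \<Longrightarrow> I j \<tau> \<Longrightarrow> regs \<tau> i = j \<Longrightarrow> frame (For i e c) \<sigma> \<tau> \<Longrightarrow>
      bounded_state B \<tau> \<Longrightarrow> ok S B c \<tau> n (\<lambda>\<upsilon>. regs \<upsilon> i = j \<and> I (Suc j) (set_reg \<upsilon> i (Suc j)))"
    and final: "\<And>\<tau>. I K \<tau> \<Longrightarrow> frame (For i e c) \<sigma> \<tau> \<Longrightarrow> bounded_state B \<tau> \<Longrightarrow> Q \<tau>"
    and n': "2 + K * (n + 2) \<le> n'"
  shows "ok S B (For i e c) \<sigma> n' Q"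
proof (rule ok_weaken[OF _ n'])
  let ?a = "Less (Reg i) e" and ?c = "Seq c (Assign i (Plus (Reg i) (Num 1)))"
  let ?J = "\<lambda>\<tau>. regs \<tau> i \<le> K \<and> I (regs \<tau> i) \<tau>"
  show "ok S B (For i e c) \<sigma> (2 + K * (n + 2)) Q"
    unfolding For_def
  proof (rule ok_Seq[where R = "\<lambda>\<tau>. \<tau> = set_reg \<sigma> i 0" and ?n1.0 = 1 and ?n2.0 = "K * (n + 2) + 1"])
    show "ok S B (Assign i (Num 0)) \<sigma> 1 (\<lambda>\<tau>. \<tau> = set_reg \<sigma> i 0)"
      using ok_wp[of S B "Assign i (Num 0)"] sm by (simp add: small_def)
    fix \<tau> assume \<tau>: "\<tau> = set_reg \<sigma> i 0" and f0: "frame (Assign i (Num 0)) \<sigma> \<tau>"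
    have fr: "frame (For i e c) \<sigma> \<upsilon>" if "frame (While ?a ?c) \<tau> \<upsilon>" for \<upsilon>
      by (rule frame_trans[OF f0 that]) auto
    show "ok S B (While ?a ?c) \<tau> (K * (n + 2) + 1) Q"
    proof (rule ok_While[where I = ?J and \<phi> = "\<lambda>\<upsilon>. (K - regs \<upsilon> i) * (n + 2)"])
      show "small ?a" using sm by (simp add: small_def)
      fix \<upsilon> assume J: "?J \<upsilon>" and t: "aval S \<upsilon> ?a \<noteq> 0" and f: "frame (While ?a ?c) \<tau> \<upsilon>"
        and b: "bounded_state B \<upsilon>"
      have v: "aval S \<upsilon> e = K" using val[OF _ fr[OF f]] J by blast
      then have lt: "regs \<upsilon> i < K" using t by (simp split: if_splits)
      let ?Q = "\<lambda>\<omega>. ?J \<omega> \<and> (K - regs \<omega> i) * (n + 2) + (n + 1) + 1 \<le> (K - regs \<upsilon> i) * (n + 2)"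
      have "ok S B ?c \<upsilon> (n + 1) ?Q"
      proof (rule ok_Seq[OF step[OF lt _ refl fr[OF f] b], where ?n2.0 = 1])
        show "I (regs \<upsilon> i) \<upsilon>" using J by simp
        fix \<omega> assume w: "regs \<omega> i = regs \<upsilon> i \<and> I (Suc (regs \<upsilon> i)) (set_reg \<omega> i (Suc (regs \<upsilon> i)))"
        have "Suc (K - Suc (regs \<upsilon> i)) = K - regs \<upsilon> i" using lt by simp
        then have "(K - Suc (regs \<upsilon> i)) * (n + 2) + (n + 1) + 1 = (K - regs \<upsilon> i) * (n + 2)"
          by (metis add.assoc add.commute mult_Suc nat_1_add_1)
        then show "ok S B (Assign i (Plus (Reg i) (Num 1))) \<omega> 1 ?Q"
          using w lt K sm(2) by (intro ok_Assign) (simp_all add: small_def)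
      qed auto
      then show "\<exists>k. ok S B ?c \<upsilon> k (\<lambda>\<omega>. ?J \<omega> \<and>
          (K - regs \<omega> i) * (n + 2) + k + 1 \<le> (K - regs \<upsilon> i) * (n + 2))" by blast
    next
      fix \<upsilon> assume J: "?J \<upsilon>" and t: "aval S \<upsilon> ?a = 0" and f: "frame (While ?a ?c) \<tau> \<upsilon>"
        and b: "bounded_state B \<upsilon>"
      have v: "aval S \<upsilon> e = K" using val[OF _ fr[OF f]] J by blast
      then have "regs \<upsilon> i = K" using t J by (simp split: if_splits)
      then show "Q \<upsilon>" using final[OF _ fr[OF f] b] J by simp
    qed (use \<tau> init sm in auto)
  qed auto
qed

section \<open>Subsequences\<close>

lemma nths_cong: "(\<And>i. i < length xs \<Longrightarrow> i \<in> A \<longleftrightarrow> i \<in> B) \<Longrightarrow> nths xs A = nths xs B"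
  unfolding nths_def by (intro arg_cong[of _ _ "map fst"] filter_cong) (auto simp: set_zip)

lemma nths_insert_last:
  assumes "T \<subseteq> {..<p}" "p < length xs"
  shows "nths xs (insert p T) = nths xs T @ [xs ! p]"
proof -
  have xs: "xs = take p xs @ xs ! p # drop (Suc p) xs" using assms(2) by (rule id_take_nth_drop)
  have a: "nths (take p xs) (insert p T) = nths (take p xs) T" by (rule nths_cong) auto
  have b: "{j. Suc (j + p) \<in> insert p T} = {}" "{j. Suc (j + p) \<in> T} = {}" "p \<notin> T"
    using assms(1) by auto
  show ?thesis
    using assms(2) a b by (subst (1 2) xs) (auto simp: nths_append nths_Cons min_def)
qed

lemma nths_take_Suc:
  assumes "p < length xs"
  shows "nths (take (Suc p) xs) T = nths (take p xs) T @ (if p \<in> T then [xs ! p] else [])"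
  using assms by (simp add: take_Suc_conv_app_nth nths_append)

lemma subseq_nths_mono: "A \<subseteq> B \<Longrightarrow> subseq (nths xs A) (nths xs B)"
proof (induction xs arbitrary: A B)
  case (Cons x xs)
  have "subseq (nths xs {j. Suc j \<in> A}) (nths xs {j. Suc j \<in> B})"
    using Cons.prems by (intro Cons.IH) auto
  then show ?case using Cons.prems by (auto simp: nths_Cons)
qed simp

lemma length_nths_subset: "T \<subseteq> {..<length xs} \<Longrightarrow> length (nths xs T) = card T"
  by (auto simp: length_nths intro!: arg_cong[of _ _ card])

lemma subseq_obtain_subset:
  assumes "subseq t xs"
  obtains T where "T \<subseteq> {..<length xs}" "nths xs T = t"
proof -
  obtain A where "t = nths xs A" using assms subseq_conv_nths by blast
  then have "nths xs (A \<inter> {..<length xs}) = t" by (auto intro: nths_cong)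
  then show ?thesis by (intro that) auto
qed

lemma subseq_take_mono: "x \<le> y \<Longrightarrow> subseq t (take x s) \<Longrightarrow> subseq t (take y s)"
  by (metis le_Suc_ex subseq_rev_drop_many take_add)

lemma subseq_snoc_take_iff:
  "y \<le> length s \<Longrightarrow> subseq (t @ [c]) (take y s) \<longleftrightarrow> (\<exists>x<y. s ! x = c \<and> subseq t (take x s))"
proof (induction y)
  case (Suc y)
  have snoc: "subseq (t @ [c]) (xs @ [d]) \<longleftrightarrow> (d = c \<and> subseq t xs) \<or> subseq (t @ [c]) xs" for xs d
  proof
    assume "subseq (t @ [c]) (xs @ [d])"
    then obtain us vs where uv: "t @ [c] = us @ vs" "subseq us xs" "subseq vs [d]"
      by (auto simp: subseq_append_iff)
    from uv(3) have "length vs \<le> 1" using list_emb_length by fastforce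
    then have "vs = [] \<or> (\<exists>e. vs = [e])" by (cases vs) auto
    with uv show "(d = c \<and> subseq t xs) \<or> subseq (t @ [c]) xs"
      by (auto simp: subseq_singleton_left)
  qed (auto intro: subseq_rev_drop_many)
  have "subseq (t @ [c]) (take (Suc y) s) \<longleftrightarrow>
      (s ! y = c \<and> subseq t (take y s)) \<or> subseq (t @ [c]) (take y s)"
    using Suc.prems by (simp add: take_Suc_conv_app_nth snoc)
  then show ?case using Suc by (auto simp: less_Suc_eq)
qed simp

function nextocc :: "'a list \<Rightarrow> 'a \<Rightarrow> nat \<Rightarrow> nat" where
  "nextocc s c x =
    (if x < length s then if s ! x = c then Suc x else nextocc s c (Suc x) else Suc (length s))"
  by auto
termination by (relation "measure (\<lambda>(s, c, x). length s - x)") auto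

declare nextocc.simps [simp del]

lemma nextocc_le_iff:
  "y \<le> length s \<Longrightarrow> nextocc s c x \<le> y \<longleftrightarrow> (\<exists>z. x \<le> z \<and> z < y \<and> s ! z = c)"
proof (induction s c x rule: nextocc.induct)
  case (1 s c x)
  show ?case
  proof (cases "x < length s \<and> s ! x \<noteq> c")
    case True
    then have "nextocc s c x \<le> y \<longleftrightarrow> (\<exists>z. Suc x \<le> z \<and> z < y \<and> s ! z = c)"
      using 1 by (simp add: nextocc.simps[of s c x])
    then show ?thesis using True by (metis Suc_leD Suc_leI le_neq_implies_less)
  next
    case False
    then show ?thesis using 1(2) by (auto simp: nextocc.simps[of s c x] Suc_le_eq)
  qed
qed

section \<open>Digits\<close>

lemma div_pred: "0 < D \<Longrightarrow> (D * x + (D - 1)) div D = x" for D x :: nat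
  by (rule div_nat_eqI) auto

lemma sub_power_eq:
  fixes N z j :: nat
  assumes "0 < z div N ^ j mod N"
  defines "w \<equiv> z div N ^ Suc j"
  shows "z - N ^ j = z mod N ^ j + N ^ j * ((z div N ^ j mod N - 1) + N * w)"
proof -
  have "w = z div N ^ j div N" unfolding w_def by (metis div_mult2_eq power_Suc2)
  then have "z div N ^ j = z div N ^ j mod N + N * w" by simp
  then have *: "z = z mod N ^ j + N ^ j * (z div N ^ j mod N + N * w)"
    by (metis mod_mult_div_eq)
  obtain d where d: "z div N ^ j mod N = Suc d" using assms(1) gr0_implies_Suc by blast
  have "z - N ^ j = z mod N ^ j + N ^ j * (Suc d + N * w) - N ^ j" using * d by simp
  also have "\<dots> = z mod N ^ j + N ^ j * (d + N * w)" by (simp add: algebra_simps)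
  finally show ?thesis by (simp add: d)
qed

lemma
  fixes N z j :: nat
  assumes N: "0 < N" and pos: "0 < z div N ^ j mod N"
  shows sub_power_mod: "(z - N ^ j) mod N ^ j = z mod N ^ j"
    and sub_power_digit: "(z - N ^ j) div N ^ j mod N = z div N ^ j mod N - 1"
    and sub_power_div: "(z - N ^ j) div N ^ Suc j = z div N ^ Suc j"
proof -
  let ?d = "z div N ^ j mod N" and ?w = "z div N ^ Suc j"
  note eq = sub_power_eq[OF pos]
  show "(z - N ^ j) mod N ^ j = z mod N ^ j" by (subst eq) simp
  have div: "(z - N ^ j) div N ^ j = ?d - 1 + N * ?w"
    using N by (subst eq) simp
  have d: "?d < N" using N by simp
  show "(z - N ^ j) div N ^ j mod N = ?d - 1"
    using d by (subst div) simp
  have "(z - N ^ j) div N ^ Suc j = (z - N ^ j) div N ^ j div N"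
    by (metis div_mult2_eq power_Suc2)
  also have "\<dots> = (?d - 1 + N * ?w) div N" by (simp only: div)
  also have "\<dots> = ?w"
  proof -
    have "(x + N * w) div N = w" if "x < N" for x w using that by simp
    moreover have "?d - 1 < N" using d by linarith
    ultimately show ?thesis by blast
  qed
  finally show "(z - N ^ j) div N ^ Suc j = z div N ^ Suc j" .
qed

lemma digit_mod_power:
  fixes N z i j :: nat
  assumes "i < j" "0 < N"
  shows "z mod N ^ j div N ^ i mod N = z div N ^ i mod N"
proof -
  have j: "N ^ j = N ^ i * N ^ (j - i)" using assms by (simp add: power_add[symmetric])
  have "N dvd N ^ (j - i)" using assms by simp
  moreover have "z mod N ^ j div N ^ i = z div N ^ i mod N ^ (j - i)"
    using assms(2) by (simp add: j mod_mult2_eq)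
  ultimately show ?thesis by (simp add: mod_mod_cancel)
qed

lemma div_power_eqI:
  fixes N x y i j :: nat
  assumes "x div N ^ i = y div N ^ i" "i \<le> j"
  shows "x div N ^ j = y div N ^ j"
proof -
  have "N ^ j = N ^ i * N ^ (j - i)" using assms by (simp add: power_add[symmetric])
  then show ?thesis by (simp add: div_mult2_eq assms(1))
qed

lemma sub_power_digits:
  fixes N z j :: nat
  assumes N: "0 < N" and pos: "0 < z div N ^ j mod N"
  shows "(z - N ^ j) div N ^ i mod N = (if i = j then z div N ^ i mod N - 1 else z div N ^ i mod N)"
proof (cases i j rule: linorder_cases)
  case less
  have "(z - N ^ j) div N ^ i mod N = (z - N ^ j) mod N ^ j div N ^ i mod N"
    by (rule digit_mod_power[OF less N, symmetric])
  also have "\<dots> = z mod N ^ j div N ^ i mod N" by (simp only: sub_power_mod[OF assms])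
  also have "\<dots> = z div N ^ i mod N" by (rule digit_mod_power[OF less N])
  finally show ?thesis using less by simp
next
  case equal
  then show ?thesis using sub_power_digit[OF assms] by simp
next
  case greater
  then have "(z - N ^ j) div N ^ i = z div N ^ i"
    by (intro div_power_eqI[OF sub_power_div[OF assms]]) simp
  then show ?thesis using greater by simp
qed

lemma sub_diagonal:
  fixes N z k :: nat
  assumes N: "0 < N" and pos: "\<And>j. j < k \<Longrightarrow> 0 < z div N ^ j mod N"
  shows "i \<le> k \<Longrightarrow> (\<forall>j. (z - (\<Sum>j<i. N ^ j)) div N ^ j mod N =
      (if j < i then z div N ^ j mod N - 1 else z div N ^ j mod N)) \<and>
    (z - (\<Sum>j<i. N ^ j)) div N ^ k = z div N ^ k"
proof (induction i)
  case (Suc i)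
  let ?z = "z - (\<Sum>j<i. N ^ j)"
  have eq: "z - (\<Sum>j<Suc i. N ^ j) = ?z - N ^ i" by simp
  have IH: "\<And>j. ?z div N ^ j mod N = (if j < i then z div N ^ j mod N - 1 else z div N ^ j mod N)"
    "?z div N ^ k = z div N ^ k" using Suc by auto
  have p: "0 < ?z div N ^ i mod N" using pos Suc.prems by (simp add: IH)
  have "(?z - N ^ i) div N ^ k = ?z div N ^ k"
    using Suc.prems by (intro div_power_eqI[OF sub_power_div[OF N p]])
  then show ?case unfolding eq using sub_power_digits[OF N p] IH by auto
qed simp

lemma sub_diagonal_power:
  fixes N z k :: nat
  assumes N: "0 < N" and pos: "\<And>j. j < k \<Longrightarrow> 0 < z div N ^ j mod N" and l: "0 < z div N ^ k"
  defines "z' \<equiv> z - (N ^ k + (\<Sum>j<k. N ^ j))"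
  shows "z' div N ^ k = z div N ^ k - 1"
    and "\<And>j. j < k \<Longrightarrow> z' div N ^ j mod N = z div N ^ j mod N - 1"
proof -
  let ?z = "z - (\<Sum>j<k. N ^ j)"
  have eq: "z' = ?z - N ^ k" unfolding z'_def by simp
  have A: "\<forall>j. ?z div N ^ j mod N = (if j < k then z div N ^ j mod N - 1 else z div N ^ j mod N)"
    "?z div N ^ k = z div N ^ k"
    using sub_diagonal[OF N pos, of k k] by auto
  have ge: "N ^ k \<le> ?z" using A(2) l by (metis div_less leI less_irrefl)
  then show "z' div N ^ k = z div N ^ k - 1" unfolding eq
    using A(2) le_div_geq[of "N ^ k" ?z] N by simp
  have m: "z' mod N ^ k = ?z mod N ^ k" unfolding eq using ge by (metis le_mod_geq)
  fix j assume "j < k"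
  have "z' div N ^ j mod N = z' mod N ^ k div N ^ j mod N"
    by (rule digit_mod_power[OF \<open>j < k\<close> N, symmetric])
  also have "\<dots> = ?z div N ^ j mod N"
    unfolding m by (rule digit_mod_power[OF \<open>j < k\<close> N])
  finally show "z' div N ^ j mod N = z div N ^ j mod N - 1" using A(1) \<open>j < k\<close> by simp
qed

section \<open>The dynamic program\<close>

locale strings =
  fixes S :: "'a list list" and n k :: nat
  assumes k_pos: "0 < k" and len: "i < length S \<Longrightarrow> length (S ! i) = n"
begin

abbreviation "N \<equiv> Suc n"
abbreviation "P \<equiv> N ^ k"
abbreviation "E \<equiv> (\<Sum>j<k. N ^ j)"

definition str :: "nat \<Rightarrow> nat \<Rightarrow> 'a list" where
  "str a j = S ! (if j = 0 then 0 else a + j - 1)"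

definition last_str :: "nat \<Rightarrow> 'a list" where
  "last_str a = S ! (a + k - 1)"

definition digit :: "nat \<Rightarrow> nat \<Rightarrow> nat" where
  "digit z j = z div N ^ j mod N"

definition feasible :: "nat \<Rightarrow> nat set \<Rightarrow> bool" where
  "feasible a T \<longleftrightarrow> (\<forall>j<k. subseq (nths (S ! 0) T) (S ! (a + j)))"

definition opt :: "nat \<Rightarrow> nat set \<Rightarrow> nat" where
  "opt a W = Max (card ` {T. T \<subseteq> W \<and> feasible a T})"

text \<open>
  A number \<open>z\<close> encodes a length \<open>z div P\<close> and, by its \<open>k\<close> lowest digits in base \<open>N\<close>, the lengths of
  prefixes of \<open>S ! 0\<close> and \<open>S ! a, \<dots>, S ! (a + k - 2)\<close>. Its table entry is the length of the shortest
  prefix of \<open>S ! (a + k - 1)\<close> for which there is a common subsequence of that length, and \<open>N\<close> if there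
  is none. Only positions in \<open>W\<close> may be used in \<open>S ! 0\<close>.
\<close>

definition witness :: "nat \<Rightarrow> nat set \<Rightarrow> nat \<Rightarrow> (nat \<Rightarrow> nat) \<Rightarrow> nat \<Rightarrow> nat set \<Rightarrow> bool" where
  "witness a W l q y T \<longleftrightarrow> T \<subseteq> W \<and> T \<subseteq> {..<q 0} \<and> card T = l \<and>
     (\<forall>j. 0 < j \<and> j < k \<longrightarrow> subseq (nths (S ! 0) T) (take (q j) (str a j))) \<and>
     subseq (nths (S ! 0) T) (take y (last_str a))"

definition good :: "nat \<Rightarrow> nat set \<Rightarrow> nat \<Rightarrow> nat \<Rightarrow> bool" where
  "good a W z v \<longleftrightarrow> v \<le> N \<and> (\<forall>y\<le>n. v \<le> y \<longleftrightarrow> (\<exists>T. witness a W (z div P) (digit z) y T))"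

lemma digit_le: "digit z j \<le> n"
  by (simp add: digit_def less_Suc_eq_le[symmetric])

lemma witness_cong: "(\<And>j. j < k \<Longrightarrow> q j = q' j) \<Longrightarrow> witness a W l q y T = witness a W l q' y T"
  using k_pos by (simp add: witness_def)

lemma witness_mono:
  "witness a W l q x T \<Longrightarrow> (\<And>j. j < k \<Longrightarrow> q j \<le> q' j) \<Longrightarrow> x \<le> y \<Longrightarrow> witness a W l q' y T"
  using k_pos unfolding witness_def
  by (meson order_trans lessThan_subset_iff subseq_take_mono)

context
  fixes a W assumes a: "0 < a" "a + k \<le> length S" and W: "W \<subseteq> {..<n}"
begin

lemma length_S0: "length (S ! 0) = n"
  using a by (intro len) linarith

lemma length_str: "j < k \<Longrightarrow> length (str a j) = n"
  using a len length_S0 by (auto simp: str_def)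

lemma length_last_str: "length (last_str a) = n"
  using a len k_pos by (auto simp: last_str_def)

lemma witness_insert:
  assumes T: "witness a W l (\<lambda>j. q j - 1) x T"
    and q: "\<And>j. j < k \<Longrightarrow> 0 < q j \<and> q j \<le> n \<and> str a j ! (q j - 1) = S ! 0 ! (q 0 - 1)"
    and p: "q 0 - 1 \<in> W"
    and y: "nextocc (last_str a) (S ! 0 ! (q 0 - 1)) x \<le> y" "y \<le> n"
  shows "witness a W (Suc l) q y (insert (q 0 - 1) T)"
proof -
  let ?p = "q 0 - 1" and ?t = "nths (S ! 0) T" and ?c = "S ! 0 ! (q 0 - 1)"
  have Tp: "T \<subseteq> {..<?p}" using T by (simp add: witness_def)
  have pn: "?p < n" using p W by auto
  have nths: "nths (S ! 0) (insert ?p T) = ?t @ [?c]"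
    using Tp pn length_S0 by (intro nths_insert_last) auto
  have fin: "finite T" using Tp finite_subset by blast
  have "?p \<notin> T" using Tp by auto
  then have "card (insert ?p T) = Suc l" using T fin by (simp add: witness_def)
  moreover have "insert ?p T \<subseteq> {..<q 0}" using Tp q[OF k_pos] by auto
  moreover have "insert ?p T \<subseteq> W" using T p by (simp add: witness_def)
  moreover have "subseq (?t @ [?c]) (take (q j) (str a j))" if "0 < j" "j < k" for j
    using T that q[OF that(2)] length_str[OF that(2)]
    by (subst subseq_snoc_take_iff) (auto simp: witness_def intro!: exI[of _ "q j - 1"])
  moreover have "subseq (?t @ [?c]) (take y (last_str a))"
  proof -
    obtain z where z: "x \<le> z" "z < y" "last_str a ! z = ?c"
      using y nextocc_le_iff[of y "last_str a" ?c x] length_last_str by auto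
    have "subseq ?t (take z (last_str a))" using T z(1) subseq_take_mono by (auto simp: witness_def)
    then show ?thesis using z y length_last_str by (subst subseq_snoc_take_iff) auto
  qed
  ultimately show ?thesis unfolding witness_def nths by blast
qed

lemma witness_cases:
  assumes T: "witness a W (Suc l) q y T" and q: "\<And>j. j < k \<Longrightarrow> q j \<le> n" and y: "y \<le> n"
  obtains (reduce) j where "j < k" "0 < q j" "witness a W (Suc l) (q(j := q j - 1)) y T"
  | (match) T' x where "\<And>j. j < k \<Longrightarrow> 0 < q j \<and> str a j ! (q j - 1) = S ! 0 ! (q 0 - 1)"
      "q 0 - 1 \<in> W" "witness a W l (\<lambda>j. q j - 1) x T'" "x < y" "last_str a ! x = S ! 0 ! (q 0 - 1)"
proof (cases "q 0 - 1 \<in> T")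
  case False
  have ne: "T \<noteq> {}" using T by (auto simp: witness_def)
  then have q0: "0 < q 0" using T by (auto simp: witness_def)
  have "T \<subseteq> {..<q 0 - 1}"
  proof
    fix i assume "i \<in> T"
    then have "i < q 0" "i \<noteq> q 0 - 1" using T False by (auto simp: witness_def)
    then show "i \<in> {..<q 0 - 1}" by auto
  qed
  then have "witness a W (Suc l) (q(0 := q 0 - 1)) y T" using T by (auto simp: witness_def)
  then show ?thesis using reduce[OF k_pos q0] by blast
next
  case True
  let ?p = "q 0 - 1" and ?T = "T - {q 0 - 1}" and ?c = "S ! 0 ! (q 0 - 1)"
  let ?t = "nths (S ! 0) (T - {q 0 - 1})"
  have q0: "0 < q 0" using T True by (auto simp: witness_def)
  have Tp: "?T \<subseteq> {..<?p}"
  proof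
    fix i assume "i \<in> ?T"
    then have "i < q 0" "i \<noteq> q 0 - 1" using T by (auto simp: witness_def)
    then show "i \<in> {..<q 0 - 1}" by auto
  qed
  have pn: "?p < n" using q[OF k_pos] q0 by auto
  have ins: "insert ?p ?T = T" using True by auto
  have nths: "nths (S ! 0) T = ?t @ [?c]"
    using nths_insert_last[OF Tp, of "S ! 0"] pn length_S0 ins by auto
  have "finite T" using T W by (meson finite_lessThan finite_subset witness_def)
  then have card: "card ?T = l" using T True by (simp add: witness_def)
  have j: "\<exists>x<q j. str a j ! x = ?c \<and> subseq ?t (take x (str a j))" if "0 < j" "j < k" for j
    using T that q[OF that(2)] length_str[OF that(2)]
    by (auto simp: witness_def nths subseq_snoc_take_iff[symmetric])
  have "\<exists>x<y. last_str a ! x = ?c \<and> subseq ?t (take x (last_str a))"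
    using T y length_last_str by (auto simp: witness_def nths subseq_snoc_take_iff[symmetric])
  then obtain x where x: "x < y" "last_str a ! x = ?c" "subseq ?t (take x (last_str a))" by blast
  show ?thesis
  proof (cases "\<exists>j<k. str a j ! (q j - 1) \<noteq> ?c")
    case True
    then obtain i where i: "i < k" "str a i ! (q i - 1) \<noteq> ?c" by blast
    have i0: "0 < i" using i(2) by (cases i) (auto simp: str_def)
    from j[OF i0 i(1)] obtain z where z: "z < q i" "str a i ! z = ?c"
      "subseq ?t (take z (str a i))" by blast
    have "z < q i - 1" using z i(2) by (metis One_nat_def Suc_pred gr_implies_not0 less_SucE not_gr0)
    then have "subseq (?t @ [?c]) (take (q i - 1) (str a i))"
      using z q[OF i(1)] length_str[OF i(1)] by (subst subseq_snoc_take_iff) auto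
    then have "witness a W (Suc l) (q(i := q i - 1)) y T" using T i0 by (auto simp: witness_def nths)
    then show ?thesis using reduce[OF i(1)] z(1) by auto
  next
    case False
    have qp: "0 < q i" if "i < k" for i using j[of i] that q0 by (cases i) auto
    have "subseq ?t (take (q i - 1) (str a i))" if i: "0 < i" "i < k" for i
    proof -
      obtain z where "z < q i" "subseq ?t (take z (str a i))" using j[OF i] by blast
      then show ?thesis by (intro subseq_take_mono[of z "q i - 1"]) auto
    qed
    then have "witness a W l (\<lambda>j. q j - 1) x ?T" using T Tp card x by (auto simp: witness_def)
    moreover have "?p \<in> W" using T True by (auto simp: witness_def)
    ultimately show ?thesis using match[of x ?T] False qp x by auto
  qed
qed

lemma good_zero:
  assumes "z div P = 0" shows "good a W z 0"
proof -
  have "witness a W 0 (digit z) y {}" for y by (simp add: witness_def)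
  then show ?thesis unfolding good_def assms by auto
qed

lemma digit_sub: "0 < digit z j \<Longrightarrow> digit (z - N ^ j) = (digit z)(j := digit z j - 1)"
  using sub_power_digits[of N z j] by (auto simp: digit_def fun_eq_iff)

lemma layer_sub: "0 < digit z j \<Longrightarrow> j < k \<Longrightarrow> (z - N ^ j) div P = z div P"
  unfolding digit_def by (intro div_power_eqI[OF sub_power_div]) simp_all

lemma digit_diag:
  "(\<And>j. j < k \<Longrightarrow> 0 < digit z j) \<Longrightarrow> 0 < z div P \<Longrightarrow> j < k \<Longrightarrow> digit (z - (P + E)) j = digit z j - 1"
  using sub_diagonal_power(2)[of N k z j] by (simp add: digit_def)

lemma layer_diag:
  "(\<And>j. j < k \<Longrightarrow> 0 < digit z j) \<Longrightarrow> 0 < z div P \<Longrightarrow> (z - (P + E)) div P = z div P - 1"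
  using sub_diagonal_power(1)[of N k z] by (simp add: digit_def)

definition matches :: "nat \<Rightarrow> bool" where
  "matches z \<longleftrightarrow> digit z 0 - 1 \<in> W \<and>
     (\<forall>j<k. 0 < digit z j \<and> str a j ! (digit z j - 1) = S ! 0 ! (digit z 0 - 1))"

lemma witness_iff:
  assumes l: "0 < z div P" and y: "y \<le> n"
    and reduce: "\<And>j. j < k \<Longrightarrow> 0 < digit z j \<Longrightarrow> good a W (z - N ^ j) (F (z - N ^ j))"
    and diag: "matches z \<Longrightarrow> good a W (z - (P + E)) (F (z - (P + E)))"
  shows "(\<exists>T. witness a W (z div P) (digit z) y T) \<longleftrightarrow>
    (\<exists>j<k. 0 < digit z j \<and> F (z - N ^ j) \<le> y) \<or>
    (matches z \<and> nextocc (last_str a) (S ! 0 ! (digit z 0 - 1)) (F (z - (P + E))) \<le> y)"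
    (is "?L \<longleftrightarrow> ?R \<or> ?M")
proof -
  obtain l where l': "z div P = Suc l" using l gr0_implies_Suc by blast
  let ?x = "F (z - (P + E))" and ?c = "S ! 0 ! (digit z 0 - 1)"
  have R: "F (z - N ^ j) \<le> y \<longleftrightarrow> (\<exists>T. witness a W (Suc l) ((digit z)(j := digit z j - 1)) y T)"
    if "j < k" "0 < digit z j" for j
    using reduce[OF that] y layer_sub[OF that(2,1)] l' digit_sub[OF that(2)] by (simp add: good_def)
  have D: "?x \<le> N \<and> (\<forall>y\<le>n. ?x \<le> y \<longleftrightarrow> (\<exists>T. witness a W l (\<lambda>j. digit z j - 1) y T))" if m: "matches z"
  proof -
    have pos: "\<And>j. j < k \<Longrightarrow> 0 < digit z j" using m by (simp add: matches_def)
    have "witness a W l (digit (z - (P + E))) y T = witness a W l (\<lambda>j. digit z j - 1) y T" for y T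
      by (rule witness_cong) (simp add: digit_diag[OF pos l])
    then show ?thesis
      using diag[OF m] layer_diag[OF pos l] l' by (simp add: good_def)
  qed
  show ?thesis
  proof
    assume ?L
    then obtain T where T: "witness a W (Suc l) (digit z) y T" using l' by auto
    show "?R \<or> ?M"
    proof (rule witness_cases[OF T digit_le y])
      fix j assume "j < k" "0 < digit z j" "witness a W (Suc l) ((digit z)(j := digit z j - 1)) y T"
      then show ?thesis using R by blast
    next
      fix T' x
      assume match: "\<And>j. j < k \<Longrightarrow> 0 < digit z j \<and> str a j ! (digit z j - 1) = S ! 0 ! (digit z 0 - 1)"
        "digit z 0 - 1 \<in> W" "witness a W l (\<lambda>j. digit z j - 1) x T'" "x < y"
        "last_str a ! x = S ! 0 ! (digit z 0 - 1)"
      then have m: "matches z" by (simp add: matches_def)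
      have "?x \<le> x" using D[OF m] match y by auto
      then have "nextocc (last_str a) ?c ?x \<le> y"
        using match y length_last_str by (subst nextocc_le_iff) auto
      then show ?thesis using m by blast
    qed
  next
    assume "?R \<or> ?M"
    then show ?L
    proof
      assume ?R
      then obtain j T where j: "j < k" "0 < digit z j" "witness a W (Suc l) ((digit z)(j := digit z j - 1)) y T"
        using R by blast
      have "witness a W (Suc l) (digit z) y T" by (rule witness_mono[OF j(3)]) auto
      then show ?L using l' by auto
    next
      assume M: ?M
      then have m: "matches z" by simp
      have "nextocc (last_str a) ?c ?x \<le> y" using M by simp
      then obtain x where "?x \<le> x" "x < y"
        using y length_last_str nextocc_le_iff[of y "last_str a" ?c ?x] by auto
      then have "?x \<le> n" using y by simp
      then obtain T where T: "witness a W l (\<lambda>j. digit z j - 1) ?x T" using D[OF m] by blast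
      have "witness a W (Suc l) (digit z) y (insert (digit z 0 - 1) T)"
        using m M y digit_le by (intro witness_insert[OF T]) (auto simp: matches_def)
      then show ?L using l' by auto
    qed
  qed
qed

lemma digit_full: "j < k \<Longrightarrow> digit (l * P + (P - 1)) j = n"
proof -
  assume "j < k"
  then have "P = N ^ j * N * N ^ (k - Suc j)"
    by (metis Suc_leI le_add_diff_inverse power_Suc2 power_add)
  then obtain M where M: "P = N ^ j * N * M" "0 < M" by auto
  have "l * P + (P - 1) = (N ^ j * (l * N * M + N * M - 1)) + (N ^ j - 1)"
  proof -
    have "N ^ j * (l * N * M + N * M - 1) = l * P + P - N ^ j"
      by (simp add: M(1) diff_mult_distrib2 algebra_simps)
    moreover have "N ^ j \<le> P" using \<open>j < k\<close> by (intro power_increasing) auto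
    moreover have "0 < N ^ j" by simp
    ultimately show ?thesis by linarith
  qed
  then have "(l * P + (P - 1)) div N ^ j = l * N * M + N * M - 1"
    using div_pred[of "N ^ j" "l * N * M + N * M - 1"] by simp
  also have "\<dots> = N * (l * M + M - 1) + n"
  proof -
    have "N * (l * M + M - 1) = l * N * M + N * M - N"
      by (simp add: diff_mult_distrib2 algebra_simps)
    moreover have "N \<le> N * M" using M(2) by (cases M) auto
    ultimately show ?thesis by linarith
  qed
  finally show ?thesis unfolding digit_def by (simp only: mod_mult_self4 mod_less lessI)
qed

lemma witness_full: "witness a W l (\<lambda>_. n) n T \<longleftrightarrow> T \<subseteq> W \<and> card T = l \<and> feasible a T"
proof -
  have full: "take n (str a j) = str a j" if "j < k" for j using length_str[OF that] by simp
  have fl: "take n (last_str a) = last_str a" using length_last_str by simp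
  have "feasible a T \<longleftrightarrow> (\<forall>j. 0 < j \<and> j < k \<longrightarrow> subseq (nths (S ! 0) T) (str a j)) \<and>
      subseq (nths (S ! 0) T) (last_str a)"
  proof
    assume f: "feasible a T"
    have "subseq (nths (S ! 0) T) (str a j)" if "0 < j" "j < k" for j
      using f[unfolded feasible_def, rule_format, of "j - 1"] that by (simp add: str_def)
    moreover have "subseq (nths (S ! 0) T) (last_str a)"
      using f[unfolded feasible_def, rule_format, of "k - 1"] k_pos by (simp add: last_str_def)
    ultimately show "(\<forall>j. 0 < j \<and> j < k \<longrightarrow> subseq (nths (S ! 0) T) (str a j)) \<and>
      subseq (nths (S ! 0) T) (last_str a)" by blast
  next
    assume r: "(\<forall>j. 0 < j \<and> j < k \<longrightarrow> subseq (nths (S ! 0) T) (str a j)) \<and>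
      subseq (nths (S ! 0) T) (last_str a)"
    show "feasible a T" unfolding feasible_def
    proof (intro allI impI)
      fix j assume j: "j < k"
      show "subseq (nths (S ! 0) T) (S ! (a + j))"
      proof (cases "Suc j < k")
        case True
        then show ?thesis using r[THEN conjunct1, rule_format, of "Suc j"] by (simp add: str_def)
      next
        case False
        then have "j = k - 1" using j by simp
        then show ?thesis using r j by (simp add: last_str_def)
      qed
    qed
  qed
  then show ?thesis using W full fl unfolding witness_def by auto
qed

lemma opt_props:
  shows opt_ge: "T \<subseteq> W \<Longrightarrow> feasible a T \<Longrightarrow> card T \<le> opt a W"
    and opt_attained: "\<exists>T. T \<subseteq> W \<and> feasible a T \<and> card T = opt a W"
    and opt_le: "opt a W \<le> card W"
proof -
  have fin: "finite W" using W finite_subset by blast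
  then have fin': "finite (card ` {T. T \<subseteq> W \<and> feasible a T})" by simp
  show "T \<subseteq> W \<Longrightarrow> feasible a T \<Longrightarrow> card T \<le> opt a W"
    unfolding opt_def using fin' by (intro Max_ge) auto
  have "{} \<in> {T. T \<subseteq> W \<and> feasible a T}" by (simp add: feasible_def)
  then have "opt a W \<in> card ` {T. T \<subseteq> W \<and> feasible a T}"
    unfolding opt_def using fin' by (intro Max_in) blast+
  then show at: "\<exists>T. T \<subseteq> W \<and> feasible a T \<and> card T = opt a W" by auto
  then show "opt a W \<le> card W" using fin card_mono by metis
qed

lemma feasible_mono: "feasible a T \<Longrightarrow> T' \<subseteq> T \<Longrightarrow> feasible a T'"
  unfolding feasible_def using subseq_nths_mono subseq_order.trans by blast

lemma good_full_iff:
  assumes "good a W (l * P + (P - 1)) v"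
  shows "v \<le> n \<longleftrightarrow> l \<le> opt a W"
proof -
  have l: "(l * P + (P - 1)) div P = l" by (subst mult.commute) (rule div_pred, simp)
  have "v \<le> n \<longleftrightarrow> (\<exists>T. witness a W l (digit (l * P + (P - 1))) n T)"
    using assms unfolding good_def l by blast
  also have "\<dots> \<longleftrightarrow> (\<exists>T. witness a W l (\<lambda>_. n) n T)"
    using witness_cong[of "digit (l * P + (P - 1))" "\<lambda>_. n"] digit_full by simp
  also have "\<dots> \<longleftrightarrow> (\<exists>T. T \<subseteq> W \<and> card T = l \<and> feasible a T)" by (simp add: witness_full)
  also have "\<dots> \<longleftrightarrow> l \<le> opt a W"
  proof
    assume "l \<le> opt a W"
    then obtain T where T: "T \<subseteq> W" "feasible a T" "l \<le> card T" using opt_attained by auto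
    from T(3) obtain T' where T': "T' \<subseteq> T" "card T' = l" by (rule obtain_subset_with_card_n)
    show "\<exists>T. T \<subseteq> W \<and> card T = l \<and> feasible a T"
      using T(1) T' feasible_mono[OF T(2) T'(1)] by (intro exI[of _ T']) auto
  qed (use opt_ge in auto)
  finally show ?thesis .
qed

end

end

section \<open>Computing a longest common subsequence\<close>

abbreviation (input) "rK \<equiv> 2 :: nat"
abbreviation (input) "rN \<equiv> 3 :: nat"
abbreviation (input) "rP \<equiv> 4 :: nat"
abbreviation (input) "rE \<equiv> 5 :: nat"
abbreviation (input) "rA \<equiv> 6 :: nat"
abbreviation (input) "rLast \<equiv> 7 :: nat"
abbreviation (input) "rZ \<equiv> 8 :: nat"
abbreviation (input) "rRem \<equiv> 9 :: nat"
abbreviation (input) "rPw \<equiv> 10 :: nat"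
abbreviation (input) "rV \<equiv> 11 :: nat"
abbreviation (input) "rMatch \<equiv> 12 :: nat"
abbreviation (input) "rPos \<equiv> 13 :: nat"
abbreviation (input) "rJ \<equiv> 14 :: nat"
abbreviation (input) "rD \<equiv> 15 :: nat"
abbreviation (input) "rGo \<equiv> 16 :: nat"
abbreviation (input) "rMv \<equiv> 17 :: nat"
abbreviation (input) "rL \<equiv> 18 :: nat"
abbreviation (input) "rBest \<equiv> 19 :: nat"
abbreviation (input) "rI \<equiv> 20 :: nat"
abbreviation (input) "rL1 \<equiv> 21 :: nat"
abbreviation (input) "rLen \<equiv> 22 :: nat"
abbreviation (input) "rX \<equiv> 23 :: nat"

abbreviation (input) "aF \<equiv> 0 :: nat"
abbreviation (input) "aNext \<equiv> 7 :: nat"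
abbreviation (input) "aAlive \<equiv> 2 :: nat"
abbreviation (input) "aFirst \<equiv> 3 :: nat"
abbreviation (input) "aSecond \<equiv> 4 :: nat"
abbreviation (input) "aBest \<equiv> 5 :: nat"

definition Mod :: "aexp \<Rightarrow> aexp \<Rightarrow> aexp" where
  "Mod a b = Monus a (Times (Quot a b) b)"

lemma Mod_simps [simp]:
  "aval S \<sigma> (Mod a b) = aval S \<sigma> a mod aval S \<sigma> b"
  "asize (Mod a b) = 3 + 2 * asize a + 2 * asize b"
  "amax (Mod a b) = max (amax a) (amax b)"
  by (auto simp: Mod_def minus_div_mult_eq_mod)

definition cell_step :: prog where
  "cell_step =
    Seq (Assign rD (Mod (Reg rRem) (Reg rN)))
   (Seq (Assign rRem (Quot (Reg rRem) (Reg rN)))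
   (Seq (Cond (Reg rD)
          (Seq (Cond (Less (Mem (Arr aF (Monus (Reg rZ) (Reg rPw)))) (Reg rV))
                 (Assign rV (Mem (Arr aF (Monus (Reg rZ) (Reg rPw))))) Skip)
               (Cond (SymEq (Times (Less (Num 0) (Reg rJ)) (Monus (Plus (Reg rA) (Reg rJ)) (Num 1)))
                        (Monus (Reg rD) (Num 1)) (Num 0) (Reg rPos))
                 Skip (Assign rMatch (Num 0))))
          (Assign rMatch (Num 0)))
        (Assign rPw (Times (Reg rPw) (Reg rN)))))"

definition cell :: "nat \<Rightarrow> prog" where
  "cell w =
    Seq (Seq (Assign rRem (Reg rZ))
        (Seq (Assign rPw (Num 1))
        (Seq (Assign rV (Reg rN))
        (Seq (Assign rPos (Monus (Mod (Reg rZ) (Reg rN)) (Num 1)))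
             (Assign rMatch (Mem (Arr w (Reg rPos))))))))
   (Seq (For rJ (Reg rK) cell_step)
        (Seq (Cond (Reg rRem)
               (Cond (Reg rMatch)
                 (Seq (Assign rX (Mem (Arr aNext (Plus
                         (Times (Plus (Times (Reg rLast) (Reg rLen)) (Reg rPos)) (Plus (Reg rLen) (Num 2)))
                         (Mem (Arr aF (Monus (Reg rZ) (Plus (Reg rP) (Reg rE)))))))))
                      (Cond (Less (Reg rX) (Reg rV)) (Assign rV (Reg rX)) Skip))
                 Skip)
               (Assign rV (Num 0)))
        (Seq (Store (Arr aF (Reg rZ)) (Reg rV))
        (Seq (Assign rZ (Plus (Reg rZ) (Num 1)))
             (Cond (Less (Reg rLen) (Reg rV))
               (Cond (Mod (Reg rZ) (Reg rP)) Skip (Assign rGo (Num 0))) Skip)))))"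

definition fill :: "nat \<Rightarrow> prog" where
  "fill w = Seq (Seq (Assign rZ (Num 0)) (Assign rGo (Num 1))) (While (Reg rGo) (cell w))"

definition trace_step :: prog where
  "trace_step =
    Seq (Assign rD (Mod (Reg rRem) (Reg rN)))
   (Seq (Assign rRem (Quot (Reg rRem) (Reg rN)))
   (Seq (Cond (Reg rD)
          (Cond (Less (Mem (Arr aF (Reg rZ))) (Mem (Arr aF (Monus (Reg rZ) (Reg rPw)))))
            Skip (Assign rMv (Reg rPw)))
          Skip)
        (Assign rPw (Times (Reg rPw) (Reg rN)))))"

definition trace_body :: "nat \<Rightarrow> prog" where
  "trace_body out =
    Seq (Seq (Assign rRem (Reg rZ))
        (Seq (Assign rPw (Num 1))
             (Assign rMv (Plus (Reg rP) (Reg rE)))))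
   (Seq (For rJ (Reg rK) trace_step)
   (Seq (Cond (Less (Reg rMv) (Reg rP)) Skip
          (Store (Arr out (Monus (Mod (Reg rZ) (Reg rN)) (Num 1))) (Num 1)))
        (Assign rZ (Monus (Reg rZ) (Reg rMv)))))"

definition trace :: "nat \<Rightarrow> prog" where
  "trace out = While (Quot (Reg rZ) (Reg rP)) (trace_body out)"

definition lcs :: "nat \<Rightarrow> nat \<Rightarrow> prog" where
  "lcs w out =
    Seq (fill w)
   (Seq (Seq (Assign rL (Monus (Quot (Reg rZ) (Reg rP)) (Num 2)))
             (Assign rZ (Monus (Reg rZ) (Plus (Reg rP) (Num 1)))))
   (Seq (For rI (Reg rLen) (Store (Arr out (Reg rI)) (Num 0)))
        (trace out)))"

lemma written_cell_step [simp]: "written cell_step = {rD, rRem, rV, rMatch, rPw}"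
  and stored_cell_step [simp]: "stored cell_step = {}"
  and smallp_cell_step [simp]: "smallp cell_step"
  by (auto simp: cell_step_def small_def)

lemma written_cell [simp]: "written (cell w) = {rD, rRem, rV, rMatch, rPw, rPos, rJ, rX, rZ, rGo}"
  and stored_cell [simp]: "stored (cell w) = {aF}"
  and smallp_cell [simp]: "w < 8 \<Longrightarrow> smallp (cell w)"
  by (auto simp: cell_def small_def)

lemma written_fill [simp]: "written (fill w) = {rD, rRem, rV, rMatch, rPw, rPos, rJ, rX, rZ, rGo}"
  and stored_fill [simp]: "stored (fill w) = {aF}"
  and written_trace_step [simp]: "written trace_step = {rD, rRem, rMv, rPw}"
  and stored_trace_step [simp]: "stored trace_step = {}"
  and smallp_trace_step [simp]: "smallp trace_step"
  by (auto simp: fill_def trace_step_def small_def)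

lemma written_trace_body [simp]: "written (trace_body out) = {rD, rRem, rMv, rPw, rJ, rZ}"
  and stored_trace_body [simp]: "out < 8 \<Longrightarrow> stored (trace_body out) = {out}"
  and smallp_trace_body [simp]: "out < 8 \<Longrightarrow> smallp (trace_body out)"
  by (auto simp: trace_body_def small_def)

lemma written_lcs [simp]:
    "written (lcs w out) = {rD, rRem, rV, rMatch, rPw, rPos, rJ, rX, rZ, rGo, rMv, rI, rL}"
  and stored_lcs [simp]: "out < 8 \<Longrightarrow> stored (lcs w out) = {aF, out}"
  by (auto simp: lcs_def trace_def)

lemma emits_simps [simp]: "\<not> emits cell_step" "\<not> emits (cell w)" "\<not> emits (lcs w out)"
  by (auto simp: lcs_def trace_def trace_body_def trace_step_def fill_def cell_def cell_step_def)

locale lcs_run = strings S n k for S :: "'a list list" and n k :: nat +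
  fixes B :: nat
  assumes B: "16 * length S * (n + 2) ^ 2 * Suc n ^ k \<le> 2 ^ B"
    and k: "k = length S div 2"
begin

definition env :: "'a state \<Rightarrow> bool" where
  "env \<sigma> \<longleftrightarrow> regs \<sigma> 0 = length S \<and> regs \<sigma> rLen = n \<and> regs \<sigma> rK = k \<and> regs \<sigma> rN = N \<and> regs \<sigma> rP = P \<and> regs \<sigma> rE = E \<and>
    (\<forall>i<length S. \<forall>p<n. \<forall>x\<le>N.
      arr \<sigma> aNext ((i * n + p) * (n + 2) + x) = nextocc (S ! i) (S ! 0 ! p) x)"

definition flags :: "'a state \<Rightarrow> nat \<Rightarrow> nat set" where
  "flags \<sigma> c = {p. p < n \<and> arr \<sigma> c p \<noteq> 0}"

lemma env_frame:
  "env \<sigma> \<Longrightarrow> frame c \<sigma> \<tau> \<Longrightarrow> written c \<inter> {0, rLen, rK, rN, rP, rE} = {} \<Longrightarrow> aNext \<notin> stored c \<Longrightarrow> env \<tau>"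
  by (auto simp: env_def frame_def)

lemma flags_frame:
  "frame c \<sigma> \<tau> \<Longrightarrow> d < 8 \<Longrightarrow> d \<notin> stored c \<Longrightarrow> flags \<tau> d = flags \<sigma> d"
  by (auto simp: flags_def frame_def)

lemma flags_subset: "flags \<sigma> d \<subseteq> {..<n}"
  by (auto simp: flags_def)

lemma
  assumes "bounded_state B \<sigma>"
  shows bounded_regs: "regs \<sigma> r < 2 ^ B" and bounded_arr: "arr \<sigma> c i < 2 ^ B"
  using assms by (auto simp: bounded_state_def arr_def)

lemma length_S: "2 \<le> length S"
  using k k_pos by simp

lemma len0: "length (S ! 0) = n"
  using length_S by (intro len) linarith

lemma
  shows B4: "4 \<le> B"
    and B_N: "n + 2 < 2 ^ B"
    and B_P: "4 * (n + 2) * P < 2 ^ B"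
    and B_E: "P + E < 2 ^ B"
    and B_next: "length S * n * (n + 2) < 2 ^ B"
    and B_len: "length S < 2 ^ B"
proof -
  let ?m = "length S"
  define Z where "Z = ?m * ((n + 2) * ((n + 2) * P))"
  have m: "1 \<le> ?m" using length_S by simp
  have Z16: "16 * Z \<le> 2 ^ B"
    using B unfolding Z_def by (simp only: power2_eq_square mult.assoc)
  have up: "x \<le> y * x" if "0 < y" for x y :: nat using that by simp
  have Pn: "P \<le> (n + 2) * P" and Pn2: "(n + 2) * P \<le> (n + 2) * ((n + 2) * P)"
    by (rule up, simp)+
  have Z1: "(n + 2) * ((n + 2) * P) \<le> Z" unfolding Z_def by (rule up) (use m in linarith)
  have ZP: "(n + 2) * P \<le> Z" using Pn2 Z1 by (rule order_trans)
  have Ppos: "0 < P" by simp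
  have "0 < Z" using Ppos Pn ZP by (meson less_le_trans)
  then have "(2::nat) ^ 4 \<le> 2 ^ B" using Z16 by simp
  then show "4 \<le> B" by (rule power_le_imp_le_exp[rotated]) simp
  have "4 * (n + 2) * P \<le> 4 * Z" unfolding mult.assoc using ZP by (rule mult_le_mono2)
  then show "4 * (n + 2) * P < 2 ^ B" using Z16 \<open>0 < Z\<close> by linarith
  have "(n + 2) * 1 \<le> (n + 2) * P" by (rule mult_le_mono2) simp
  then have "n + 2 \<le> (n + 2) * P" by simp
  then have "n + 2 \<le> Z" using ZP by (rule order_trans)
  then show "n + 2 < 2 ^ B" using Z16 \<open>0 < Z\<close> by linarith
  have mP: "?m * P \<le> Z" unfolding Z_def by (intro mult_le_mono2 order_trans[OF Pn Pn2])
  have "E \<le> (\<Sum>j<k. P)" by (rule sum_mono) (auto intro!: power_increasing)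
  also have "\<dots> \<le> ?m * P" using k by simp
  finally have "E \<le> Z" using mP by (rule order_trans)
  moreover have "P \<le> Z" using Pn ZP by (rule order_trans)
  ultimately show "P + E < 2 ^ B" using Z16 \<open>0 < Z\<close> by linarith
  have "?m * n * (n + 2) = ?m * ((n + 2) * (n * 1))"
    by (simp only: mult_1_right mult.assoc mult.commute[of n])
  also have "\<dots> \<le> Z" unfolding Z_def by (intro mult_le_mono order_refl) auto
  finally show "?m * n * (n + 2) < 2 ^ B" using Z16 \<open>0 < Z\<close> by linarith
  have "?m \<le> ?m * P" by simp
  then show "?m < 2 ^ B" using mP Z16 \<open>0 < Z\<close> by linarith
qed

lemma B_1: "Suc 0 < 2 ^ B"
  using B_N by linarith

lemma B_k: "k < 2 ^ B"
  using B_len k by (meson div_le_dividend le_less_trans)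

lemma ok_cell_loop:
  assumes env: "env \<sigma>" and a: "0 < a" "a + k \<le> length S" "regs \<sigma> rA = a"
    and z: "regs \<sigma> rZ = z" "regs \<sigma> rRem = z" "regs \<sigma> rPw = 1" "regs \<sigma> rV = N"
    and pos: "regs \<sigma> rPos = digit z 0 - 1"
    and F: "\<And>i. i < k \<Longrightarrow> 0 < digit z i \<Longrightarrow> arr \<sigma> aF (z - N ^ i) \<le> N"
  shows "ok S B (For rJ (Reg rK) cell_step) \<sigma> (2 + k * 10) (\<lambda>\<tau>.
    regs \<tau> rRem = z div P \<and> regs \<tau> rV \<le> N \<and>
    (\<forall>y\<le>n. regs \<tau> rV \<le> y \<longleftrightarrow> (\<exists>i<k. 0 < digit z i \<and> arr \<sigma> aF (z - N ^ i) \<le> y)) \<and>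
    (regs \<tau> rMatch \<noteq> 0 \<longleftrightarrow> regs \<sigma> rMatch \<noteq> 0 \<and>
      (\<forall>i<k. 0 < digit z i \<and> str a i ! (digit z i - 1) = S ! 0 ! (digit z 0 - 1))))"
proof (rule ok_For[where K = k and n = 8 and I = "\<lambda>j \<tau>.
    regs \<tau> rRem = z div N ^ j \<and> regs \<tau> rPw = N ^ j \<and> regs \<tau> rV \<le> N \<and>
    (\<forall>y\<le>n. regs \<tau> rV \<le> y \<longleftrightarrow> (\<exists>i<j. 0 < digit z i \<and> arr \<sigma> aF (z - N ^ i) \<le> y)) \<and>
    (regs \<tau> rMatch \<noteq> 0 \<longleftrightarrow> regs \<sigma> rMatch \<noteq> 0 \<and>
      (\<forall>i<j. 0 < digit z i \<and> str a i ! (digit z i - 1) = S ! 0 ! (digit z 0 - 1)))"])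
  fix j \<tau>
  assume j: "j < k" and I: "regs \<tau> rRem = z div N ^ j \<and> regs \<tau> rPw = N ^ j \<and> regs \<tau> rV \<le> N \<and>
    (\<forall>y\<le>n. regs \<tau> rV \<le> y \<longleftrightarrow> (\<exists>i<j. 0 < digit z i \<and> arr \<sigma> aF (z - N ^ i) \<le> y)) \<and>
    (regs \<tau> rMatch \<noteq> 0 \<longleftrightarrow> regs \<sigma> rMatch \<noteq> 0 \<and>
      (\<forall>i<j. 0 < digit z i \<and> str a i ! (digit z i - 1) = S ! 0 ! (digit z 0 - 1)))"
    and rj: "regs \<tau> rJ = j" and fr: "frame (For rJ (Reg rK) cell_step) \<sigma> \<tau>"
    and bd: "bounded_state B \<tau>"
  let ?d = "digit z j" and ?f = "arr \<sigma> aF (z - N ^ j)"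
  have regs: "regs \<tau> rN = N" "regs \<tau> rZ = z" "regs \<tau> rA = a" "regs \<tau> rPos = digit z 0 - 1"
    "arr \<tau> aF = arr \<sigma> aF"
    using fr env z a pos by (auto simp: frame_def env_def)
  have d: "z div N ^ j mod N = ?d" by (simp add: digit_def)
  have rem: "z div N ^ j div N = z div N ^ Suc j" by (metis div_mult2_eq power_Suc2)
  have pw: "N ^ j * N = N ^ Suc j" by simp
  have pwB: "N ^ Suc j < 2 ^ B"
  proof -
    have "N ^ Suc j \<le> P" using j by (intro power_increasing) auto
    moreover have "P \<le> 4 * (n + 2) * P" by simp
    ultimately show ?thesis using B_P by linarith
  qed
  have remB: "z div N ^ Suc j < 2 ^ B"
    using bounded_regs[OF bd, of rRem] I by (metis rem div_le_dividend le_less_trans)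
  have dB: "?d < 2 ^ B" using digit_le[of z j] B_N by linarith
  have fB: "?f < 2 ^ B" using bounded_arr[OF bd] regs by metis
  have sym: "aval S \<upsilon> (SymEq (Times (Less (Num 0) (Reg rJ)) (Monus (Plus (Reg rA) (Reg rJ)) (Num 1)))
      (Monus (Reg rD) (Num 1)) (Num 0) (Reg rPos)) =
      (if str a j ! (?d - 1) = S ! 0 ! (digit z 0 - 1) then 1 else 0)"
    if "regs \<upsilon> rJ = j" "regs \<upsilon> rA = a" "regs \<upsilon> rD = ?d" "regs \<upsilon> rPos = digit z 0 - 1" "0 < ?d" for \<upsilon>
  proof -
    have dn: "?d - 1 < n" "digit z 0 - 1 < n"
      using digit_le[of z j] digit_le[of z 0] that(5) by linarith+
    have idx: "(if 0 < j then 1 else 0) * (a + j - 1) = (if j = 0 then 0 else a + j - 1)" by simp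
    have S: "(if j = 0 then 0 else a + j - 1) < length S" using a j by auto
    then have v: "valid_pos S (if j = 0 then 0 else a + j - 1) (?d - 1)"
      using len dn(1) unfolding valid_pos_def by metis
    have v0: "valid_pos S 0 (digit z 0 - 1)"
      using length_S len0 dn(2) unfolding valid_pos_def by auto
    show ?thesis unfolding aval.simps that(1-4) idx using v v0 by (simp only: str_def simp_thms if_True)
  qed
  let ?Q = "\<lambda>\<upsilon>. regs \<upsilon> rJ = j \<and> regs (set_reg \<upsilon> rJ (Suc j)) rRem = z div N ^ Suc j \<and>
    regs (set_reg \<upsilon> rJ (Suc j)) rPw = N ^ Suc j \<and> regs (set_reg \<upsilon> rJ (Suc j)) rV \<le> N \<and>
    (\<forall>y\<le>n. regs (set_reg \<upsilon> rJ (Suc j)) rV \<le> y \<longleftrightarrow>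
      (\<exists>i<Suc j. 0 < digit z i \<and> arr \<sigma> aF (z - N ^ i) \<le> y)) \<and>
    (regs (set_reg \<upsilon> rJ (Suc j)) rMatch \<noteq> 0 \<longleftrightarrow> regs \<sigma> rMatch \<noteq> 0 \<and>
      (\<forall>i<Suc j. 0 < digit z i \<and> str a i ! (digit z i - 1) = S ! 0 ! (digit z 0 - 1)))"
  show "ok S B cell_step \<tau> 8 ?Q"
  proof (rule ok_wp_le)
    have I': "regs \<tau> rRem = z div N ^ j" "regs \<tau> rPw = N ^ j" "regs \<tau> rV \<le> N"
      "\<And>y. y \<le> n \<Longrightarrow> regs \<tau> rV \<le> y \<longleftrightarrow> (\<exists>i<j. 0 < digit z i \<and> arr \<sigma> aF (z - N ^ i) \<le> y)"
      "regs \<tau> rMatch \<noteq> 0 \<longleftrightarrow> regs \<sigma> rMatch \<noteq> 0 \<and>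
        (\<forall>i<j. 0 < digit z i \<and> str a i ! (digit z i - 1) = S ! 0 ! (digit z 0 - 1))"
      using I by auto
    have I5: "0 < regs \<tau> rMatch \<longleftrightarrow> regs \<sigma> rMatch \<noteq> 0 \<and>
        (\<forall>i<j. 0 < digit z i \<and> str a i ! (digit z i - 1) = S ! 0 ! (digit z 0 - 1))"
      using I'(5) by simp
    show "wp S B cell_step ?Q \<tau>"
    proof (cases "?d = 0")
      case True
      then show ?thesis unfolding cell_step_def wp.simps
        using I'(3) by (simp add: regs rj I'(1,2,4) I5 Ex_less_Suc All_less_Suc d rem dB remB pwB pw
          del: power_Suc aval.simps(9) mult_Suc_right mult_Suc One_nat_def)
    next
      case False
      have le: "min ?f (regs \<tau> rV) \<le> y \<longleftrightarrow> (\<exists>i<Suc j. 0 < digit z i \<and> arr \<sigma> aF (z - N ^ i) \<le> y)"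
        if "y \<le> n" for y
        using False by (simp only: Ex_less_Suc I'(4)[OF that, symmetric]) auto
      show ?thesis
      proof (cases "?f < regs \<tau> rV")
        case True
        then have "min ?f (regs \<tau> rV) = ?f" by simp
        then show ?thesis unfolding cell_step_def wp.simps
          using le False F[OF j] True
          by (simp add: regs rj I'(1,2) I5 All_less_Suc d rem dB remB fB sym pwB pw
            del: power_Suc aval.simps(9) mult_Suc_right mult_Suc One_nat_def)
      next
        case F: False
        then have "min ?f (regs \<tau> rV) = regs \<tau> rV" by simp
        then show ?thesis unfolding cell_step_def wp.simps
          using le False I'(3) F
          by (simp add: regs rj I'(1,2) I5 All_less_Suc d rem dB remB fB sym pwB pw
            del: power_Suc aval.simps(9) mult_Suc_right mult_Suc One_nat_def)
      qed
    qed
  qed (use B4 in \<open>auto simp: cell_step_def small_def\<close>)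
qed (use env z B_k B4 in \<open>auto simp: small_def env_def frame_def\<close>)

lemma opt_le_n: "0 < a \<Longrightarrow> a + k \<le> length S \<Longrightarrow> W \<subseteq> {..<n} \<Longrightarrow> opt a W \<le> n"
  using opt_le[of a W] card_mono[of "{..<n}" W] by auto

lemma opt_P_bound:
  assumes "0 < a" "a + k \<le> length S" "W \<subseteq> {..<n}"
  shows "(opt a W + 2) * P < 2 ^ B"
proof -
  have "(opt a W + 2) * P \<le> (n + 2) * P" using opt_le_n[OF assms] by (intro mult_le_mono1) simp
  also have "\<dots> \<le> 4 * (n + 2) * P" by (simp only: mult.assoc)
  finally show ?thesis using B_P by linarith
qed

lemma ok_cell:
  assumes env: "env \<sigma>" and a: "0 < a" "a + k \<le> length S" and ra: "regs \<sigma> rA = a" "regs \<sigma> rLast = a + k - 1"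
    and w: "0 < w" "w < 7" and z: "regs \<sigma> rZ = z" "z < (opt a (flags \<sigma> w) + 2) * P"
    and good: "\<And>z'. z' < z \<Longrightarrow> good a (flags \<sigma> w) z' (arr \<sigma> aF z')"
  shows "ok S B (cell w) \<sigma> (20 + k * 10) (\<lambda>\<tau>. regs \<tau> rZ = Suc z \<and>
    (\<forall>z'<Suc z. good a (flags \<sigma> w) z' (arr \<tau> aF z')) \<and>
    regs \<tau> rGo = (if Suc z = (opt a (flags \<sigma> w) + 2) * P then 0 else regs \<sigma> rGo))"
proof (rule ok_bounded)
  assume bd: "bounded_state B \<sigma>"
  define W where "W = flags \<sigma> w"
  have W: "W \<subseteq> {..<n}" unfolding W_def by (rule flags_subset)
  have zB: "z < 2 ^ B" using bounded_regs[OF bd, of rZ] z by simp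
  have ne: "regs \<sigma> rN = N" "regs \<sigma> rLen = n" "regs \<sigma> rP = P" "regs \<sigma> rE = E" using env by (auto simp: env_def)
  have zd: "z mod N = digit z 0" by (simp add: digit_def)
  have NB: "N < 2 ^ B" "digit z 0 - 1 < 2 ^ B" "1 < (2::nat) ^ B"
    using B_N digit_le[of z 0] by linarith+
  have pred: "good a W (z - N ^ i) (arr \<sigma> aF (z - N ^ i))" if "i < k" "0 < digit z i" for i
  proof -
    have "z \<noteq> 0" using that(2) by (metis digit_def div_0 mod_0 less_irrefl)
    then have "z - N ^ i < z" by simp
    from good[OF this] show ?thesis by (simp add: W_def)
  qed
  have predF: "arr \<sigma> aF (z - N ^ i) \<le> N" if "i < k" "0 < digit z i" for i
    using pred[OF that] by (simp add: good_def)
  have diag: "good a W (z - (P + E)) (arr \<sigma> aF (z - (P + E)))" if "0 < z div P"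
  proof -
    have "0 < z" using that by (metis div_0 gr0I less_irrefl)
    then have "z - (P + E) < z" by simp
    from good[OF this] show ?thesis by (simp add: W_def)
  qed
  let ?c = "S ! 0 ! (digit z 0 - 1)" and ?x = "arr \<sigma> aF (z - (P + E))"
  let ?pre = "Seq (Assign rRem (Reg rZ))
        (Seq (Assign rPw (Num 1))
        (Seq (Assign rV (Reg rN))
        (Seq (Assign rPos (Monus (Mod (Reg rZ) (Reg rN)) (Num 1)))
             (Assign rMatch (Mem (Arr w (Reg rPos)))))))"
  let ?loop = "For rJ (Reg rK) cell_step"
  let ?c1 = "Cond (Reg rRem)
               (Cond (Reg rMatch)
                 (Seq (Assign rX (Mem (Arr aNext (Plus
                         (Times (Plus (Times (Reg rLast) (Reg rLen)) (Reg rPos)) (Plus (Reg rLen) (Num 2)))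
                         (Mem (Arr aF (Monus (Reg rZ) (Plus (Reg rP) (Reg rE)))))))))
                      (Cond (Less (Reg rX) (Reg rV)) (Assign rV (Reg rX)) Skip))
                 Skip)
               (Assign rV (Num 0))"
  let ?c2 = "Seq (Store (Arr aF (Reg rZ)) (Reg rV))
        (Seq (Assign rZ (Plus (Reg rZ) (Num 1)))
             (Cond (Less (Reg rLen) (Reg rV))
               (Cond (Mod (Reg rZ) (Reg rP)) Skip (Assign rGo (Num 0))) Skip))"
  let ?Q = "\<lambda>\<tau>. regs \<tau> rZ = Suc z \<and> (\<forall>z'<Suc z. good a W z' (arr \<tau> aF z')) \<and>
    regs \<tau> rGo = (if Suc z = (opt a W + 2) * P then 0 else regs \<sigma> rGo)"
  have "ok S B (cell w) \<sigma> (20 + k * 10) ?Q"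
    unfolding cell_def
  proof (rule ok_Seq[where ?n1.0 = 5 and ?n2.0 = "15 + k * 10" and
        R = "\<lambda>\<tau>. regs \<tau> rRem = z \<and> regs \<tau> rPw = 1 \<and> regs \<tau> rV = N \<and> regs \<tau> rPos = digit z 0 - 1 \<and>
          regs \<tau> rMatch = arr \<sigma> w (digit z 0 - 1)"])
    show "ok S B ?pre \<sigma> 5 (\<lambda>\<tau>. regs \<tau> rRem = z \<and> regs \<tau> rPw = 1 \<and> regs \<tau> rV = N \<and>
        regs \<tau> rPos = digit z 0 - 1 \<and> regs \<tau> rMatch = arr \<sigma> w (digit z 0 - 1))"
      using w B4 by (intro ok_wp_le) (auto simp: z(1) ne zd zB NB[simplified] bounded_arr[OF bd] small_def)
  next
    fix \<tau> assume R: "regs \<tau> rRem = z \<and> regs \<tau> rPw = 1 \<and> regs \<tau> rV = N \<and> regs \<tau> rPos = digit z 0 - 1 \<and>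
          regs \<tau> rMatch = arr \<sigma> w (digit z 0 - 1)"
      and fr: "frame ?pre \<sigma> \<tau>" and bdt: "bounded_state B \<tau>"
    have envt: "env \<tau>" by (rule env_frame[OF env fr]) auto
    have arrt: "arr \<tau> aF = arr \<sigma> aF" using fr by (rule frame_arr) auto
    have regt: "regs \<tau> rZ = z" "regs \<tau> rA = a" "regs \<tau> rLast = a + k - 1" "regs \<tau> rGo = regs \<sigma> rGo"
      using fr z ra by (auto simp: frame_def)
    have loop: "ok S B ?loop \<tau> (2 + k * 10) (\<lambda>\<tau>'. regs \<tau>' rRem = z div P \<and> regs \<tau>' rV \<le> N \<and>
      (\<forall>y\<le>n. regs \<tau>' rV \<le> y \<longleftrightarrow> (\<exists>i<k. 0 < digit z i \<and> arr \<tau> aF (z - N ^ i) \<le> y)) \<and>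
      (regs \<tau>' rMatch \<noteq> 0 \<longleftrightarrow> regs \<tau> rMatch \<noteq> 0 \<and>
      (\<forall>i<k. 0 < digit z i \<and> str a i ! (digit z i - 1) = S ! 0 ! (digit z 0 - 1))))"
      using R regt arrt predF by (intro ok_cell_loop[OF envt a]) auto
    show "ok S B (Seq ?loop (Seq ?c1 ?c2)) \<tau> (15 + k * 10) ?Q"
    proof (rule ok_Seq[OF loop, where ?n2.0 = 13])
      fix \<upsilon> assume L: "regs \<upsilon> rRem = z div P \<and> regs \<upsilon> rV \<le> N \<and>
        (\<forall>y\<le>n. regs \<upsilon> rV \<le> y \<longleftrightarrow> (\<exists>i<k. 0 < digit z i \<and> arr \<tau> aF (z - N ^ i) \<le> y)) \<and>
        (regs \<upsilon> rMatch \<noteq> 0 \<longleftrightarrow> regs \<tau> rMatch \<noteq> 0 \<and>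
        (\<forall>i<k. 0 < digit z i \<and> str a i ! (digit z i - 1) = S ! 0 ! (digit z 0 - 1)))"
        and fr': "frame ?loop \<tau> \<upsilon>" and bdu: "bounded_state B \<upsilon>"
      have envu: "env \<upsilon>" by (rule env_frame[OF envt fr']) auto
      have arru: "arr \<upsilon> aF = arr \<sigma> aF" using frame_arr[OF fr', of aF] arrt by simp
      have regu: "regs \<upsilon> rZ = z" "regs \<upsilon> rLast = a + k - 1" "regs \<upsilon> rGo = regs \<sigma> rGo"
        "regs \<upsilon> rPos = digit z 0 - 1"
        using fr' regt R by (auto simp: frame_def)
      have neu: "regs \<upsilon> rLen = n" "regs \<upsilon> rP = P" "regs \<upsilon> rE = E" using envu by (auto simp: env_def)
      have match: "regs \<upsilon> rMatch \<noteq> 0 \<longleftrightarrow> matches a W z"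
      proof -
        have "digit z 0 - 1 < n" if "0 < digit z 0" using that digit_le[of z 0] by linarith
        then have "digit z 0 - 1 \<in> W \<longleftrightarrow> regs \<tau> rMatch \<noteq> 0" if "0 < digit z 0"
          using that R by (simp add: W_def flags_def)
        moreover have "regs \<upsilon> rMatch \<noteq> 0 \<longleftrightarrow> regs \<tau> rMatch \<noteq> 0 \<and>
            (\<forall>i<k. 0 < digit z i \<and> str a i ! (digit z i - 1) = S ! 0 ! (digit z 0 - 1))"
          using L by blast
        moreover have "matches a W z \<longleftrightarrow> digit z 0 - 1 \<in> W \<and>
            (\<forall>i<k. 0 < digit z i \<and> str a i ! (digit z i - 1) = S ! 0 ! (digit z 0 - 1))"
          using matches_def[OF a W] by blast
        ultimately show ?thesis using k_pos by metis
      qed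
      have rec: "good a W z (if matches a W z then min (nextocc (last_str a) ?c ?x) (regs \<upsilon> rV) else regs \<upsilon> rV)"
        if l: "0 < z div P"
      proof -
        have wi: "(\<exists>T. witness a W (z div P) (digit z) y T) \<longleftrightarrow> regs \<upsilon> rV \<le> y \<or>
            (matches a W z \<and> nextocc (last_str a) ?c ?x \<le> y)" if "y \<le> n" for y
          using witness_iff[OF a W l that, of "arr \<sigma> aF"] pred diag[OF l] L that by (simp add: arrt)
        show ?thesis unfolding good_def using wi L by (auto simp: min_le_iff_disj)
      qed
      have nx: "arr \<upsilon> aNext (((a + k - 1) * n + (digit z 0 - 1)) * (n + 2) + ?x) = nextocc (last_str a) ?c ?x"
        if m: "matches a W z" and l: "0 < z div P"
      proof -
        have "digit z 0 - 1 \<in> W" using m matches_def[OF a W] by blast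
        then have "digit z 0 - 1 < n" using W by blast
        moreover have "a + k - 1 < length S" using a k_pos by linarith
        moreover have "?x \<le> N" using diag[OF l] by (simp add: good_def)
        ultimately show ?thesis using envu by (simp add: env_def last_str_def)
      qed
      show "ok S B (Seq ?c1 ?c2) \<upsilon> 13 ?Q"
      proof (rule ok_Seq[where ?n1.0 = 5 and ?n2.0 = 5 and R = "\<lambda>\<omega>. good a W z (regs \<omega> rV)"])
        have "wp S B ?c1 (\<lambda>\<omega>. good a W z (regs \<omega> rV)) \<upsilon>"
        proof (cases "z div P = 0")
          case True
          then show ?thesis using L good_zero[OF a W True] by simp
        next
          case l: False
          show ?thesis
          proof (cases "matches a W z")
            case True
            have nxl: "nextocc (last_str a) ?c ?x < 2 ^ B"
              using bounded_arr[OF bdu] nx[OF True] l by (metis neq0_conv)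
            then show ?thesis using l True L match rec nx[OF True] nxl regu neu arru by auto
          next
            case False
            then show ?thesis using l L match rec by auto
          qed
        qed
        then show "ok S B ?c1 \<upsilon> 5 (\<lambda>\<omega>. good a W z (regs \<omega> rV))"
          by (rule ok_wp_le) (use B4 in \<open>simp_all add: small_def\<close>)
      next
        fix \<omega> assume v: "good a W z (regs \<omega> rV)" and fr'': "frame ?c1 \<upsilon> \<omega>" and bdw: "bounded_state B \<omega>"
        have regw: "regs \<omega> rZ = z" "regs \<omega> rGo = regs \<sigma> rGo" "regs \<omega> rLen = n" "regs \<omega> rP = P"
          using fr'' regu neu by (auto simp: frame_def)
        have arrw: "arr \<omega> aF = arr \<sigma> aF" using frame_arr[OF fr'', of aF] arru by simp
        have Sz: "Suc z < 2 ^ B" using opt_P_bound[OF a W] z(2) unfolding W_def by linarith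
        have stop: "n < regs \<omega> rV \<and> Suc z mod P = 0 \<longleftrightarrow> Suc z = (opt a W + 2) * P"
        proof (cases "Suc z mod P = 0")
          case True
          then have "P dvd Suc z" by (simp only: dvd_eq_mod_eq_0)
          then obtain q where q: "Suc z = q * P" by (metis dvd_def mult.commute)
          then obtain l where l: "q = Suc l" by (cases q) auto
          have zl: "z = l * P + (P - 1)"
          proof -
            have "0 < P" by simp
            then show ?thesis using q unfolding l mult_Suc by linarith
          qed
          have "regs \<omega> rV \<le> n \<longleftrightarrow> l \<le> opt a W" using v unfolding zl by (rule good_full_iff[OF a W])
          moreover have "Suc l \<le> opt a W + 2"
          proof -
            have "q * P \<le> (opt a W + 2) * P" using z(2) q unfolding W_def by linarith
            then show ?thesis unfolding l by (simp only: mult_le_cancel2) simp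
          qed
          moreover have "Suc z = (opt a W + 2) * P \<longleftrightarrow> Suc l = opt a W + 2"
            unfolding q l by (simp only: mult_cancel2) simp
          ultimately show ?thesis using True by linarith
        next
          case False
          then have "Suc z \<noteq> (opt a W + 2) * P" by (metis mod_mult_self2_is_0)
          then show ?thesis using False by simp
        qed
        have gd: "\<forall>z'<Suc z. good a W z' (if z' = z then regs \<omega> rV else arr \<sigma> aF z')"
          using v good by (auto simp: less_Suc_eq W_def)
        have "wp S B ?c2 ?Q \<omega>"
          using stop Sz gd bounded_regs[OF bdw, of rV]
          by (auto simp: regw arrw simp del: mult_Suc mult_Suc_right)
        then show "ok S B ?c2 \<omega> 5 ?Q"
          by (rule ok_wp_le) (use B4 in \<open>simp_all add: small_def\<close>)
      qed auto
    qed auto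
  qed auto
  then show ?thesis unfolding W_def .
qed

lemma ok_fill:
  assumes env: "env \<sigma>" and a: "0 < a" "a + k \<le> length S" and ra: "regs \<sigma> rA = a" "regs \<sigma> rLast = a + k - 1"
    and w: "0 < w" "w < 7"
  shows "ok S B (fill w) \<sigma> (3 + (opt a (flags \<sigma> w) + 2) * P * (21 + k * 10)) (\<lambda>\<tau>.
    regs \<tau> rZ = (opt a (flags \<sigma> w) + 2) * P \<and>
    (\<forall>z < (opt a (flags \<sigma> w) + 2) * P. good a (flags \<sigma> w) z (arr \<tau> aF z)))"
proof -
  define M where "M = (opt a (flags \<sigma> w) + 2) * P"
  have M0: "0 < M" unfolding M_def by simp
  let ?J = "\<lambda>\<tau>. regs \<tau> rZ \<le> M \<and> regs \<tau> rGo = (if regs \<tau> rZ = M then 0 else 1) \<and>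
    (\<forall>z < regs \<tau> rZ. good a (flags \<sigma> w) z (arr \<tau> aF z))"
  let ?pre = "Seq (Assign rZ (Num 0)) (Assign rGo (Num 1))"
  have "ok S B (fill w) \<sigma> (3 + M * (21 + k * 10)) (\<lambda>\<tau>. regs \<tau> rZ = M \<and>
      (\<forall>z < M. good a (flags \<sigma> w) z (arr \<tau> aF z)))"
    unfolding fill_def
  proof (rule ok_Seq[where ?n1.0 = 2 and ?n2.0 = "M * (21 + k * 10) + 1" and
        R = "\<lambda>\<tau>. regs \<tau> rZ = 0 \<and> regs \<tau> rGo = 1"])
    show "ok S B ?pre \<sigma> 2 (\<lambda>\<tau>. regs \<tau> rZ = 0 \<and> regs \<tau> rGo = 1)"
      using B4 B_1 by (intro ok_wp_le) (auto simp: small_def)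
  next
    fix \<tau> assume R: "regs \<tau> rZ = 0 \<and> regs \<tau> rGo = 1" and fr: "frame ?pre \<sigma> \<tau>"
    show "ok S B (While (Reg rGo) (cell w)) \<tau> (M * (21 + k * 10) + 1) (\<lambda>\<tau>. regs \<tau> rZ = M \<and>
      (\<forall>z < M. good a (flags \<sigma> w) z (arr \<tau> aF z)))"
    proof (rule ok_While[where I = ?J and \<phi> = "\<lambda>\<tau>. (M - regs \<tau> rZ) * (21 + k * 10)"])
      fix \<upsilon> assume J: "?J \<upsilon>" and go: "aval S \<upsilon> (Reg rGo) \<noteq> 0"
        and fr': "frame (While (Reg rGo) (cell w)) \<tau> \<upsilon>"
      have env': "env \<upsilon>" by (rule env_frame[OF env_frame[OF env fr] fr']) auto
      have fl: "flags \<upsilon> w = flags \<sigma> w"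
        using flags_frame[OF fr, of w] flags_frame[OF fr', of w] w by auto
      have ra': "regs \<upsilon> rA = a" "regs \<upsilon> rLast = a + k - 1"
        using fr fr' ra by (auto simp: frame_def)
      have lt: "regs \<upsilon> rZ < M" and go1: "regs \<upsilon> rGo = 1" using J go by (auto split: if_splits)
      have "ok S B (cell w) \<upsilon> (20 + k * 10) (\<lambda>\<omega>. regs \<omega> rZ = Suc (regs \<upsilon> rZ) \<and>
        (\<forall>z' < Suc (regs \<upsilon> rZ). good a (flags \<upsilon> w) z' (arr \<omega> aF z')) \<and>
        regs \<omega> rGo = (if Suc (regs \<upsilon> rZ) = (opt a (flags \<upsilon> w) + 2) * P then 0 else regs \<upsilon> rGo))"
        using J lt by (intro ok_cell[OF env' a ra' w refl]) (auto simp: fl M_def)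
      then have "ok S B (cell w) \<upsilon> (20 + k * 10) (\<lambda>\<omega>. ?J \<omega> \<and>
          (M - regs \<omega> rZ) * (21 + k * 10) + (20 + k * 10) + 1 \<le> (M - regs \<upsilon> rZ) * (21 + k * 10))"
      proof (rule ok_weaken)
        fix \<omega> assume h: "regs \<omega> rZ = Suc (regs \<upsilon> rZ) \<and>
          (\<forall>z' < Suc (regs \<upsilon> rZ). good a (flags \<upsilon> w) z' (arr \<omega> aF z')) \<and>
          regs \<omega> rGo = (if Suc (regs \<upsilon> rZ) = (opt a (flags \<upsilon> w) + 2) * P then 0 else regs \<upsilon> rGo)"
        have "M - regs \<upsilon> rZ = Suc (M - Suc (regs \<upsilon> rZ))" using lt by simp
        then have "(M - Suc (regs \<upsilon> rZ)) * (21 + k * 10) + (20 + k * 10) + 1 =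
            (M - regs \<upsilon> rZ) * (21 + k * 10)" by simp
        then show "?J \<omega> \<and> (M - regs \<omega> rZ) * (21 + k * 10) + (20 + k * 10) + 1 \<le> (M - regs \<upsilon> rZ) * (21 + k * 10)"
          using h[unfolded fl M_def[symmetric]] lt go1 by simp
      qed simp
      then show "\<exists>c. ok S B (cell w) \<upsilon> c (\<lambda>\<omega>. ?J \<omega> \<and>
          (M - regs \<omega> rZ) * (21 + k * 10) + c + 1 \<le> (M - regs \<upsilon> rZ) * (21 + k * 10))" by blast
    qed (use R M0 B4 in \<open>auto simp: small_def split: if_splits\<close>)
  qed simp
  then show ?thesis unfolding M_def .
qed

definition trace_inv :: "nat \<Rightarrow> nat set \<Rightarrow> (nat \<Rightarrow> nat) \<Rightarrow> nat \<Rightarrow> nat set \<Rightarrow> bool" where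
  "trace_inv a W F z T \<longleftrightarrow> F z \<le> n \<and> T \<subseteq> W \<and> (\<forall>p\<in>T. digit z 0 \<le> p) \<and>
     card T + z div P = opt a W \<and> (\<forall>T'. witness a W (z div P) (digit z) (F z) T' \<longrightarrow> feasible a (T' \<union> T))"

context
  fixes a W F
  assumes a: "0 < a" "a + k \<le> length S" and W: "W \<subseteq> {..<n}"
    and F: "\<And>z. z div P \<le> opt a W \<Longrightarrow> good a W z (F z)"
begin

lemma trace_inv_init: "trace_inv a W F (opt a W * P + (P - 1)) {}"
proof -
  let ?z = "opt a W * P + (P - 1)"
  have l: "?z div P = opt a W" by (subst mult.commute) (rule div_pred, simp)
  have Fz: "F ?z \<le> n" using good_full_iff[OF a W F[of ?z]] l by simp
  have "feasible a T" if "witness a W (opt a W) (digit ?z) (F ?z) T" for T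
  proof -
    have "witness a W (opt a W) (\<lambda>_. n) n T" by (rule witness_mono[OF that digit_le Fz])
    then show ?thesis using witness_full[OF a W] by blast
  qed
  then show ?thesis unfolding trace_inv_def l using Fz by simp
qed

lemma trace_inv_reduce:
  assumes inv: "trace_inv a W F z T" and j: "j < k" "0 < digit z j" "F (z - N ^ j) \<le> F z"
  shows "trace_inv a W F (z - N ^ j) T"
proof -
  have l: "(z - N ^ j) div P = z div P" by (rule layer_sub[OF a W j(2,1)])
  have d: "digit (z - N ^ j) = (digit z)(j := digit z j - 1)" by (rule digit_sub[OF a W j(2)])
  have "witness a W (z div P) (digit z) (F z) T'" if "witness a W (z div P) (digit (z - N ^ j)) (F (z - N ^ j)) T'" for T'
    by (rule witness_mono[OF that]) (auto simp: d j)
  moreover have "digit (z - N ^ j) 0 \<le> digit z 0" by (simp add: d)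
  ultimately show ?thesis using inv j(3) unfolding trace_inv_def l by (meson order_trans)
qed

lemma trace_inv_match:
  assumes inv: "trace_inv a W F z T" and l: "0 < z div P"
    and no: "\<And>j. j < k \<Longrightarrow> 0 < digit z j \<Longrightarrow> F z < F (z - N ^ j)"
  shows "trace_inv a W F (z - (P + E)) (insert (digit z 0 - 1) T)" and "digit z 0 - 1 < n"
proof -
  let ?z = "z - (P + E)" and ?p = "digit z 0 - 1"
  have Fn: "F z \<le> n" and lo: "z div P \<le> opt a W" using inv by (auto simp: trace_inv_def)
  have pred: "good a W (z - N ^ j) (F (z - N ^ j))" if "j < k" "0 < digit z j" for j
    by (rule F) (use layer_sub[OF a W that(2,1)] lo in simp)
  have diag: "good a W ?z (F ?z)"
    by (rule F) (use lo div_le_mono[of ?z z P] in \<open>meson diff_le_self order_trans\<close>)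
  have ex: "\<exists>T. witness a W (z div P) (digit z) (F z) T" using F[OF lo] Fn unfolding good_def by blast
  have "\<not> (\<exists>j<k. 0 < digit z j \<and> F (z - N ^ j) \<le> F z)" using no by (meson not_le)
  then have mn: "matches a W z \<and> nextocc (last_str a) (S ! 0 ! ?p) (F ?z) \<le> F z"
    using iffD1[OF witness_iff[OF a W l Fn pred diag] ex] by blast
  then have M: "matches a W z" and nx: "nextocc (last_str a) (S ! 0 ! ?p) (F ?z) \<le> F z"
    by auto
  have m: "?p \<in> W" "\<And>j. j < k \<Longrightarrow> 0 < digit z j"
    "\<And>j. j < k \<Longrightarrow> str a j ! (digit z j - 1) = S ! 0 ! ?p"
    using M matches_def[OF a W] by blast+
  show pn: "?p < n" using m W by blast
  obtain l' where l': "z div P = Suc l'" using l gr0_implies_Suc by blast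
  have lz: "?z div P = l'" using layer_diag[OF a W m(2) l] l' by simp
  have dz: "digit ?z j = digit z j - 1" if "j < k" for j by (rule digit_diag[OF a W m(2) l that])
  obtain x where "F ?z \<le> x" "x < F z"
    using nx nextocc_le_iff[of "F z" "last_str a" "S ! 0 ! ?p" "F ?z"] Fn length_last_str[OF a W] by auto
  then have Fz: "F ?z \<le> n" using Fn by simp
  have "finite T" using inv W by (meson trace_inv_def finite_lessThan finite_subset)
  moreover have "?p \<notin> T" using inv m(2)[OF k_pos] unfolding trace_inv_def by fastforce
  ultimately have "card (insert ?p T) + l' = opt a W" using inv l' by (simp add: trace_inv_def)
  moreover have "feasible a (T' \<union> insert ?p T)" if T': "witness a W l' (digit ?z) (F ?z) T'" for T'
  proof -
    have "witness a W l' (\<lambda>j. digit z j - 1) (F ?z) T'"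
      using T' witness_cong[of "digit ?z" "\<lambda>j. digit z j - 1"] dz by blast
    then have "witness a W (Suc l') (digit z) (F z) (insert ?p T')"
      using m digit_le nx Fn by (intro witness_insert[OF a W]) auto
    then have "feasible a (insert ?p T' \<union> T)" using inv l' unfolding trace_inv_def by metis
    then show ?thesis by simp
  qed
  moreover have "\<forall>p\<in>insert ?p T. digit ?z 0 \<le> p"
    using inv dz[OF k_pos] unfolding trace_inv_def by auto
  ultimately show "trace_inv a W F ?z (insert ?p T)"
    unfolding trace_inv_def lz using Fz m(1) inv by (auto simp: trace_inv_def)
qed

lemma trace_inv_final:
  assumes "trace_inv a W F z T" "z div P = 0"
  shows "T \<subseteq> W" "feasible a T" "card T = opt a W"
proof -
  have "witness a W 0 (digit z) (F z) {}" by (simp add: witness_def)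
  then have "feasible a ({} \<union> T)" using assms unfolding trace_inv_def by metis
  then show "feasible a T" by simp
qed (use assms in \<open>auto simp: trace_inv_def\<close>)

end

lemma ok_trace_loop:
  assumes env: "env \<sigma>"
    and z: "regs \<sigma> rZ = z" "regs \<sigma> rRem = z" "regs \<sigma> rPw = 1" "regs \<sigma> rMv = P + E"
  shows "ok S B (For rJ (Reg rK) trace_step) \<sigma> (2 + k * 8) (\<lambda>\<tau>.
    ((\<exists>i<k. 0 < digit z i \<and> arr \<sigma> aF (z - N ^ i) \<le> arr \<sigma> aF z \<and> regs \<tau> rMv = N ^ i) \<or>
     (\<forall>i<k. 0 < digit z i \<longrightarrow> arr \<sigma> aF z < arr \<sigma> aF (z - N ^ i)) \<and> regs \<tau> rMv = P + E))"
proof (rule ok_For[where K = k and n = 6 and I = "\<lambda>j \<tau>. regs \<tau> rRem = z div N ^ j \<and> regs \<tau> rPw = N ^ j \<and>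
    ((\<exists>i<j. 0 < digit z i \<and> arr \<sigma> aF (z - N ^ i) \<le> arr \<sigma> aF z \<and> regs \<tau> rMv = N ^ i) \<or>
     (\<forall>i<j. 0 < digit z i \<longrightarrow> arr \<sigma> aF z < arr \<sigma> aF (z - N ^ i)) \<and> regs \<tau> rMv = P + E)"])
  fix j \<tau>
  assume j: "j < k" and I: "regs \<tau> rRem = z div N ^ j \<and> regs \<tau> rPw = N ^ j \<and>
    ((\<exists>i<j. 0 < digit z i \<and> arr \<sigma> aF (z - N ^ i) \<le> arr \<sigma> aF z \<and> regs \<tau> rMv = N ^ i) \<or>
     (\<forall>i<j. 0 < digit z i \<longrightarrow> arr \<sigma> aF z < arr \<sigma> aF (z - N ^ i)) \<and> regs \<tau> rMv = P + E)"
    and rj: "regs \<tau> rJ = j" and fr: "frame (For rJ (Reg rK) trace_step) \<sigma> \<tau>"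
    and bd: "bounded_state B \<tau>"
  let ?d = "digit z j" and ?f = "arr \<sigma> aF (z - N ^ j)"
  have regs: "regs \<tau> rN = N" "regs \<tau> rZ = z" "arr \<tau> aF = arr \<sigma> aF"
    using fr env z by (auto simp: frame_def env_def)
  have d: "z div N ^ j mod N = ?d" by (simp add: digit_def)
  have rem: "z div N ^ j div N = z div N ^ Suc j" by (metis div_mult2_eq power_Suc2)
  have pw: "N ^ j * N = N ^ Suc j" by simp
  have pwB: "N ^ Suc j < 2 ^ B"
  proof -
    have "N ^ Suc j \<le> P" using j by (intro power_increasing) auto
    moreover have "P \<le> 4 * (n + 2) * P" by simp
    ultimately show ?thesis using B_P by linarith
  qed
  have pwB': "N ^ j < 2 ^ B" using bounded_regs[OF bd, of rPw] I by simp
  have remB: "z div N ^ Suc j < 2 ^ B"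
    using bounded_regs[OF bd, of rRem] I by (metis rem div_le_dividend le_less_trans)
  have dB: "?d < 2 ^ B" using digit_le[of z j] B_N by linarith
  have I': "regs \<tau> rRem = z div N ^ j" "regs \<tau> rPw = N ^ j" using I by auto
  let ?Q = "\<lambda>\<upsilon>. regs \<upsilon> rJ = j \<and> regs (set_reg \<upsilon> rJ (Suc j)) rRem = z div N ^ Suc j \<and>
    regs (set_reg \<upsilon> rJ (Suc j)) rPw = N ^ Suc j \<and>
    ((\<exists>i<Suc j. 0 < digit z i \<and> arr \<sigma> aF (z - N ^ i) \<le> arr \<sigma> aF z \<and> regs (set_reg \<upsilon> rJ (Suc j)) rMv = N ^ i) \<or>
     (\<forall>i<Suc j. 0 < digit z i \<longrightarrow> arr \<sigma> aF z < arr \<sigma> aF (z - N ^ i)) \<and> regs (set_reg \<upsilon> rJ (Suc j)) rMv = P + E)"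
  show "ok S B trace_step \<tau> 6 ?Q"
  proof (rule ok_wp_le)
    show "wp S B trace_step ?Q \<tau>"
    proof (cases "0 < ?d \<and> ?f \<le> arr \<sigma> aF z")
      case True
      then show ?thesis unfolding trace_step_def wp.simps
        by (simp add: regs rj I' d rem dB remB pwB pwB' pw Ex_less_Suc
          del: power_Suc mult_Suc_right mult_Suc)
    next
      case False
      have U: "(\<exists>i<Suc j. 0 < digit z i \<and> arr \<sigma> aF (z - N ^ i) \<le> arr \<sigma> aF z \<and> regs \<tau> rMv = N ^ i) \<or>
        (\<forall>i<Suc j. 0 < digit z i \<longrightarrow> arr \<sigma> aF z < arr \<sigma> aF (z - N ^ i)) \<and> regs \<tau> rMv = P + E"
        using I False unfolding Ex_less_Suc All_less_Suc by (auto simp: not_le)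
      show ?thesis unfolding trace_step_def wp.simps
        using False U
        by (auto simp add: regs rj I' d rem dB remB pwB pwB' pw
          simp del: power_Suc mult_Suc_right mult_Suc)
    qed
  qed (use B4 in \<open>auto simp: small_def trace_step_def\<close>)
qed (use env z B_k B4 in \<open>auto simp: small_def env_def frame_def\<close>)

lemma flags_set_arr [simp]:
  "out < 8 \<Longrightarrow> c < 8 \<Longrightarrow> p < n \<Longrightarrow> 0 < v \<Longrightarrow>
    flags (set_arr \<sigma> out p v) c = (if c = out then insert p (flags \<sigma> c) else flags \<sigma> c)"
  "flags (set_reg \<sigma> r v) c = flags \<sigma> c"
  by (auto simp: flags_def)

lemma ok_trace:
  assumes env: "env \<sigma>" and a: "0 < a" "a + k \<le> length S" and W: "W \<subseteq> {..<n}"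
    and good: "\<And>z. z div P \<le> opt a W \<Longrightarrow> good a W z (arr \<sigma> aF z)"
    and out: "0 < out" "out < 7" and z0: "regs \<sigma> rZ = opt a W * P + (P - 1)" and fl: "flags \<sigma> out = {}"
  shows "ok S B (trace out) \<sigma> (1 + (opt a W + 1) * P * (14 + k * 8)) (\<lambda>\<tau>.
    flags \<tau> out \<subseteq> W \<and> feasible a (flags \<tau> out) \<and> card (flags \<tau> out) = opt a W)"
  unfolding trace_def
proof (rule ok_While[where I = "\<lambda>\<tau>. trace_inv a W (arr \<sigma> aF) (regs \<tau> rZ) (flags \<tau> out)"
      and \<phi> = "\<lambda>\<tau>. regs \<tau> rZ * (14 + k * 8)"])
  let ?F = "arr \<sigma> aF" and ?a = "Quot (Reg rZ) (Reg rP)"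
  show "trace_inv a W ?F (regs \<sigma> rZ) (flags \<sigma> out)"
    unfolding z0 fl by (rule trace_inv_init[OF a W good])
  show "small ?a" by (simp add: small_def)
  have "opt a W * P + (P - 1) \<le> (opt a W + 1) * P" by simp
  then show "regs \<sigma> rZ * (14 + k * 8) + 1 \<le> 1 + (opt a W + 1) * P * (14 + k * 8)"
    unfolding z0 by (metis add.commute add_le_mono1 mult_le_mono1)
  fix \<tau> assume inv: "trace_inv a W ?F (regs \<tau> rZ) (flags \<tau> out)"
    and fr: "frame (While ?a (trace_body out)) \<sigma> \<tau>" and bd: "bounded_state B \<tau>"
  have env': "env \<tau>" by (rule env_frame[OF env fr]) (use out in auto)
  have rP: "regs \<tau> rP = P" "regs \<tau> rE = E" "regs \<tau> rN = N" using env' by (auto simp: env_def)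
  {
    assume "aval S \<tau> ?a = 0"
    then have "regs \<tau> rZ div P = 0" using rP by simp
    then show "flags \<tau> out \<subseteq> W \<and> feasible a (flags \<tau> out) \<and> card (flags \<tau> out) = opt a W"
      using trace_inv_final[OF a W good inv] by blast
  }
  assume nz: "aval S \<tau> ?a \<noteq> 0"
  define z where "z = regs \<tau> rZ"
  have l: "0 < z div P" using nz rP by (simp add: z_def)
  have z1: "0 < z" using l by (metis div_0 gr0I less_irrefl)
  have zB: "z < 2 ^ B" using bounded_regs[OF bd] by (simp add: z_def)
  have Ft: "arr \<tau> aF = ?F" using frame_arr[OF fr, of aF] out by simp
  let ?J = "\<lambda>\<omega>. trace_inv a W ?F (regs \<omega> rZ) (flags \<omega> out) \<and>
      regs \<omega> rZ * (14 + k * 8) + (8 + k * 8) + 1 \<le> z * (14 + k * 8)"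
  let ?pre = "Seq (Assign rRem (Reg rZ))
        (Seq (Assign rPw (Num 1))
             (Assign rMv (Plus (Reg rP) (Reg rE))))"
  let ?loop = "For rJ (Reg rK) trace_step"
  let ?post = "Seq (Cond (Less (Reg rMv) (Reg rP)) Skip
          (Store (Arr out (Monus (Mod (Reg rZ) (Reg rN)) (Num 1))) (Num 1)))
        (Assign rZ (Monus (Reg rZ) (Reg rMv)))"
  have "ok S B (trace_body out) \<tau> (8 + k * 8) ?J"
    unfolding trace_body_def
  proof (rule ok_Seq[where ?n1.0 = 3 and ?n2.0 = "5 + k * 8" and
        R = "\<lambda>\<upsilon>. regs \<upsilon> rRem = z \<and> regs \<upsilon> rPw = 1 \<and> regs \<upsilon> rMv = P + E"])
    show "ok S B ?pre \<tau> 3 (\<lambda>\<upsilon>. regs \<upsilon> rRem = z \<and> regs \<upsilon> rPw = 1 \<and> regs \<upsilon> rMv = P + E)"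
      using B4 B_1 B_E zB by (intro ok_wp_le) (auto simp: small_def rP z_def)
  next
    fix \<upsilon> assume R: "regs \<upsilon> rRem = z \<and> regs \<upsilon> rPw = 1 \<and> regs \<upsilon> rMv = P + E"
      and fru: "frame ?pre \<tau> \<upsilon>"
    have envu: "env \<upsilon>" by (rule env_frame[OF env' fru]) auto
    have zu: "regs \<upsilon> rZ = z" using fru by (simp add: frame_def z_def)
    have Fu: "arr \<upsilon> aF = ?F" using frame_arr[OF fru, of aF] Ft by simp
    have flu: "flags \<upsilon> out = flags \<tau> out" using fru by (rule flags_frame) (use out in auto)
    have loop: "ok S B ?loop \<upsilon> (2 + k * 8) (\<lambda>\<omega>.
      ((\<exists>i<k. 0 < digit z i \<and> arr \<upsilon> aF (z - N ^ i) \<le> arr \<upsilon> aF z \<and> regs \<omega> rMv = N ^ i) \<or>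
      (\<forall>i<k. 0 < digit z i \<longrightarrow> arr \<upsilon> aF z < arr \<upsilon> aF (z - N ^ i)) \<and> regs \<omega> rMv = P + E))"
      using R zu by (intro ok_trace_loop[OF envu]) auto
    show "ok S B (Seq ?loop ?post) \<upsilon> (5 + k * 8) ?J"
    proof (rule ok_Seq[OF loop, where ?n2.0 = 3])
      fix \<omega> assume mv: "(\<exists>i<k. 0 < digit z i \<and> arr \<upsilon> aF (z - N ^ i) \<le> arr \<upsilon> aF z \<and> regs \<omega> rMv = N ^ i) \<or>
        (\<forall>i<k. 0 < digit z i \<longrightarrow> arr \<upsilon> aF z < arr \<upsilon> aF (z - N ^ i)) \<and> regs \<omega> rMv = P + E"
        and frw: "frame ?loop \<upsilon> \<omega>"
      have zw: "regs \<omega> rZ = z" using frw zu by (simp add: frame_def)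
      have rw: "regs \<omega> rP = P" "regs \<omega> rN = N" using env_frame[OF envu frw] by (auto simp: env_def)
      have flw: "flags \<omega> out = flags \<tau> out" using flags_frame[OF frw, of out] flu out by simp
      have pot: "(z - x) * (14 + k * 8) + (8 + k * 8) + 1 \<le> z * (14 + k * 8)" if "0 < x" for x
      proof -
        have "Suc (z - x) \<le> z" using that z1 by simp
        then have "Suc (z - x) * (14 + k * 8) \<le> z * (14 + k * 8)" by (rule mult_le_mono1)
        then show ?thesis by simp
      qed
      have subB: "z - x < 2 ^ B" for x using zB by simp
      have "wp S B ?post ?J \<omega>" using mv
      proof (elim disjE)
        assume "\<exists>i<k. 0 < digit z i \<and> arr \<upsilon> aF (z - N ^ i) \<le> arr \<upsilon> aF z \<and> regs \<omega> rMv = N ^ i"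
        then obtain i where i: "i < k" "0 < digit z i" "?F (z - N ^ i) \<le> ?F z" "regs \<omega> rMv = N ^ i"
          unfolding Fu by blast
        have "1 < N" using i(2) digit_le[of z i] by linarith
        then have "N ^ i < P" using i(1) by (rule power_strict_increasing[rotated])
        moreover have "trace_inv a W ?F (z - N ^ i) (flags \<omega> out)"
          unfolding flw using inv i by (intro trace_inv_reduce[OF a W good]) (auto simp: z_def)
        ultimately show ?thesis using i(4) pot[of "N ^ i"] subB zw rw by simp
      next
        assume "(\<forall>i<k. 0 < digit z i \<longrightarrow> arr \<upsilon> aF z < arr \<upsilon> aF (z - N ^ i)) \<and> regs \<omega> rMv = P + E"
        then have no: "\<And>i. i < k \<Longrightarrow> 0 < digit z i \<Longrightarrow> ?F z < ?F (z - N ^ i)" and m: "regs \<omega> rMv = P + E"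
          unfolding Fu by auto
        note tm = trace_inv_match[OF a W good inv[folded z_def] l no]
        have zd: "z mod N = digit z 0" by (simp add: digit_def)
        have pe: "0 < P + E" by simp
        show ?thesis using tm m pot[OF pe] subB zw rw zd flw out B_1
          by (simp del: mult_Suc mult_Suc_right)
      qed
      then show "ok S B ?post \<omega> 3 ?J"
        by (rule ok_wp_le) (use B4 out in \<open>simp_all add: small_def\<close>)
    qed simp
  qed simp
  then show "\<exists>c. ok S B (trace_body out) \<tau> c (\<lambda>\<omega>. trace_inv a W ?F (regs \<omega> rZ) (flags \<omega> out) \<and>
      regs \<omega> rZ * (14 + k * 8) + c + 1 \<le> regs \<tau> rZ * (14 + k * 8))"
    unfolding z_def by blast
qed (use B4 in simp)

lemma ok_clear:
  assumes env: "env \<sigma>" and out: "0 < out" "out < 7"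
  shows "ok S B (For rI (Reg rLen) (Store (Arr out (Reg rI)) (Num 0))) \<sigma> (2 + n * 3) (\<lambda>\<tau>. flags \<tau> out = {})"
proof (rule ok_For[where K = n and n = 1 and I = "\<lambda>j \<tau>. \<forall>p<j. arr \<tau> out p = 0"])
  fix j :: nat and \<tau> :: "'a state" assume I: "\<forall>p<j. arr \<tau> out p = 0" and rj: "regs \<tau> rI = j"
  show "ok S B (Store (Arr out (Reg rI)) (Num 0)) \<tau> 1 (\<lambda>\<upsilon>. regs \<upsilon> rI = j \<and> (\<forall>p<Suc j. arr (set_reg \<upsilon> rI (Suc j)) out p = 0))"
    using I rj out B4 by (intro ok_wp_le) (auto simp: small_def less_Suc_eq)
qed (use env out B4 B_N in \<open>auto simp: small_def env_def frame_def flags_def\<close>)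

lemma ok_lcs:
  assumes env: "env \<sigma>" and a: "0 < a" "a + k \<le> length S" and ra: "regs \<sigma> rA = a" "regs \<sigma> rLast = a + k - 1"
    and w: "0 < w" "w < 7" and out: "0 < out" "out < 7" and ne: "w \<noteq> out"
  shows "ok S B (lcs w out) \<sigma> (60 * (opt a (flags \<sigma> w) + 2) * (P * (k + 1))) (\<lambda>\<tau>.
    regs \<tau> rL = opt a (flags \<sigma> w) \<and> flags \<tau> out \<subseteq> flags \<sigma> w \<and> feasible a (flags \<tau> out) \<and>
    card (flags \<tau> out) = opt a (flags \<sigma> w))"
proof -
  define W where "W = flags \<sigma> w"
  define L where "L = opt a W"
  have W: "W \<subseteq> {..<n}" unfolding W_def by (rule flags_subset)
  let ?pre = "Seq (Assign rL (Monus (Quot (Reg rZ) (Reg rP)) (Num 2)))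
             (Assign rZ (Monus (Reg rZ) (Plus (Reg rP) (Num 1))))"
  let ?clr = "For rI (Reg rLen) (Store (Arr out (Reg rI)) (Num 0))"
  let ?Q = "\<lambda>\<tau>. regs \<tau> rL = L \<and> flags \<tau> out \<subseteq> W \<and> feasible a (flags \<tau> out) \<and> card (flags \<tau> out) = L"
  have fill: "ok S B (fill w) \<sigma> (3 + (L + 2) * P * (21 + k * 10)) (\<lambda>\<tau>.
      regs \<tau> rZ = (L + 2) * P \<and> (\<forall>z < (L + 2) * P. good a W z (arr \<tau> aF z)))"
    using ok_fill[OF env a ra w] unfolding W_def L_def .
  define X where "X = P * (k + 1)"
  have "ok S B (lcs w out) \<sigma> (60 * (L + 2) * X) ?Q"
    unfolding lcs_def
  proof (rule ok_Seq[OF fill, where ?n2.0 = "2 + ((2 + n * 3) + (1 + (L + 1) * P * (14 + k * 8)))"])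
    have n: "n \<le> P" using k_pos self_le_power[of N k] by simp
    have PX: "P \<le> X" unfolding X_def by simp
    have "(L + 2) * P * (21 + k * 10) \<le> (L + 2) * P * (21 * (k + 1))" by (intro mult_le_mono2) simp
    also have "\<dots> = 21 * ((L + 2) * X)" by (simp only: X_def ac_simps)
    finally have 1: "(L + 2) * P * (21 + k * 10) \<le> 21 * ((L + 2) * X)" .
    have "(L + 1) * P * (14 + k * 8) \<le> (L + 2) * P * (14 * (k + 1))" by (intro mult_le_mono) simp_all
    also have "\<dots> = 14 * ((L + 2) * X)" by (simp only: X_def ac_simps)
    finally have 2: "(L + 1) * P * (14 + k * 8) \<le> 14 * ((L + 2) * X)" .
    have 3: "X \<le> (L + 2) * X" by simp
    have "0 < X" unfolding X_def by simp
    then have 4: "1 \<le> (L + 2) * X" using 3 by linarith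
    have 5: "n \<le> (L + 2) * X" using n PX 3 by linarith
    have "60 * (L + 2) * X = 60 * ((L + 2) * X)" by (simp only: mult.assoc)
    then show "3 + (L + 2) * P * (21 + k * 10) + (2 + (2 + n * 3 + (1 + (L + 1) * P * (14 + k * 8)))) \<le> 60 * (L + 2) * X"
      using 1 2 4 5 by linarith
  next
    fix \<tau> assume R: "regs \<tau> rZ = (L + 2) * P \<and> (\<forall>z < (L + 2) * P. good a W z (arr \<tau> aF z))"
      and fr: "frame (fill w) \<sigma> \<tau>"
    have env1: "env \<tau>" by (rule env_frame[OF env fr]) auto
    have rP: "regs \<tau> rP = P" using env1 by (simp add: env_def)
    have zP: "(L + 2) * P div P = L + 2" by simp
    have z': "(L + 2) * P - (P + 1) = L * P + (P - 1)" by (simp add: algebra_simps)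
    have LB: "(L + 2) * P < 2 ^ B" using opt_P_bound[OF a W] by (simp add: L_def)
    have LB': "L < 2 ^ B" using opt_le_n[OF a W] B_N by (simp add: L_def)
    show "ok S B (Seq ?pre (Seq ?clr (trace out))) \<tau> (2 + ((2 + n * 3) + (1 + (L + 1) * P * (14 + k * 8)))) ?Q"
    proof (rule ok_Seq[where ?n1.0 = 2 and ?n2.0 = "(2 + n * 3) + (1 + (L + 1) * P * (14 + k * 8))" and
          R = "\<lambda>\<upsilon>. regs \<upsilon> rL = L \<and> regs \<upsilon> rZ = L * P + (P - 1)"])
      have "wp S B ?pre (\<lambda>\<upsilon>. regs \<upsilon> rL = L \<and> regs \<upsilon> rZ = L * P + (P - 1)) \<tau>"
        using R rP zP z' LB LB'
        by (simp del: mult_Suc mult_Suc_right One_nat_def add_Suc_right add_2_eq_Suc' distrib_right_numeral)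
      then show "ok S B ?pre \<tau> 2 (\<lambda>\<upsilon>. regs \<upsilon> rL = L \<and> regs \<upsilon> rZ = L * P + (P - 1))"
        by (rule ok_wp_le) (use B4 in \<open>simp_all add: small_def\<close>)
    next
      fix \<upsilon> assume R2: "regs \<upsilon> rL = L \<and> regs \<upsilon> rZ = L * P + (P - 1)" and fr2: "frame ?pre \<tau> \<upsilon>"
      have env2: "env \<upsilon>" by (rule env_frame[OF env1 fr2]) auto
      show "ok S B (Seq ?clr (trace out)) \<upsilon> ((2 + n * 3) + (1 + (L + 1) * P * (14 + k * 8))) ?Q"
      proof (rule ok_Seq[OF ok_clear[OF env2 out]])
        fix \<omega> assume e: "flags \<omega> out = {}" and fr3: "frame ?clr \<upsilon> \<omega>"
        have env3: "env \<omega>" by (rule env_frame[OF env2 fr3]) (use out in auto)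
        have Fw: "arr \<omega> aF = arr \<tau> aF"
          using frame_arr[OF fr2, of aF] frame_arr[OF fr3, of aF] out by simp
        have rw: "regs \<omega> rZ = L * P + (P - 1)" "regs \<omega> rL = L"
          using fr3 R2 by (auto simp: frame_def)
        have gd: "good a W z (arr \<omega> aF z)" if "z div P \<le> opt a W" for z
        proof -
          have "z < P + z div P * P" by (rule dividend_less_div_times) simp
          also have "\<dots> = Suc (z div P) * P" by (simp only: mult_Suc)
          also have "\<dots> \<le> (L + 2) * P" using that by (intro mult_le_mono1) (simp add: L_def)
          finally show ?thesis using R Fw by auto
        qed
        have "ok S B (trace out) \<omega> (1 + (opt a W + 1) * P * (14 + k * 8)) (\<lambda>\<tau>.
            flags \<tau> out \<subseteq> W \<and> feasible a (flags \<tau> out) \<and> card (flags \<tau> out) = opt a W)"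
          by (rule ok_trace[OF env3 a W gd out _ e]) (use rw in \<open>simp_all add: L_def\<close>)
        then show "ok S B (trace out) \<omega> (1 + (L + 1) * P * (14 + k * 8)) ?Q"
        proof (rule ok_weaken)
          fix \<rho> assume "flags \<rho> out \<subseteq> W \<and> feasible a (flags \<rho> out) \<and> card (flags \<rho> out) = opt a W"
            and "frame (trace out) \<omega> \<rho>"
          moreover have "regs \<rho> rL = L"
            using \<open>frame (trace out) \<omega> \<rho>\<close> rw by (simp add: frame_def trace_def)
          ultimately show "?Q \<rho>" by (simp add: L_def)
        qed (simp add: L_def)
      qed simp
    qed simp
  qed
  then show ?thesis unfolding W_def L_def X_def .
qed

end

section \<open>The greedy algorithm\<close>

definition init_regs :: prog where
  "init_regs =
    Seq (Seq (Assign rLen (Reg 1))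
        (Seq (Assign rK (Quot (Reg 0) (Num 2)))
        (Seq (Assign rN (Plus (Reg rLen) (Num 1)))
        (Seq (Assign rP (Num 1))
             (Assign rE (Num 0))))))
        (For rJ (Reg rK) (Seq (Assign rE (Plus (Reg rE) (Reg rP))) (Assign rP (Times (Reg rP) (Reg rN)))))"

definition next_step :: prog where
  "next_step =
    Seq (Assign rZ (Monus (Reg rL1) (Plus (Reg rI) (Num 1))))
   (Seq (Assign rX (Mod (Reg rZ) (Plus (Reg rLen) (Num 2))))
   (Seq (Assign rD (Quot (Reg rZ) (Plus (Reg rLen) (Num 2))))
        (Cond (Less (Reg rX) (Reg rLen))
          (Cond (SymEq (Quot (Reg rD) (Reg rLen)) (Reg rX) (Num 0) (Mod (Reg rD) (Reg rLen)))
            (Store (Arr aNext (Reg rZ)) (Plus (Reg rX) (Num 1)))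
            (Store (Arr aNext (Reg rZ)) (Mem (Arr aNext (Plus (Reg rZ) (Num 1))))))
          (Store (Arr aNext (Reg rZ)) (Reg rN)))))"

definition init_next :: prog where
  "init_next =
    Seq (Assign rL1 (Times (Reg 0) (Times (Reg rLen) (Plus (Reg rLen) (Num 2)))))
        (For rI (Reg rL1) next_step)"

definition init_alive :: prog where
  "init_alive = For rI (Reg rLen) (Store (Arr aAlive (Reg rI)) (Num 1))"

definition copy_best :: prog where
  "copy_best = For rI (Reg rLen) (Store (Arr aBest (Reg rI)) (Mem (Arr aSecond (Reg rI))))"

definition improve :: prog where
  "improve =
    Seq (Seq (Assign rA (Monus (Reg 0) (Reg rK))) (Assign rLast (Monus (Reg 0) (Num 1))))
   (Seq (lcs aFirst aSecond)
        (Cond (Less (Reg rBest) (Reg rL)) (Seq (Assign rBest (Reg rL)) copy_best) Skip))"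

definition remove_first :: prog where
  "remove_first =
    For rI (Reg rLen) (Cond (Mem (Arr aFirst (Reg rI))) (Store (Arr aAlive (Reg rI)) (Num 0)) Skip)"

definition greedy_round :: prog where
  "greedy_round =
    Seq (Seq (Assign rA (Num 1)) (Assign rLast (Reg rK)))
   (Seq (lcs aAlive aFirst)
   (Seq (Assign rL1 (Reg rL))
        (Cond (Reg rL1) (Seq improve remove_first) Skip)))"

definition greedy :: prog where
  "greedy = Seq (Seq (Assign rBest (Num 0)) (Assign rL1 (Num 1))) (While (Reg rL1) greedy_round)"

definition emit_best :: prog where
  "emit_best = For rI (Reg rLen) (Cond (Mem (Arr aBest (Reg rI))) (Emit (Num 0) (Reg rI)) Skip)"

definition main :: prog where
  "main = Seq init_regs (Seq init_next (Seq init_alive (Seq greedy emit_best)))"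

lemma written_greedy_simps [simp]:
  "written copy_best = {rI}" "stored copy_best = {aBest}" "\<not> emits copy_best"
  "written remove_first = {rI}" "stored remove_first = {aAlive}" "\<not> emits remove_first"
  "written improve = {rA, rLast, rBest, rD, rRem, rV, rMatch, rPw, rPos, rJ, rX, rZ, rGo, rMv, rI, rL}"
  "stored improve = {aF, aSecond, aBest}" "\<not> emits improve"
  by (auto simp: copy_best_def remove_first_def improve_def)

lemma written_round [simp]:
  "written greedy_round = {rA, rLast, rBest, rD, rRem, rV, rMatch, rPw, rPos, rJ, rX, rZ, rGo, rMv, rI, rL, rL1}"
  "stored greedy_round = {aF, aAlive, aFirst, aSecond, aBest}" "\<not> emits greedy_round"
  by (auto simp: greedy_round_def)

lemma square_step:
  fixes b b' c n r a t u :: nat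
  assumes c: "c\<^sup>2 \<le> 2 * b * (n - u) + r\<^sup>2" and r: "r \<le> t" and a: "a \<le> r" "a \<le> b'" and b: "b \<le> b'"
    and u: "t \<le> u" "u \<le> n"
  shows "c\<^sup>2 \<le> 2 * b' * (n - (u - t)) + (r - a)\<^sup>2"
proof -
  obtain d where d: "r = a + d" using a(1) le_Suc_ex by blast
  have "n - (u - t) = (n - u) + t" using u by simp
  then have "2 * b' * (n - (u - t)) = 2 * b' * (n - u) + 2 * (b' * t)" by (simp add: algebra_simps)
  moreover have "2 * b * (n - u) \<le> 2 * b' * (n - u)" using b by simp
  moreover have "a * r \<le> b' * t" using a r by (intro mult_le_mono)
  moreover have "r\<^sup>2 \<le> 2 * (a * r) + (r - a)\<^sup>2" unfolding d by (simp add: power2_eq_square algebra_simps)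
  ultimately show ?thesis using c by linarith
qed

context lcs_run
begin

definition round_cost :: nat where "round_cost = P * (k + 1)"

lemma n_le_round_cost: "n \<le> round_cost" and round_cost_pos: "0 < round_cost"
proof -
  have "n \<le> P" using k_pos self_le_power[of N k] by simp
  also have "P \<le> round_cost" unfolding round_cost_def by simp
  finally show "n \<le> round_cost" .
  show "0 < round_cost" unfolding round_cost_def by simp
qed

definition nexttab :: "nat \<Rightarrow> nat" where
  "nexttab y = nextocc (S ! (y div (n + 2) div n)) (S ! 0 ! (y div (n + 2) mod n)) (y mod (n + 2))"

lemma ok_init_regs:
  assumes "regs \<sigma> 0 = length S" "regs \<sigma> 1 = n"
  shows "ok S B init_regs \<sigma> (7 + k * 4) (\<lambda>\<tau>. regs \<tau> 0 = length S \<and> regs \<tau> rLen = n \<and> regs \<tau> rK = k \<and>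
    regs \<tau> rN = N \<and> regs \<tau> rP = P \<and> regs \<tau> rE = E)"
proof -
  let ?pre = "Seq (Assign rLen (Reg 1))
        (Seq (Assign rK (Quot (Reg 0) (Num 2)))
        (Seq (Assign rN (Plus (Reg rLen) (Num 1)))
        (Seq (Assign rP (Num 1))
             (Assign rE (Num 0)))))"
  let ?body = "Seq (Assign rE (Plus (Reg rE) (Reg rP))) (Assign rP (Times (Reg rP) (Reg rN)))"
  let ?R = "\<lambda>\<tau>. regs \<tau> 0 = length S \<and> regs \<tau> rLen = n \<and> regs \<tau> rK = k \<and> regs \<tau> rN = N"
  show ?thesis unfolding init_regs_def
  proof (rule ok_Seq[where ?n1.0 = 5 and ?n2.0 = "2 + k * (2 + 2)" and
        R = "\<lambda>\<tau>. ?R \<tau> \<and> regs \<tau> rP = 1 \<and> regs \<tau> rE = 0"])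
    have "wp S B ?pre (\<lambda>\<tau>. ?R \<tau> \<and> regs \<tau> rP = 1 \<and> regs \<tau> rE = 0) \<sigma>"
      using assms B_N B_k B_1 k by simp
    then show "ok S B ?pre \<sigma> 5 (\<lambda>\<tau>. ?R \<tau> \<and> regs \<tau> rP = 1 \<and> regs \<tau> rE = 0)"
      by (rule ok_wp_le) (use B4 in \<open>simp_all add: small_def\<close>)
  next
    fix \<tau> :: "'a state" assume R: "?R \<tau> \<and> regs \<tau> rP = 1 \<and> regs \<tau> rE = 0"
    show "ok S B (For rJ (Reg rK) ?body) \<tau> (2 + k * (2 + 2)) (\<lambda>\<tau>. regs \<tau> 0 = length S \<and> regs \<tau> rLen = n \<and>
        regs \<tau> rK = k \<and> regs \<tau> rN = N \<and> regs \<tau> rP = P \<and> regs \<tau> rE = E)"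
    proof (rule ok_For[where K = k and n = 2 and I = "\<lambda>j \<tau>. regs \<tau> rP = N ^ j \<and> regs \<tau> rE = (\<Sum>i<j. N ^ i)"])
      fix j \<upsilon> assume j: "j < k" and I: "regs \<upsilon> rP = N ^ j \<and> regs \<upsilon> rE = (\<Sum>i<j. N ^ i)" and rj: "regs \<upsilon> rJ = j"
        and fr: "frame (For rJ (Reg rK) ?body) \<tau> \<upsilon>"
      have rN: "regs \<upsilon> rN = N" using fr R by (simp add: frame_def)
      have s: "(\<Sum>i<j. N ^ i) + N ^ j = (\<Sum>i<Suc j. N ^ i)" by simp
      have p: "N ^ j * N = N ^ Suc j" by simp
      have "(\<Sum>i<Suc j. N ^ i) \<le> E" using j by (intro sum_mono2) auto
      then have sB: "(\<Sum>i<Suc j. N ^ i) < 2 ^ B" using B_E by linarith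
      have "N ^ Suc j \<le> P" using j by (intro power_increasing) auto
      then have pB: "N ^ Suc j < 2 ^ B" using B_E by linarith
      have "wp S B ?body (\<lambda>\<upsilon>. regs \<upsilon> rJ = j \<and> regs (set_reg \<upsilon> rJ (Suc j)) rP = N ^ Suc j \<and>
          regs (set_reg \<upsilon> rJ (Suc j)) rE = (\<Sum>i<Suc j. N ^ i)) \<upsilon>"
        using I rj rN sB pB by (simp add: s p del: sum.lessThan_Suc power_Suc mult_Suc mult_Suc_right)
      then show "ok S B ?body \<upsilon> 2 (\<lambda>\<upsilon>. regs \<upsilon> rJ = j \<and> regs (set_reg \<upsilon> rJ (Suc j)) rP = N ^ Suc j \<and>
          regs (set_reg \<upsilon> rJ (Suc j)) rE = (\<Sum>i<Suc j. N ^ i))"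
        by (rule ok_wp_le) (use B4 in \<open>simp_all add: small_def\<close>)
    qed (use R B4 B_k in \<open>auto simp: small_def frame_def\<close>)
  qed simp
qed

lemma ok_init_next:
  assumes R: "regs \<sigma> 0 = length S \<and> regs \<sigma> rLen = n \<and> regs \<sigma> rK = k \<and>
    regs \<sigma> rN = N \<and> regs \<sigma> rP = P \<and> regs \<sigma> rE = E"
  shows "ok S B init_next \<sigma> (3 + length S * n * (n + 2) * 8) env"
proof -
  define Z where "Z = length S * n * (n + 2)"
  let ?pre = "Assign rL1 (Times (Reg 0) (Times (Reg rLen) (Plus (Reg rLen) (Num 2))))"
  have ZB: "Z < 2 ^ B" using B_next by (simp add: Z_def)
  have Z: "length S * (n * (n + 2)) = Z" by (simp only: Z_def mult.assoc)
  have "ok S B init_next \<sigma> (3 + Z * 8) env"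
    unfolding init_next_def
  proof (rule ok_Seq[where ?n1.0 = 1 and ?n2.0 = "2 + Z * (6 + 2)" and R = "\<lambda>\<tau>. regs \<tau> rL1 = Z"])
    have "wp S B ?pre (\<lambda>\<tau>. regs \<tau> rL1 = Z) \<sigma>"
      using R ZB Z by (simp del: mult_Suc mult_Suc_right add_2_eq_Suc' distrib_left_numeral)
    then show "ok S B ?pre \<sigma> 1 (\<lambda>\<tau>. regs \<tau> rL1 = Z)"
      by (rule ok_wp_le) (use B4 in \<open>simp_all add: small_def\<close>)
  next
    fix \<tau> assume L1: "regs \<tau> rL1 = Z" and fr: "frame ?pre \<sigma> \<tau>"
    have Rt: "regs \<tau> 0 = length S \<and> regs \<tau> rLen = n \<and> regs \<tau> rK = k \<and>
      regs \<tau> rN = N \<and> regs \<tau> rP = P \<and> regs \<tau> rE = E" using R fr by (simp add: frame_def)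
    show "ok S B (For rI (Reg rL1) next_step) \<tau> (2 + Z * (6 + 2)) env"
    proof (rule ok_For[where K = Z and n = 6 and I = "\<lambda>j \<upsilon>. \<forall>y<Z. Z - j \<le> y \<longrightarrow> arr \<upsilon> aNext y = nexttab y"])
      fix j \<upsilon> assume j: "j < Z" and I: "\<forall>y<Z. Z - j \<le> y \<longrightarrow> arr \<upsilon> aNext y = nexttab y"
        and rj: "regs \<upsilon> rI = j" and fr': "frame (For rI (Reg rL1) next_step) \<tau> \<upsilon>" and bd: "bounded_state B \<upsilon>"
      define y where "y = Z - Suc j"
      define x where "x = y mod (n + 2)"
      define d where "d = y div (n + 2)"
      have ru: "regs \<upsilon> rL1 = Z" "regs \<upsilon> rLen = n" "regs \<upsilon> rN = N"
        using fr' L1 Rt by (auto simp: frame_def next_step_def)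
      have yZ: "y < Z" using j by (simp add: y_def)
      have n0: "0 < n" using yZ unfolding Z_def by (cases n) auto
      have dlt: "d < length S * n" unfolding d_def using yZ[unfolded Z_def] by (rule less_mult_imp_div_less)
      have ilt: "d div n < length S" using dlt by (rule less_mult_imp_div_less)
      have plt: "d mod n < n" using n0 by simp
      have leni: "length (S ! (d div n)) = n" using ilt by (rule len)
      have nt: "nexttab y = nextocc (S ! (d div n)) (S ! 0 ! (d mod n)) x"
        by (simp only: nexttab_def d_def x_def)
      have val: "nexttab y = (if x < n then if S ! (d div n) ! x = S ! 0 ! (d mod n) then Suc x else arr \<upsilon> aNext (Suc y) else N)"
      proof (cases "x < n \<and> S ! (d div n) ! x \<noteq> S ! 0 ! (d mod n)")
        case True
        have sx: "Suc y mod (n + 2) = Suc x" using True by (simp only: mod_Suc x_def) simp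
        have sd: "Suc y div (n + 2) = d" using sx by (simp add: div_Suc d_def)
        have "Suc y \<noteq> Z" using sx unfolding Z_def by (metis mod_mult_self2_is_0 nat.distinct(1))
        then have "arr \<upsilon> aNext (Suc y) = nexttab (Suc y)" using I yZ j by (simp add: y_def)
        also have "\<dots> = nextocc (S ! (d div n)) (S ! 0 ! (d mod n)) (Suc x)"
          by (simp only: nexttab_def sx sd)
        finally show ?thesis using True leni by (simp add: nt nextocc.simps[of _ _ x])
      next
        case False
        then show ?thesis using leni by (auto simp: nt nextocc.simps[of _ _ x])
      qed
      have sym: "valid_pos S (d div n) x \<and> valid_pos S 0 (d mod n)" if "x < n"
        using that ilt plt leni len0 length_S by (auto simp: valid_pos_def)
      have yB: "y < 2 ^ B" using yZ ZB by simp
      have dB: "d < 2 ^ B" "x < 2 ^ B" unfolding d_def x_def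
        using yB by (meson div_le_dividend mod_less_eq_dividend le_less_trans)+
      have sxB: "Suc x < 2 ^ B" if "x < n" using that B_N by simp
      have NB: "N < 2 ^ B" using B_N by simp
      have nx: "y mod Suc (Suc n) = x" "y div Suc (Suc n) = d" by (simp_all add: x_def d_def)
      have y': "Z - Suc j = y" by (simp add: y_def)
      let ?Q = "\<lambda>\<omega>. regs \<omega> rI = j \<and> (\<forall>y<Z. Z - Suc j \<le> y \<longrightarrow> arr (set_reg \<omega> rI (Suc j)) aNext y = nexttab y)"
      have J: "\<forall>y'<Z. y \<le> y' \<longrightarrow> y' \<noteq> y \<longrightarrow> arr \<upsilon> aNext y' = nexttab y'"
        using I j by (auto simp: y_def)
      have "wp S B next_step ?Q \<upsilon>"
        unfolding next_step_def
        using val J sym yB dB sxB NB bounded_arr[OF bd] by (auto simp: ru rj y' nx)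
      then show "ok S B next_step \<upsilon> 6 ?Q"
        by (rule ok_wp_le) (use B4 in \<open>simp_all add: small_def next_step_def\<close>)
    next
      fix \<upsilon> assume I: "\<forall>y<Z. Z - Z \<le> y \<longrightarrow> arr \<upsilon> aNext y = nexttab y"
        and fr': "frame (For rI (Reg rL1) next_step) \<tau> \<upsilon>"
      have "arr \<upsilon> aNext ((i * n + p) * (n + 2) + x) = nextocc (S ! i) (S ! 0 ! p) x"
        if h: "i < length S" "p < n" "x \<le> N" for i p x
      proof -
        let ?y = "(i * n + p) * (n + 2) + x"
        have ip: "Suc (i * n + p) \<le> length S * n"
        proof -
          have "Suc (i * n + p) \<le> Suc i * n" using h(2) by simp
          also have "\<dots> \<le> length S * n" using h(1) by (intro mult_le_mono1) simp
          finally show ?thesis .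
        qed
        have "?y < Suc (i * n + p) * (n + 2)" using h(3) by simp
        also have "\<dots> \<le> Z" unfolding Z_def using ip by (rule mult_le_mono1)
        finally have "arr \<upsilon> aNext ?y = nexttab ?y" using I by simp
        moreover have "?y mod (n + 2) = x" using h(3) by (simp only: mod_mult_self3) simp
        moreover have "?y div (n + 2) = i * n + p"
          by (rule div_nat_eqI) (use h(3) in \<open>simp_all add: algebra_simps\<close>)
        moreover have "(i * n + p) div n = i" "(i * n + p) mod n = p" using h(2) by simp_all
        ultimately show ?thesis by (simp only: nexttab_def)
      qed
      then show "env \<upsilon>" using Rt fr' by (simp add: env_def frame_def next_step_def)
    qed (use L1 B4 ZB in \<open>auto simp: small_def frame_def next_step_def\<close>)
  qed simp
  then show ?thesis unfolding Z_def .
qed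

lemma ok_init_alive:
  assumes env: "env \<sigma>"
  shows "ok S B init_alive \<sigma> (2 + n * 3) (\<lambda>\<tau>. flags \<tau> aAlive = {..<n})"
  unfolding init_alive_def
proof (rule ok_For[where K = n and n = 1 and I = "\<lambda>j \<tau>. \<forall>p<j. arr \<tau> aAlive p = 1"])
  fix j :: nat and \<tau> :: "'a state" assume I: "\<forall>p<j. arr \<tau> aAlive p = 1" and rj: "regs \<tau> rI = j"
  show "ok S B (Store (Arr aAlive (Reg rI)) (Num 1)) \<tau> 1
      (\<lambda>\<upsilon>. regs \<upsilon> rI = j \<and> (\<forall>p<Suc j. arr (set_reg \<upsilon> rI (Suc j)) aAlive p = 1))"
    using I rj B4 B_1 by (intro ok_wp_le) (auto simp: small_def less_Suc_eq)
qed (use env B4 B_N in \<open>auto simp: small_def env_def frame_def flags_def\<close>)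

lemma ok_copy_best:
  assumes env: "env \<sigma>"
  shows "ok S B copy_best \<sigma> (2 + n * 3) (\<lambda>\<tau>. flags \<tau> aBest = flags \<sigma> aSecond)"
  unfolding copy_best_def
proof (rule ok_For[where K = n and n = 1 and I = "\<lambda>j \<tau>. \<forall>p<j. arr \<tau> aBest p = arr \<sigma> aSecond p"])
  fix j :: nat and \<tau> :: "'a state" assume I: "\<forall>p<j. arr \<tau> aBest p = arr \<sigma> aSecond p" and rj: "regs \<tau> rI = j"
    and fr: "frame (For rI (Reg rLen) (Store (Arr aBest (Reg rI)) (Mem (Arr aSecond (Reg rI))))) \<sigma> \<tau>"
    and bd: "bounded_state B \<tau>"
  have s: "arr \<tau> aSecond = arr \<sigma> aSecond" using fr by (rule frame_arr) auto
  have sB: "arr \<sigma> aSecond p < 2 ^ B" for p using bounded_arr[OF bd, of aSecond] s by simp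
  show "ok S B (Store (Arr aBest (Reg rI)) (Mem (Arr aSecond (Reg rI)))) \<tau> 1
      (\<lambda>\<upsilon>. regs \<upsilon> rI = j \<and> (\<forall>p<Suc j. arr (set_reg \<upsilon> rI (Suc j)) aBest p = arr \<sigma> aSecond p))"
    using I rj B4 sB by (intro ok_wp_le) (auto simp: s small_def less_Suc_eq)
qed (use env B4 B_N in \<open>auto simp: small_def env_def frame_def flags_def\<close>)

lemma ok_remove_first:
  assumes env: "env \<sigma>"
  shows "ok S B remove_first \<sigma> (2 + n * 4) (\<lambda>\<tau>. flags \<tau> aAlive = flags \<sigma> aAlive - flags \<sigma> aFirst)"
  unfolding remove_first_def
proof (rule ok_For[where K = n and n = 2 and I = "\<lambda>j \<tau>. \<forall>p. arr \<tau> aAlive p =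
    (if p < j \<and> arr \<sigma> aFirst p \<noteq> 0 then 0 else arr \<sigma> aAlive p)"])
  let ?c = "Cond (Mem (Arr aFirst (Reg rI))) (Store (Arr aAlive (Reg rI)) (Num 0)) Skip"
  fix j :: nat and \<tau> :: "'a state" assume I: "\<forall>p. arr \<tau> aAlive p =
      (if p < j \<and> arr \<sigma> aFirst p \<noteq> 0 then 0 else arr \<sigma> aAlive p)" and rj: "regs \<tau> rI = j"
    and fr: "frame (For rI (Reg rLen) ?c) \<sigma> \<tau>"
  have s: "arr \<tau> aFirst = arr \<sigma> aFirst" using fr by (rule frame_arr) auto
  show "ok S B ?c \<tau> 2
      (\<lambda>\<upsilon>. regs \<upsilon> rI = j \<and> (\<forall>p. arr (set_reg \<upsilon> rI (Suc j)) aAlive p =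
        (if p < Suc j \<and> arr \<sigma> aFirst p \<noteq> 0 then 0 else arr \<sigma> aAlive p)))"
    using I rj B4 by (intro ok_wp_le) (auto simp: s small_def less_Suc_eq)
qed (use env B4 B_N in \<open>auto simp: small_def env_def frame_def flags_def\<close>)

lemma group_bounds: "0 < length S - k" "length S - k + k \<le> length S" "0 < (1::nat)" "1 + k \<le> length S"
  using k k_pos by auto

lemma ok_improve:
  assumes env: "env \<sigma>"
  defines "T \<equiv> flags \<sigma> aFirst"
  defines "L \<equiv> opt (length S - k) T"
  shows "ok S B improve \<sigma> (60 * (L + 2) * round_cost + (6 + n * 3)) (\<lambda>\<tau>. \<exists>T2. T2 \<subseteq> T \<and> feasible (length S - k) T2 \<and>
    card T2 = L \<and> (if regs \<sigma> rBest < L then regs \<tau> rBest = L \<and> flags \<tau> aBest = T2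
      else regs \<tau> rBest = regs \<sigma> rBest \<and> flags \<tau> aBest = flags \<sigma> aBest))"
proof -
  let ?a = "length S - k"
  let ?pre = "Seq (Assign rA (Monus (Reg 0) (Reg rK))) (Assign rLast (Monus (Reg 0) (Num 1)))"
  let ?upd = "Seq (Assign rBest (Reg rL)) copy_best"
  let ?cond = "Cond (Less (Reg rBest) (Reg rL)) ?upd Skip"
  let ?Q = "\<lambda>\<tau>. \<exists>T2. T2 \<subseteq> T \<and> feasible ?a T2 \<and> card T2 = L \<and>
      (if regs \<sigma> rBest < L then regs \<tau> rBest = L \<and> flags \<tau> aBest = T2
      else regs \<tau> rBest = regs \<sigma> rBest \<and> flags \<tau> aBest = flags \<sigma> aBest)"
  show ?thesis unfolding improve_def
  proof (rule ok_Seq[where ?n1.0 = 2 and ?n2.0 = "60 * (L + 2) * round_cost + (4 + n * 3)" and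
        R = "\<lambda>\<tau>. regs \<tau> rA = ?a \<and> regs \<tau> rLast = ?a + k - 1"])
    have "length S - 1 = ?a + k - 1" using group_bounds by simp
    moreover have "length S - x < 2 ^ B" for x using B_len by simp
    moreover have "?a + k - 1 < 2 ^ B" using B_len group_bounds by linarith
    ultimately have "wp S B ?pre (\<lambda>\<tau>. regs \<tau> rA = ?a \<and> regs \<tau> rLast = ?a + k - 1) \<sigma>"
      using env by (simp add: env_def)
    then show "ok S B ?pre \<sigma> 2 (\<lambda>\<tau>. regs \<tau> rA = ?a \<and> regs \<tau> rLast = ?a + k - 1)"
      by (rule ok_wp_le) (use B4 in \<open>simp_all add: small_def\<close>)
  next
    fix \<tau> assume R: "regs \<tau> rA = ?a \<and> regs \<tau> rLast = ?a + k - 1" and fr: "frame ?pre \<sigma> \<tau>"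
    have env1: "env \<tau>" by (rule env_frame[OF env fr]) auto
    have fl: "flags \<tau> aFirst = T" "flags \<tau> aBest = flags \<sigma> aBest"
      unfolding T_def by (rule flags_frame[OF fr]; simp)+
    have best: "regs \<tau> rBest = regs \<sigma> rBest" using fr by (simp add: frame_def)
    have l: "ok S B (lcs aFirst aSecond) \<tau> (60 * (L + 2) * round_cost) (\<lambda>\<upsilon>. regs \<upsilon> rL = L \<and>
        flags \<upsilon> aSecond \<subseteq> T \<and> feasible ?a (flags \<upsilon> aSecond) \<and> card (flags \<upsilon> aSecond) = L)"
      using ok_lcs[OF env1 group_bounds(1,2), of aFirst aSecond] R unfolding fl(1) L_def round_cost_def by simp
    show "ok S B (Seq (lcs aFirst aSecond) ?cond) \<tau> (60 * (L + 2) * round_cost + (4 + n * 3)) ?Q"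
    proof (rule ok_Seq[OF l, where ?n2.0 = "4 + n * 3"])
      fix \<upsilon> assume R2: "regs \<upsilon> rL = L \<and>
        flags \<upsilon> aSecond \<subseteq> T \<and> feasible ?a (flags \<upsilon> aSecond) \<and> card (flags \<upsilon> aSecond) = L"
        and fr2: "frame (lcs aFirst aSecond) \<tau> \<upsilon>" and bd: "bounded_state B \<upsilon>"
      have env2: "env \<upsilon>" by (rule env_frame[OF env1 fr2]) auto
      have flu: "flags \<upsilon> aBest = flags \<sigma> aBest" using flags_frame[OF fr2, of aBest] fl by simp
      have bestu: "regs \<upsilon> rBest = regs \<sigma> rBest" using fr2 best by (simp add: frame_def)
      have LB: "L < 2 ^ B" using bounded_regs[OF bd, of rL] R2 by simp
      show "ok S B ?cond \<upsilon> (4 + n * 3) ?Q"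
      proof (rule ok_Cond[where n = "3 + n * 3"])
        assume "aval S \<upsilon> (Less (Reg rBest) (Reg rL)) \<noteq> 0"
        then have lt: "regs \<sigma> rBest < L" using R2 bestu by (simp split: if_splits)
        show "ok S B ?upd \<upsilon> (3 + n * 3) ?Q"
        proof (rule ok_Seq[where ?n1.0 = 1 and ?n2.0 = "2 + n * 3" and R = "\<lambda>\<omega>. regs \<omega> rBest = L"])
          show "ok S B (Assign rBest (Reg rL)) \<upsilon> 1 (\<lambda>\<omega>. regs \<omega> rBest = L)"
            using R2 LB B4 by (intro ok_Assign) (simp_all add: small_def)
        next
          fix \<omega> assume b: "regs \<omega> rBest = L" and fr3: "frame (Assign rBest (Reg rL)) \<upsilon> \<omega>"
          have env3: "env \<omega>" by (rule env_frame[OF env2 fr3]) auto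
          have flw: "flags \<omega> aSecond = flags \<upsilon> aSecond" using fr3 by (rule flags_frame) auto
          show "ok S B copy_best \<omega> (2 + n * 3) ?Q"
          proof (rule ok_weaken[OF ok_copy_best[OF env3]])
            fix \<rho> assume "flags \<rho> aBest = flags \<omega> aSecond" and "frame copy_best \<omega> \<rho>"
            then have "regs \<rho> rBest = L \<and> flags \<rho> aBest = flags \<upsilon> aSecond"
              using b flw by (simp add: frame_def)
            then show "?Q \<rho>" using R2 lt by (intro exI[of _ "flags \<upsilon> aSecond"]) simp
          qed simp
        qed simp
      next
        assume "aval S \<upsilon> (Less (Reg rBest) (Reg rL)) = 0"
        then have nlt: "\<not> regs \<sigma> rBest < L" using R2 bestu by (simp split: if_splits)
        have "?Q \<upsilon>" using R2 nlt flu bestu by (intro exI[of _ "flags \<upsilon> aSecond"]) simp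
        then show "ok S B Skip \<upsilon> (3 + n * 3) ?Q" by (rule ok_Skip) (use B4 in simp_all)
      qed (use B4 in \<open>simp_all add: small_def\<close>)
    qed simp
  qed simp
qed

lemma ok_round:
  assumes env: "env \<sigma>"
  defines "U \<equiv> flags \<sigma> aAlive"
  defines "L \<equiv> opt 1 U"
  shows "ok S B greedy_round \<sigma> (139 * ((L + 2) * round_cost)) (\<lambda>\<tau>. regs \<tau> rL1 = L \<and>
    (if L = 0 then flags \<tau> aAlive = U \<and> regs \<tau> rBest = regs \<sigma> rBest \<and> flags \<tau> aBest = flags \<sigma> aBest
     else \<exists>T T2. T \<subseteq> U \<and> feasible 1 T \<and> card T = L \<and> flags \<tau> aAlive = U - T \<and>
       T2 \<subseteq> T \<and> feasible (length S - k) T2 \<and> card T2 = opt (length S - k) T \<and>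
       (if regs \<sigma> rBest < card T2 then regs \<tau> rBest = card T2 \<and> flags \<tau> aBest = T2
        else regs \<tau> rBest = regs \<sigma> rBest \<and> flags \<tau> aBest = flags \<sigma> aBest)))"
    (is "ok _ _ _ _ _ ?Q")
proof -
  define Y where "Y = (L + 2) * round_cost"
  have nY: "n \<le> Y" "2 \<le> Y"
  proof -
    have "2 * round_cost \<le> Y" unfolding Y_def by simp
    then show "n \<le> Y" "2 \<le> Y" using n_le_round_cost round_cost_pos by linarith+
  qed
  let ?pre = "Seq (Assign rA (Num 1)) (Assign rLast (Reg rK))"
  let ?cond = "Cond (Reg rL1) (Seq improve remove_first) Skip"
  have "ok S B greedy_round \<sigma> (139 * Y) ?Q" unfolding greedy_round_def
  proof (rule ok_Seq[where ?n1.0 = 2 and ?n2.0 = "60 * Y + (60 * Y + (11 + n * 7))" and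
        R = "\<lambda>\<tau>. regs \<tau> rA = 1 \<and> regs \<tau> rLast = 1 + k - 1"])
    have "wp S B ?pre (\<lambda>\<tau>. regs \<tau> rA = 1 \<and> regs \<tau> rLast = 1 + k - 1) \<sigma>"
      using env B_1 B_k by (simp add: env_def)
    then show "ok S B ?pre \<sigma> 2 (\<lambda>\<tau>. regs \<tau> rA = 1 \<and> regs \<tau> rLast = 1 + k - 1)"
      by (rule ok_wp_le) (use B4 in \<open>simp_all add: small_def\<close>)
    show "2 + (60 * Y + (60 * Y + (11 + n * 7))) \<le> 139 * Y" using nY by linarith
  next
    fix \<tau> assume R: "regs \<tau> rA = 1 \<and> regs \<tau> rLast = 1 + k - 1" and fr: "frame ?pre \<sigma> \<tau>"
    have env1: "env \<tau>" by (rule env_frame[OF env fr]) auto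
    have fl: "flags \<tau> aAlive = U" "flags \<tau> aBest = flags \<sigma> aBest"
      unfolding U_def by (rule flags_frame[OF fr]; simp)+
    have best: "regs \<tau> rBest = regs \<sigma> rBest" using fr by (simp add: frame_def)
    have "ok S B (lcs aAlive aFirst) \<tau> (60 * (L + 2) * round_cost) (\<lambda>\<upsilon>. regs \<upsilon> rL = L \<and>
        flags \<upsilon> aFirst \<subseteq> U \<and> feasible 1 (flags \<upsilon> aFirst) \<and> card (flags \<upsilon> aFirst) = L)"
      using ok_lcs[OF env1 group_bounds(3,4), of aAlive aFirst] R unfolding fl(1) L_def round_cost_def by simp
    then have l: "ok S B (lcs aAlive aFirst) \<tau> (60 * Y) (\<lambda>\<upsilon>. regs \<upsilon> rL = L \<and>
        flags \<upsilon> aFirst \<subseteq> U \<and> feasible 1 (flags \<upsilon> aFirst) \<and> card (flags \<upsilon> aFirst) = L)"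
      by (simp only: Y_def mult.assoc)
    show "ok S B (Seq (lcs aAlive aFirst) (Seq (Assign rL1 (Reg rL)) ?cond)) \<tau>
        (60 * Y + (60 * Y + (11 + n * 7))) ?Q"
    proof (rule ok_Seq[OF l, where ?n2.0 = "60 * Y + (11 + n * 7)"])
      fix \<upsilon> assume R2: "regs \<upsilon> rL = L \<and>
        flags \<upsilon> aFirst \<subseteq> U \<and> feasible 1 (flags \<upsilon> aFirst) \<and> card (flags \<upsilon> aFirst) = L"
        and fr2: "frame (lcs aAlive aFirst) \<tau> \<upsilon>" and bd: "bounded_state B \<upsilon>"
      have LB: "L < 2 ^ B" using bounded_regs[OF bd, of rL] R2 by simp
      define T where "T = flags \<upsilon> aFirst"
      have T: "T \<subseteq> U" "feasible 1 T" "card T = L" using R2 by (auto simp: T_def)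
      have env2: "env \<upsilon>" by (rule env_frame[OF env1 fr2]) auto
      have flu: "flags \<upsilon> aAlive = U" "flags \<upsilon> aBest = flags \<sigma> aBest"
        using flags_frame[OF fr2, of aBest] flags_frame[OF fr2, of aAlive] fl by simp_all
      have bestu: "regs \<upsilon> rBest = regs \<sigma> rBest" using fr2 best by (simp add: frame_def)
      show "ok S B (Seq (Assign rL1 (Reg rL)) ?cond) \<upsilon> (60 * Y + (11 + n * 7)) ?Q"
      proof (rule ok_Seq[where ?n1.0 = 1 and ?n2.0 = "60 * Y + (10 + n * 7)" and R = "\<lambda>\<omega>. regs \<omega> rL1 = L"])
        show "ok S B (Assign rL1 (Reg rL)) \<upsilon> 1 (\<lambda>\<omega>. regs \<omega> rL1 = L)"
          using R2 LB B4 by (intro ok_Assign) (simp_all add: small_def)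
      next
        fix \<omega> assume l1: "regs \<omega> rL1 = L" and fr3: "frame (Assign rL1 (Reg rL)) \<upsilon> \<omega>"
        have env3: "env \<omega>" by (rule env_frame[OF env2 fr3]) auto
        have flw: "flags \<omega> aAlive = U" "flags \<omega> aBest = flags \<sigma> aBest" "flags \<omega> aFirst = T"
          using flags_frame[OF fr3] flu by (simp_all add: T_def)
        have bestw: "regs \<omega> rBest = regs \<sigma> rBest" using fr3 bestu by (simp add: frame_def)
        show "ok S B ?cond \<omega> (60 * Y + (10 + n * 7)) ?Q"
        proof (rule ok_Cond[where n = "60 * Y + (9 + n * 7)"])
          assume "aval S \<omega> (Reg rL1) \<noteq> 0"
          then have L0: "L \<noteq> 0" using l1 by simp
          define L2 where "L2 = opt (length S - k) T"
          have "T \<subseteq> {..<n}" unfolding T_def by (rule flags_subset)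
          then have "L2 \<le> L" using opt_le[OF group_bounds(1,2), of T] T by (simp add: L2_def)
          then have L2Y: "60 * (L2 + 2) * round_cost \<le> 60 * Y" unfolding Y_def mult.assoc
            by (intro mult_le_mono order_refl) simp
          let ?R = "\<lambda>\<rho>. \<exists>T2. T2 \<subseteq> T \<and> feasible (length S - k) T2 \<and> card T2 = L2 \<and>
             (if regs \<sigma> rBest < L2 then regs \<rho> rBest = L2 \<and> flags \<rho> aBest = T2
              else regs \<rho> rBest = regs \<sigma> rBest \<and> flags \<rho> aBest = flags \<sigma> aBest)"
          have imp: "ok S B improve \<omega> (60 * (L2 + 2) * round_cost + (6 + n * 3)) ?R"
            using ok_improve[OF env3] unfolding flw bestw L2_def .
          show "ok S B (Seq improve remove_first) \<omega> (60 * Y + (9 + n * 7)) ?Q"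
          proof (rule ok_Seq[OF imp, where ?n2.0 = "2 + n * 4"])
            fix \<rho> assume R4: "?R \<rho>" and fr4: "frame improve \<omega> \<rho>"
            have env4: "env \<rho>" by (rule env_frame[OF env3 fr4]) auto
            have flr: "flags \<rho> aAlive = U" "flags \<rho> aFirst = T"
              using flags_frame[OF fr4] flw by simp_all
            have l1r: "regs \<rho> rL1 = L" using fr4 l1 by (simp add: frame_def)
            show "ok S B remove_first \<rho> (2 + n * 4) ?Q"
            proof (rule ok_weaken[OF ok_remove_first[OF env4]])
              fix \<pi> assume al: "flags \<pi> aAlive = flags \<rho> aAlive - flags \<rho> aFirst"
                and fr5: "frame remove_first \<rho> \<pi>"
              have r: "regs \<pi> rL1 = L" "regs \<pi> rBest = regs \<rho> rBest" "flags \<pi> aBest = flags \<rho> aBest"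
                using fr5 l1r flags_frame[OF fr5, of aBest] by (simp_all add: frame_def)
              obtain T2 where T2: "T2 \<subseteq> T" "feasible (length S - k) T2" "card T2 = L2"
                "if regs \<sigma> rBest < L2 then regs \<rho> rBest = L2 \<and> flags \<rho> aBest = T2
                 else regs \<rho> rBest = regs \<sigma> rBest \<and> flags \<rho> aBest = flags \<sigma> aBest"
                using R4 by blast
              have all: "T \<subseteq> U \<and> feasible 1 T \<and> card T = L \<and> flags \<pi> aAlive = U - T \<and>
                T2 \<subseteq> T \<and> feasible (length S - k) T2 \<and> card T2 = opt (length S - k) T \<and>
                (if regs \<sigma> rBest < card T2 then regs \<pi> rBest = card T2 \<and> flags \<pi> aBest = T2
                 else regs \<pi> rBest = regs \<sigma> rBest \<and> flags \<pi> aBest = flags \<sigma> aBest)"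
                using T T2 al flr r(2,3) by (simp add: L2_def)
              show "?Q \<pi>" unfolding if_not_P[OF L0]
                by (rule conjI[OF r(1)], rule exI[of _ T], rule exI[of _ T2], rule all)
            qed simp
          qed (use L2Y in linarith)
        next
          assume "aval S \<omega> (Reg rL1) = 0"
          then have "L = 0" using l1 by simp
          then have "?Q \<omega>" using l1 flw bestw by simp
          then show "ok S B Skip \<omega> (60 * Y + (9 + n * 7)) ?Q" by (rule ok_Skip) (use B4 in simp_all)
        qed (use B4 in \<open>simp_all add: small_def\<close>)
      qed simp
    qed simp
  qed
  then show ?thesis unfolding Y_def .
qed

definition common :: "nat set \<Rightarrow> bool" where
  "common T \<longleftrightarrow> (\<forall>i<length S. subseq (nths (S ! 0) T) (S ! i))"

lemma common_imp_feas: "common T \<Longrightarrow> a + k \<le> length S \<Longrightarrow> feasible a T"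
  by (simp add: common_def feasible_def)

lemma common_mono: "common T \<Longrightarrow> T' \<subseteq> T \<Longrightarrow> common T'"
  unfolding common_def using subseq_nths_mono subseq_order.trans by blast

lemma commonI:
  assumes "feasible 1 T" "feasible (length S - k) T"
  shows "common T"
  unfolding common_def
proof (intro allI impI)
  fix i assume i: "i < length S"
  consider "i = 0" | "0 < i" "i \<le> k" | "length S - k \<le> i" using k by linarith
  then show "subseq (nths (S ! 0) T) (S ! i)"
  proof cases
    case 1
    then show ?thesis using subseq_conv_nths by blast
  next
    case 2
    then show ?thesis using assms(1)[unfolded feasible_def, rule_format, of "i - 1"] by simp
  next
    case 3
    then show ?thesis
      using assms(2)[unfolded feasible_def, rule_format, of "i - (length S - k)"] i group_bounds by simp
  qed
qed

lemma ok_greedy: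
  assumes env: "env \<sigma>" and al: "flags \<sigma> aAlive = {..<n}" and best: "flags \<sigma> aBest = {}"
    and O: "Opt \<subseteq> {..<n}" "common Opt"
  shows "ok S B greedy \<sigma> (3 + (3 * n + 2) * (140 * round_cost)) (\<lambda>\<tau>. common (flags \<tau> aBest) \<and>
    (card Opt)\<^sup>2 \<le> 2 * card (flags \<tau> aBest) * n)"
proof -
  let ?pre = "Seq (Assign rBest (Num 0)) (Assign rL1 (Num 1))"
  let ?I = "\<lambda>\<tau>. card (flags \<tau> aBest) = regs \<tau> rBest \<and> common (flags \<tau> aBest) \<and>
    (card Opt)\<^sup>2 \<le> 2 * regs \<tau> rBest * (n - card (flags \<tau> aAlive)) + (card (Opt \<inter> flags \<tau> aAlive))\<^sup>2 \<and>
    (regs \<tau> rL1 = 0 \<longrightarrow> Opt \<inter> flags \<tau> aAlive = {})"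
  let ?\<phi> = "\<lambda>\<tau>. if regs \<tau> rL1 = 0 then 0 else (3 * card (flags \<tau> aAlive) + 2) * (140 * round_cost)"
  let ?Q = "\<lambda>\<tau>. common (flags \<tau> aBest) \<and> (card Opt)\<^sup>2 \<le> 2 * card (flags \<tau> aBest) * n"
  have finO: "finite Opt" using O(1) finite_subset by blast
  show ?thesis unfolding greedy_def
  proof (rule ok_Seq[where ?n1.0 = 2 and ?n2.0 = "(3 * n + 2) * (140 * round_cost) + 1" and
        R = "\<lambda>\<tau>. regs \<tau> rBest = 0 \<and> regs \<tau> rL1 = 1"])
    show "ok S B ?pre \<sigma> 2 (\<lambda>\<tau>. regs \<tau> rBest = 0 \<and> regs \<tau> rL1 = 1)"
      using B4 B_1 by (intro ok_wp_le) (auto simp: small_def)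
  next
    fix \<tau> assume R: "regs \<tau> rBest = 0 \<and> regs \<tau> rL1 = 1" and fr: "frame ?pre \<sigma> \<tau>"
    have env1: "env \<tau>" by (rule env_frame[OF env fr]) auto
    have flt: "flags \<tau> aAlive = {..<n}" "flags \<tau> aBest = {}" using flags_frame[OF fr] al best by simp_all
    show "ok S B (While (Reg rL1) greedy_round) \<tau> ((3 * n + 2) * (140 * round_cost) + 1) ?Q"
    proof (rule ok_While[where I = ?I and \<phi> = ?\<phi>])
      have "common {}" by (simp add: common_def)
      moreover have "Opt \<inter> {..<n} = Opt" using O by auto
      ultimately show "?I \<tau>" using R flt by simp
      show "?\<phi> \<tau> + 1 \<le> (3 * n + 2) * (140 * round_cost) + 1" using R flt by simp
    next
      fix \<upsilon> assume I: "?I \<upsilon>" and go: "aval S \<upsilon> (Reg rL1) \<noteq> 0"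
        and fr2: "frame (While (Reg rL1) greedy_round) \<tau> \<upsilon>"
      have env2: "env \<upsilon>" by (rule env_frame[OF env1 fr2]) auto
      define U where "U = flags \<upsilon> aAlive"
      define L where "L = opt 1 U"
      have U: "U \<subseteq> {..<n}" unfolding U_def by (rule flags_subset)
      then have finU: "finite U" using finite_subset by blast
      have cardU: "card U \<le> n" using card_mono[OF _ U] by simp
      have rL: "card (Opt \<inter> U) \<le> L" unfolding L_def
        using common_imp_feas[OF common_mono[OF O(2)] group_bounds(4), of "Opt \<inter> U"]
        by (intro opt_ge[OF group_bounds(3,4) U]) auto
      have go': "regs \<upsilon> rL1 \<noteq> 0" using go by simp
      let ?P = "\<lambda>\<tau>. regs \<tau> rL1 = L \<and>
        (if L = 0 then flags \<tau> aAlive = U \<and> regs \<tau> rBest = regs \<upsilon> rBest \<and> flags \<tau> aBest = flags \<upsilon> aBest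
         else \<exists>T T2. T \<subseteq> U \<and> feasible 1 T \<and> card T = L \<and> flags \<tau> aAlive = U - T \<and>
           T2 \<subseteq> T \<and> feasible (length S - k) T2 \<and> card T2 = opt (length S - k) T \<and>
           (if regs \<upsilon> rBest < card T2 then regs \<tau> rBest = card T2 \<and> flags \<tau> aBest = T2
            else regs \<tau> rBest = regs \<upsilon> rBest \<and> flags \<tau> aBest = flags \<upsilon> aBest))"
      have "ok S B greedy_round \<upsilon> (139 * ((L + 2) * round_cost)) ?P"
        using ok_round[OF env2] unfolding U_def L_def .
      then have "ok S B greedy_round \<upsilon> (139 * ((L + 2) * round_cost)) (\<lambda>\<omega>. ?I \<omega> \<and> ?\<phi> \<omega> + 139 * ((L + 2) * round_cost) + 1 \<le> ?\<phi> \<upsilon>)"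
      proof (rule ok_weaken)
        fix \<omega> assume P: "?P \<omega>"
        have l1: "regs \<omega> rL1 = L" using P by blast
        have X1: "1 \<le> (L + 2) * round_cost" using round_cost_pos by simp
        have cost: "139 * ((L + 2) * round_cost) + 1 \<le> (L + 2) * (140 * round_cost)"
        proof -
          have "(L + 2) * (140 * round_cost) = 140 * ((L + 2) * round_cost)" by (simp only: ac_simps)
          then show ?thesis using X1 by linarith
        qed
        have phi: "?\<phi> \<upsilon> = (3 * card U + 2) * (140 * round_cost)" using go' by (simp add: U_def)
        show "?I \<omega> \<and> ?\<phi> \<omega> + 139 * ((L + 2) * round_cost) + 1 \<le> ?\<phi> \<upsilon>"
        proof (cases "L = 0")
          case True
          then have P0: "flags \<omega> aAlive = U" "regs \<omega> rBest = regs \<upsilon> rBest" "flags \<omega> aBest = flags \<upsilon> aBest"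
            using P by auto
          have "Opt \<inter> U = {}" using rL True finO by simp
          then have "?I \<omega>" using I P0 unfolding U_def by simp
          moreover have "?\<phi> \<omega> + 139 * ((L + 2) * round_cost) + 1 \<le> ?\<phi> \<upsilon>"
          proof -
            have "(L + 2) * (140 * round_cost) \<le> (3 * card U + 2) * (140 * round_cost)"
              using True by (intro mult_le_mono1) simp
            then have "139 * ((L + 2) * round_cost) + 1 \<le> ?\<phi> \<upsilon>" unfolding phi using cost by linarith
            moreover have "?\<phi> \<omega> = 0" using l1 True by simp
            ultimately show ?thesis by linarith
          qed
          ultimately show ?thesis by blast
        next
          case False
          then obtain T T2 where T: "T \<subseteq> U" "feasible 1 T" "card T = L" "flags \<omega> aAlive = U - T"
            "T2 \<subseteq> T" "feasible (length S - k) T2" "card T2 = opt (length S - k) T"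
            "if regs \<upsilon> rBest < card T2 then regs \<omega> rBest = card T2 \<and> flags \<omega> aBest = T2
             else regs \<omega> rBest = regs \<upsilon> rBest \<and> flags \<omega> aBest = flags \<upsilon> aBest"
            using P by auto
          have Tn: "T \<subseteq> {..<n}" using T(1) U by blast
          have finT: "finite T" using Tn finite_subset by blast
          have "common T2"
            using commonI[OF feasible_mono[OF group_bounds(3,4) Tn T(2,5)] T(6)] .
          then have b1: "card (flags \<omega> aBest) = regs \<omega> rBest \<and> common (flags \<omega> aBest)"
            using T(8) I by (auto split: if_splits)
          have b2: "regs \<upsilon> rBest \<le> regs \<omega> rBest" "card T2 \<le> regs \<omega> rBest"
            using T(8) by (auto split: if_splits)
          have "card (Opt \<inter> T) \<le> card T2" unfolding T(7)
            using common_imp_feas[OF common_mono[OF O(2)] group_bounds(2), of "Opt \<inter> T"]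
            by (intro opt_ge[OF group_bounds(1,2) Tn]) auto
          then have aT: "card (Opt \<inter> T) \<le> regs \<omega> rBest" using b2 by linarith
          have r': "card (Opt \<inter> (U - T)) = card (Opt \<inter> U) - card (Opt \<inter> T)"
          proof -
            have "Opt \<inter> (U - T) = (Opt \<inter> U) - (Opt \<inter> T)" by auto
            moreover have "Opt \<inter> T \<subseteq> Opt \<inter> U" using T(1) by blast
            ultimately show ?thesis using finO card_Diff_subset[of "Opt \<inter> T" "Opt \<inter> U"] by simp
          qed
          have aU: "card (Opt \<inter> T) \<le> card (Opt \<inter> U)" using T(1) finO by (intro card_mono) auto
          have u': "card (U - T) = card U - card T" using T(1) finT by (rule card_Diff_subset[rotated])
          have TU: "card T \<le> card U" using T(1) finU by (rule card_mono[rotated])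
          have "(card Opt)\<^sup>2 \<le> 2 * regs \<upsilon> rBest * (n - card U) + (card (Opt \<inter> U))\<^sup>2"
            using I by (simp add: U_def)
          from square_step[OF this _ aU aT b2(1) TU cardU]
          have "(card Opt)\<^sup>2 \<le> 2 * regs \<omega> rBest * (n - card (U - T)) + (card (Opt \<inter> (U - T)))\<^sup>2"
            using rL T(3) unfolding u' r' by simp
          then have "?I \<omega>" using b1 T(4) l1 False by simp
          moreover have "?\<phi> \<omega> + 139 * ((L + 2) * round_cost) + 1 \<le> ?\<phi> \<upsilon>"
          proof -
            have "?\<phi> \<omega> = (3 * card (U - T) + 2) * (140 * round_cost)" using l1 False T(4) by simp
            moreover have "(3 * card (U - T) + 2) * (140 * round_cost) + (L + 2) * (140 * round_cost) \<le> (3 * card U + 2) * (140 * round_cost)"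
              unfolding add_mult_distrib[symmetric] u' T(3) using TU T(3) False by (intro mult_le_mono1) simp
            ultimately show ?thesis unfolding phi using cost by linarith
          qed
          ultimately show ?thesis by blast
        qed
      qed simp
      then show "\<exists>c. ok S B greedy_round \<upsilon> c (\<lambda>\<omega>. ?I \<omega> \<and> ?\<phi> \<omega> + c + 1 \<le> ?\<phi> \<upsilon>)" by blast
    next
      fix \<upsilon> assume I: "?I \<upsilon>" and stop: "aval S \<upsilon> (Reg rL1) = 0"
      have "regs \<upsilon> rL1 = 0" using stop by simp
      then have e: "Opt \<inter> flags \<upsilon> aAlive = {}" using I by blast
      have c: "card (flags \<upsilon> aBest) = regs \<upsilon> rBest" using I by blast
      have "(card Opt)\<^sup>2 \<le> 2 * regs \<upsilon> rBest * (n - card (flags \<upsilon> aAlive)) + (card (Opt \<inter> flags \<upsilon> aAlive))\<^sup>2"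
        using I by blast
      then have "(card Opt)\<^sup>2 \<le> 2 * card (flags \<upsilon> aBest) * (n - card (flags \<upsilon> aAlive))"
        unfolding e c by simp
      also have "\<dots> \<le> 2 * card (flags \<upsilon> aBest) * n" by (intro mult_le_mono2) simp
      finally show "?Q \<upsilon>" using I by blast
    qed (use B4 in \<open>simp_all add: small_def\<close>)
  qed simp
qed

lemma ok_emit_best:
  assumes env: "env \<sigma>" and out: "outp \<sigma> = []"
  shows "ok S B emit_best \<sigma> (2 + n * 4) (\<lambda>\<tau>. outp \<tau> = nths (S ! 0) (flags \<sigma> aBest))"
  unfolding emit_best_def
proof (rule ok_For[where K = n and n = 2 and I = "\<lambda>j \<tau>. outp \<tau> = nths (take j (S ! 0)) (flags \<sigma> aBest)"])
  let ?c = "Cond (Mem (Arr aBest (Reg rI))) (Emit (Num 0) (Reg rI)) Skip"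
  fix j :: nat and \<tau> :: "'a state" assume j: "j < n"
    and I: "outp \<tau> = nths (take j (S ! 0)) (flags \<sigma> aBest)" and rj: "regs \<tau> rI = j"
    and fr: "frame (For rI (Reg rLen) ?c) \<sigma> \<tau>"
  have s: "arr \<tau> aBest = arr \<sigma> aBest" using fr by (rule frame_arr) auto
  have "valid_pos S 0 j" using j len0 length_S by (auto simp: valid_pos_def)
  moreover have "nths (take (Suc j) (S ! 0)) (flags \<sigma> aBest) =
      nths (take j (S ! 0)) (flags \<sigma> aBest) @ (if arr \<sigma> aBest j \<noteq> 0 then [S ! 0 ! j] else [])"
    using j len0 by (subst nths_take_Suc) (auto simp: flags_def)
  ultimately show "ok S B ?c \<tau> 2 (\<lambda>\<upsilon>. regs \<upsilon> rI = j \<and>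
      outp (set_reg \<upsilon> rI (Suc j)) = nths (take (Suc j) (S ! 0)) (flags \<sigma> aBest))"
    using I rj B4 by (intro ok_wp_le) (auto simp: s small_def)
qed (use env out B4 B_N len0 in \<open>auto simp: small_def env_def frame_def\<close>)

lemma ok_main:
  assumes init: "regs \<sigma> 0 = length S" "regs \<sigma> 1 = n" "flags \<sigma> aBest = {}" "outp \<sigma> = []"
    and O: "Opt \<subseteq> {..<n}" "common Opt"
  shows "ok S B main \<sigma> (17 + k * 4 + length S * n * (n + 2) * 8 + n * 7 + (3 * n + 2) * (140 * round_cost))
    (\<lambda>\<tau>. \<exists>T \<subseteq> {..<n}. common T \<and> (card Opt)\<^sup>2 \<le> 2 * card T * n \<and> outp \<tau> = nths (S ! 0) T)"
    (is "ok _ _ _ _ _ ?Q")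
proof -
  let ?n1 = "7 + k * 4" and ?n2 = "3 + length S * n * (n + 2) * 8" and ?n3 = "2 + n * 3"
    and ?n4 = "3 + (3 * n + 2) * (140 * round_cost)" and ?n5 = "2 + n * 4"
  have "ok S B main \<sigma> (?n1 + (?n2 + (?n3 + (?n4 + ?n5)))) ?Q"
    unfolding main_def
  proof (rule ok_Seq[OF ok_init_regs[OF init(1,2)] _ order_refl])
    fix \<tau> assume R: "regs \<tau> 0 = length S \<and> regs \<tau> rLen = n \<and> regs \<tau> rK = k \<and>
      regs \<tau> rN = N \<and> regs \<tau> rP = P \<and> regs \<tau> rE = E" and fr1: "frame init_regs \<sigma> \<tau>"
    show "ok S B (Seq init_next (Seq init_alive (Seq greedy emit_best))) \<tau> (?n2 + (?n3 + (?n4 + ?n5))) ?Q"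
    proof (rule ok_Seq[OF ok_init_next[OF R] _ order_refl])
      fix \<upsilon> assume env: "env \<upsilon>" and fr2: "frame init_next \<tau> \<upsilon>"
      show "ok S B (Seq init_alive (Seq greedy emit_best)) \<upsilon> (?n3 + (?n4 + ?n5)) ?Q"
      proof (rule ok_Seq[OF ok_init_alive[OF env] _ order_refl])
        fix \<omega> assume al: "flags \<omega> aAlive = {..<n}" and fr3: "frame init_alive \<upsilon> \<omega>"
        have env3: "env \<omega>" by (rule env_frame[OF env fr3]) (auto simp: init_alive_def)
        have be: "flags \<omega> aBest = {}"
          using flags_frame[OF fr1, of aBest] flags_frame[OF fr2, of aBest] flags_frame[OF fr3, of aBest] init
          by (simp add: init_regs_def init_next_def next_step_def init_alive_def)
        have ow: "outp \<omega> = []"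
          using frame_outp[OF fr1] frame_outp[OF fr2] frame_outp[OF fr3] init
          by (simp add: init_regs_def init_next_def next_step_def init_alive_def)
        show "ok S B (Seq greedy emit_best) \<omega> (?n4 + ?n5) ?Q"
        proof (rule ok_Seq[OF ok_greedy[OF env3 al be O] _ order_refl])
          fix \<rho> assume G: "common (flags \<rho> aBest) \<and> (card Opt)\<^sup>2 \<le> 2 * card (flags \<rho> aBest) * n"
            and fr4: "frame greedy \<omega> \<rho>"
          have env4: "env \<rho>" by (rule env_frame[OF env3 fr4]) (auto simp: greedy_def)
          have orr: "outp \<rho> = []" using frame_outp[OF fr4] ow by (simp add: greedy_def)
          show "ok S B emit_best \<rho> ?n5 ?Q"
            by (rule ok_weaken[OF ok_emit_best[OF env4 orr] order_refl])
              (use G flags_subset in blast)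
        qed
      qed
    qed
  qed
  then show ?thesis by (rule ok_weaken) auto
qed

end

section \<open>Running time and correctness\<close>

definition value_bits :: "nat \<Rightarrow> nat \<Rightarrow> nat" where
  "value_bits m n = floorlog 2 (16 * m * (n + 2) ^ 2 * Suc n ^ (m div 2))"

definition main_steps :: "nat \<Rightarrow> nat \<Rightarrow> nat" where
  "main_steps m n = 17 + (m div 2) * 4 + m * n * (n + 2) * 8 + n * 7 +
     (3 * n + 2) * (140 * (Suc n ^ (m div 2) * (m div 2 + 1)))"

definition main_time :: "nat \<Rightarrow> nat \<Rightarrow> nat" where
  "main_time m n = main_steps m n * unit_cost (value_bits m n)"

lemma main_steps_le:
  assumes m: "2 \<le> m" and n: "2 \<le> n"
  shows "main_steps m n \<le> 602 * 4 ^ m * n ^ (m div 2 + 1)"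
proof -
  define k where "k = m div 2"
  define Q where "Q = n ^ (k + 1)"
  have k: "1 \<le> k" "k + 1 \<le> m" "4 * k \<le> 2 * m" unfolding k_def using m by auto
  have n1: "n \<le> Q" unfolding Q_def using n self_le_power[of n "k + 1"] by simp
  then have Q1: "1 \<le> Q" using n by linarith
  have "n ^ 2 \<le> Q" unfolding Q_def using n k by (intro power_increasing) auto
  moreover have "n * (n + 2) \<le> n * (2 * n)" using n by (intro mult_le_mono2) simp
  then have "n * (n + 2) \<le> 2 * n ^ 2" by (simp add: power2_eq_square)
  ultimately have nn: "n * (n + 2) \<le> 2 * Q" by linarith
  have "m * n * (n + 2) * 8 = m * (n * (n + 2)) * 8" by (simp only: mult.assoc)
  also have "\<dots> \<le> m * (2 * Q) * 8" using nn by (intro mult_le_mono1 mult_le_mono2)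
  finally have s1: "m * n * (n + 2) * 8 \<le> 16 * (m * Q)" by simp
  have "Suc n ^ k \<le> (2 * n) ^ k" using n by (intro power_mono) auto
  also have "\<dots> = 2 ^ k * n ^ k" by (rule power_mult_distrib)
  also have "\<dots> \<le> 2 ^ m * n ^ k" using k by (intro mult_le_mono1 power_increasing) auto
  finally have pk: "Suc n ^ k \<le> 2 ^ m * n ^ k" .
  have "(3 * n + 2) * (140 * (Suc n ^ k * (k + 1))) \<le> (4 * n) * (140 * ((2 ^ m * n ^ k) * m))"
    using n pk k by (intro mult_le_mono order_refl) auto
  also have "\<dots> = 560 * (m * (2 ^ m * Q))" by (simp add: Q_def)
  finally have s2: "(3 * n + 2) * (140 * (Suc n ^ k * (k + 1))) \<le> 560 * (m * (2 ^ m * Q))" .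
  have mm: "m \<le> 2 ^ m" by (rule less_imp_le[OF less_exp])
  have four: "(2::nat) ^ m * 2 ^ m = 4 ^ m" by (simp add: power_mult_distrib[symmetric])
  define R where "R = 4 ^ m * Q"
  have "m * (2 ^ m * Q) \<le> 2 ^ m * (2 ^ m * Q)" using mm by (rule mult_le_mono1)
  also have "\<dots> = R" unfolding R_def four[symmetric] by simp
  finally have r1: "m * (2 ^ m * Q) \<le> R" .
  have "m * Q \<le> m * (2 ^ m * Q)" by (intro mult_le_mono2) simp
  then have r2: "m * Q \<le> R" using r1 by linarith
  have "Q \<le> m * Q" "m \<le> m * Q" using m Q1 by auto
  then have r3: "Q \<le> R" "m \<le> R" using r2 by linarith+
  have "main_steps m n \<le> 602 * R"
    unfolding main_steps_def k_def[symmetric] using s1 s2 r1 r2 r3 k(3) n1 Q1 by linarith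
  then show ?thesis unfolding R_def Q_def k_def by simp
qed

lemma value_bits_le:
  assumes m: "2 \<le> m" and n: "2 \<le> n"
  shows "real (value_bits m n) \<le> 11 * 2 ^ m * log 2 n"
proof -
  define V where "V = 16 * m * (n + 2) ^ 2 * Suc n ^ (m div 2)"
  let ?l = "log 2 (real n)"
  have l: "1 \<le> ?l" using n by simp
  have nn: "n + 2 \<le> n ^ 2" "Suc n \<le> n ^ 2"
  proof -
    have "2 * n \<le> n ^ 2" using n by (simp add: power2_eq_square)
    then show "n + 2 \<le> n ^ 2" "Suc n \<le> n ^ 2" using n by linarith+
  qed
  have mm: "m \<le> 2 ^ m" by (rule less_imp_le[OF less_exp])
  have "Suc n ^ (m div 2) \<le> (n ^ 2) ^ (m div 2)" using nn by (intro power_mono) auto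
  also have "\<dots> = n ^ (2 * (m div 2))" by (simp add: power_mult)
  also have "\<dots> \<le> n ^ m" using n by (intro power_increasing) auto
  finally have p: "Suc n ^ (m div 2) \<le> n ^ m" .
  have m16: "16 * m \<le> 2 ^ 4 * 2 ^ m" using mm by simp
  have sq: "(n + 2) ^ 2 \<le> (n ^ 2) ^ 2" using nn(1) by (rule power_mono) simp
  have "V \<le> 2 ^ 4 * 2 ^ m * (n ^ 2) ^ 2 * n ^ m" unfolding V_def
    by (rule mult_le_mono[OF mult_le_mono[OF m16 sq] p])
  also have "\<dots> = 2 ^ (4 + m) * n ^ (4 + m)" by (simp add: power_add power_mult[symmetric])
  finally have "V \<le> 2 ^ (4 + m) * n ^ (4 + m)" .
  from of_nat_mono[OF this, where ?'a = real]
  have "real V \<le> 2 ^ (4 + m) * real n ^ (4 + m)" by simp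
  moreover have V0: "0 < V" unfolding V_def using m by simp
  ultimately have "log 2 V \<le> log 2 (2 ^ (4 + m) * real n ^ (4 + m))" using n by (intro log_mono) auto
  also have "\<dots> = (4 + m) + (4 + m) * ?l" using n by (simp add: log_mult log_nat_power)
  also have "\<dots> \<le> (4 + m) * ?l + (4 + m) * ?l" using l by simp
  finally have lV: "log 2 V \<le> (8 + 2 * m) * ?l" by (simp add: algebra_simps)
  have "real (floorlog 2 V) \<le> log 2 V + 1"
    using V0 by (simp add: floorlog_def)
  also have "\<dots> \<le> (9 + 2 * real m) * ?l" using lV l by (simp add: algebra_simps)
  also have "\<dots> \<le> (11 * 2 ^ m) * ?l"
  proof (rule mult_right_mono)
    have "real m \<le> 2 ^ m" using of_nat_mono[OF mm, where ?'a = real] by simp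
    moreover have "1 \<le> (2::real) ^ m" by simp
    ultimately show "9 + 2 * real m \<le> 11 * 2 ^ m" by linarith
  qed (use l in simp)
  finally show ?thesis unfolding value_bits_def V_def .
qed

lemma main_time_soft_O: "(\<lambda>m n. real (main_time m n)) \<in> soft_O_m (\<lambda>m n. real n ^ (m div 2 + 1))"
  unfolding soft_O_m_def
proof (intro CollectI exI conjI allI impI)
  fix m n :: nat assume m: "2 \<le> m" and n: "2 \<le> n"
  let ?l = "log 2 (real n)" and ?Q = "real n ^ (m div 2 + 1)"
  have l: "1 \<le> ?l" using n by simp
  have s: "real (main_steps m n) \<le> 602 * 4 ^ m * ?Q"
    using of_nat_mono[OF main_steps_le[OF m n], where ?'a = real] by simp
  have "1 * 1 \<le> 2 ^ m * ?l" using l by (intro mult_mono) auto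
  then have one: "1 \<le> 2 ^ m * ?l" by simp
  have "real (unit_cost (value_bits m n)) = 101 + 5000 * real (value_bits m n)" by (simp add: unit_cost_def)
  also have "\<dots> \<le> 101 * (2 ^ m * ?l) + 5000 * (11 * 2 ^ m * ?l)"
    using value_bits_le[OF m n] one by (intro add_mono) auto
  also have "\<dots> = 55101 * 2 ^ m * ?l" by simp
  finally have u: "real (unit_cost (value_bits m n)) \<le> 55101 * 2 ^ m * ?l" .
  have "real (main_time m n) \<le> (602 * 4 ^ m * ?Q) * (55101 * 2 ^ m * ?l)"
    unfolding main_time_def of_nat_mult using s u by (intro mult_mono) auto
  also have "\<dots> = 602 * 55101 * 8 ^ m * ?l * ?Q" by (simp add: power_mult_distrib[symmetric])
  also have "\<dots> \<le> 602 * 55101 * (8 ^ m * ?l ^ m) * ?l * ?Q"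
    using l one_le_power[OF l, of m] by (intro mult_right_mono mult_left_mono) auto
  finally show "real (main_time m n) \<le> (602 * 55101) * (8 ^ m * ?l ^ m) * ?l ^ 1 * ?Q" by simp
qed simp_all

lemma lcs_length_attained:
  assumes "S \<noteq> []"
  obtains t where "common_subseq t S" "length t = lcs_length S"
proof -
  have "length t \<le> length (hd S)" if "common_subseq t S" for t
    using that assms list_emb_length unfolding common_subseq_def by (metis list.set_sel(1))
  then have "length ` {t. common_subseq t S} \<subseteq> {..length (hd S)}" by auto
  then have "finite (length ` {t. common_subseq t S})" using finite_subset by blast
  moreover have "[] \<in> {t. common_subseq t S}" by (simp add: common_subseq_def)
  ultimately have "lcs_length S \<in> length ` {t. common_subseq t S}"
    unfolding lcs_length_def by (intro Max_in) blast+
  then show ?thesis using that by auto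
qed

lemma main_correct:
  assumes m: "2 \<le> length S" and len: "\<forall>s\<in>set S. length s = n"
  obtains r t where "returns_in_time main S r t" "t \<le> main_time (length S) n" "common_subseq r S"
    "(lcs_length S)\<^sup>2 \<le> 2 * length r * n"
proof -
  let ?m = "length S" and ?B = "value_bits (length S) n"
  interpret lcs_run S n "?m div 2" ?B
  proof
    show "0 < ?m div 2" using m by simp
    show "length (S ! i) = n" if "i < ?m" for i using that len by simp
    have "0 < 16 * ?m * (n + 2) ^ 2 * Suc n ^ (?m div 2)" using m by (intro mult_pos_pos) auto
    then show "16 * ?m * (n + 2) ^ 2 * Suc n ^ (?m div 2) \<le> 2 ^ ?B"
      unfolding value_bits_def using floorlog_bounds[of _ 2] by (simp add: less_imp_le)
  qed simp
  have ne: "S \<noteq> []" using m by auto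
  then have hd: "hd S = S ! 0" by (rule hd_conv_nth)
  obtain t where t: "common_subseq t S" "length t = lcs_length S"
    using lcs_length_attained[OF ne] by blast
  have "subseq t (S ! 0)" using t(1) ne hd unfolding common_subseq_def by (metis list.set_sel(1))
  then obtain Opt where Opt: "Opt \<subseteq> {..<length (S ! 0)}" "nths (S ! 0) Opt = t"
    by (rule subseq_obtain_subset)
  have O1: "Opt \<subseteq> {..<n}" using Opt(1) len0 by simp
  have cO: "card Opt = lcs_length S" using length_nths_subset[OF Opt(1)] Opt(2) t(2) by simp
  have O2: "common Opt" unfolding common_def Opt(2) using t(1) by (simp add: common_subseq_def)
  let ?\<sigma> = "init_state S"
  have "bounded_state ?B ?\<sigma>"
    using B_len B_N len0 hd by (auto simp: bounded_state_def init_state_def)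
  moreover have "flags ?\<sigma> aBest = {}" by (simp add: flags_def init_state_def arr_def)
  moreover have "regs ?\<sigma> 0 = ?m" "regs ?\<sigma> 1 = n" "outp ?\<sigma> = []"
    using hd len0 by (simp_all add: init_state_def)
  moreover have "17 + ?m div 2 * 4 + ?m * n * (n + 2) * 8 + n * 7 + (3 * n + 2) * (140 * round_cost) = main_steps ?m n"
    by (simp only: main_steps_def round_cost_def)
  ultimately obtain u \<tau> where u: "exec S main ?\<sigma> u \<tau>" "u \<le> main_time ?m n"
    "\<exists>T\<subseteq>{..<n}. common T \<and> (card Opt)\<^sup>2 \<le> 2 * card T * n \<and> outp \<tau> = nths (S ! 0) T"
    using ok_main[OF _ _ _ _ O1 O2, of ?\<sigma>] unfolding ok_def main_time_def by metis
  then obtain T where T: "T \<subseteq> {..<n}" "common T" "(card Opt)\<^sup>2 \<le> 2 * card T * n" "outp \<tau> = nths (S ! 0) T"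
    by blast
  have "length (outp \<tau>) = card T" using T(1,4) len0 by (simp add: length_nths_subset)
  moreover have "common_subseq (outp \<tau>) S"
    using T(2,4) by (auto simp: common_subseq_def common_def in_set_conv_nth)
  moreover have "returns_in_time main S (outp \<tau>) u" using u(1) by (auto simp: returns_in_time_def)
  ultimately show ?thesis using that u(2) T(3) cO by simp
qed

theorem theorem1:
  fixes \<epsilon> :: real
  assumes "\<epsilon> > 0"
  shows "\<exists>P :: prog. \<exists>T \<in> soft_O_m (\<lambda>m n. real n ^ (m div 2 + 1)).
    \<forall>(m :: nat) (n :: nat) (S :: 'a list list) (l :: real).
      m \<ge> 2 \<longrightarrow> length S = m \<longrightarrow> (\<forall>s\<in>set S. length s = n) \<longrightarrow>
      l \<in> {0..1} \<longrightarrow> real (lcs_length S) = l * real n \<longrightarrow>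
      (\<exists>r t. returns_in_time P S r t \<and> real t \<le> T m n \<and>
         common_subseq r S \<and>
         real (length r) \<ge> l / (2 + \<epsilon>) * real (lcs_length S))"
proof (intro exI[of _ main] bexI[OF _ main_time_soft_O] allI impI)
  fix m n :: nat and S :: "'a list list" and l :: real
  assume m: "2 \<le> m" "length S = m" and len: "\<forall>s\<in>set S. length s = n" and l: "l \<in> {0..1}"
    and c: "real (lcs_length S) = l * real n"
  obtain r t where r: "returns_in_time main S r t" "t \<le> main_time m n" "common_subseq r S"
    "(lcs_length S)\<^sup>2 \<le> 2 * length r * n"
    using main_correct[of S n] m len by metis
  have "l / (2 + \<epsilon>) * real (lcs_length S) \<le> real (length r)"
  proof (cases "n = 0")
    case False
    have "(l * real n)\<^sup>2 \<le> 2 * real (length r) * real n"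
      using of_nat_mono[OF r(4), where ?'a = real] unfolding c[symmetric] by simp
    then have "(l\<^sup>2 * real n) * real n \<le> (2 * real (length r)) * real n"
      by (simp add: power2_eq_square algebra_simps)
    then have "l\<^sup>2 * real n \<le> 2 * real (length r)" using False by simp
    moreover have "2 * real (length r) \<le> real (length r) * (2 + \<epsilon>)" using assms by (simp add: algebra_simps)
    ultimately have "l\<^sup>2 * real n \<le> real (length r) * (2 + \<epsilon>)" by linarith
    then have "l\<^sup>2 * real n / (2 + \<epsilon>) \<le> real (length r)" using assms by (simp add: divide_le_eq)
    then show ?thesis unfolding c by (simp add: power2_eq_square)
  qed (simp add: c)
  then show "\<exists>r t. returns_in_time main S r t \<and> real t \<le> real (main_time m n) \<and> common_subseq r S \<and>
      l / (2 + \<epsilon>) * real (lcs_length S) \<le> real (length r)"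
    using r by auto
qed

end
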